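(* Let $G=A*_{\varphi}$ be an HNN extension, where $\varphi\colon C\to\varphi(C)$ is an isomorphism between two subgroups of $A$. Suppose that $A$ has the f.c.i.p. relative to $C$, that $(A,C)$ has the $C$-f.g.i.p., and that $C$ has the s.f.g.i.p. Then $G$ has the f.g.i.p. if and only if $G$ has the f.g.i.p. relative to $C$.
   Context: Conventions: $H^g=g^{-1}Hg$; $B\backslash G/C$ is the set of double cosets $BhC$. The HNN extension is $A*_\varphi=\langle A,t\mid t^{-1}ct=\varphi(c),\ c\in C\rangle$. A group $G$ has the f.g.i.p. if the intersection of any two finitely generated subgroups is finitely generated; $G$ has the f.g.i.p. relative to a subgroup $H$ if $K\cap H$ is finitely generated for every finitely generated $K\le G$; $G$ has the s.f.g.i.p. if it has the f.g.i.p. and for all finitely generated $H,K\le G$ there are finitely many double cosets $HgK$ with $H^g\cap K\ne1$. For a subgroup $A\le G$, the pair $(G,A)$ has the $A$-f.g.i.p. if $G$ has the f.g.i.p. and for all finitely generated $H,K\le G$ there are only finitely many double cosets $HgK$ with $g\in A$ and $H^g\cap K\not\le A$. f.c.i.p.: for finitely generated subgroups $A,B,C\le G$ and $f,g\in G$, let $q^A_{f,g}\colon (A\cap B^f)\backslash A/(A\cap C^g)\to B\backslash G/C$ be the (well-defined) map $(A\cap B^f)a(A\cap C^g)\mapsto B\,fag^{-1}\,C$. $G$ has the f.c.i.p. relative to a finitely generated subgroup $A$ if for every pair $B,C$ of finitely generated subgroups of $G$ and all finite sets $\mathcal F,\mathcal G\subset G$ whose elements lie in pairwise distinct $(B,A)$-double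 cosets, respectively $(C,A)$-double cosets, $$\sum_{BhC\in B\backslash G/C}\max\Big\{0,\Big(\sum_{f\in\mathcal F,\,g\in\mathcal G}\big|(q^A_{f,g})^{-1}(BhC)\big|\Big)-1\Big\}<\infty .$$ (The f.c.i.p. relative to a subgroup is only defined for finitely generated subgroups.) *)

theory Defs
  imports "HOL-Analysis.Infinite_Sum" "HOL-Library.Extended_Real" "HOL-Algebra.Generated_Groups"
begin

section \<open>Finitely generated subgroups, conjugates and double cosets\<close>

definition fg_subgroup :: "'a set \<Rightarrow> ('a, 'b) monoid_scheme \<Rightarrow> bool" where
  "fg_subgroup H G \<longleftrightarrow> subgroup H G \<and> (\<exists>S. finite S \<and> S \<subseteq> carrier G \<and> H = generate G S)"

definition conj_subgroup :: "('a, 'b) monoid_scheme \<Rightarrow> 'a set \<Rightarrow> 'a \<Rightarrow> 'a set" where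
  "conj_subgroup G H g = (\<lambda>h. inv\<^bsub>G\<^esub> g \<otimes>\<^bsub>G\<^esub> h \<otimes>\<^bsub>G\<^esub> g) ` H"

definition double_coset :: "('a, 'b) monoid_scheme \<Rightarrow> 'a set \<Rightarrow> 'a \<Rightarrow> 'a set \<Rightarrow> 'a set" where
  "double_coset G H g K = (H #>\<^bsub>G\<^esub> g) <#>\<^bsub>G\<^esub> K"

definition double_cosets :: "('a, 'b) monoid_scheme \<Rightarrow> 'a set \<Rightarrow> 'a set \<Rightarrow> 'a set set" where
  "double_cosets G H K = (\<lambda>g. double_coset G H g K) ` carrier G"


section \<open>Finite intersection properties\<close>

definition fgip :: "('a, 'b) monoid_scheme \<Rightarrow> bool" where
  "fgip G \<longleftrightarrow> (\<forall>H K. fg_subgroup H G \<longrightarrow> fg_subgroup K G \<longrightarrow> fg_subgroup (H \<inter> K) G)"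

definition fgip_rel :: "('a, 'b) monoid_scheme \<Rightarrow> 'a set \<Rightarrow> bool" where
  "fgip_rel G H \<longleftrightarrow> (\<forall>K. fg_subgroup K G \<longrightarrow> fg_subgroup (K \<inter> H) G)"

definition sfgip :: "('a, 'b) monoid_scheme \<Rightarrow> bool" where
  "sfgip G \<longleftrightarrow> fgip G \<and>
     (\<forall>H K. fg_subgroup H G \<longrightarrow> fg_subgroup K G \<longrightarrow>
        finite {double_coset G H g K | g.
                  g \<in> carrier G \<and> conj_subgroup G H g \<inter> K \<noteq> {\<one>\<^bsub>G\<^esub>}})"

definition pair_fgip :: "('a, 'b) monoid_scheme \<Rightarrow> 'a set \<Rightarrow> bool" where
  "pair_fgip G A \<longleftrightarrow> fgip G \<and>
     (\<forall>H K. fg_subgroup H G \<longrightarrow> fg_subgroup K G \<longrightarrow>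
        finite {double_coset G H g K | g. g \<in> A \<and> \<not> conj_subgroup G H g \<inter> K \<subseteq> A})"


section \<open>The finite coset interaction property\<close>

definition ecard :: "'a set \<Rightarrow> enat" where
  "ecard S = (if finite S then enat (card S) else \<infinity>)"

text \<open>
  The map induced on double cosets by \<open>a \<mapsto> B f a g\<inverse> C\<close>; its value does not depend on the chosen
  representative \<open>a\<close> (lemma \<open>coset_map_double_coset\<close> below), so the image set is a singleton.
\<close>

definition coset_map ::
  "('a, 'b) monoid_scheme \<Rightarrow> 'a set \<Rightarrow> 'a set \<Rightarrow> 'a \<Rightarrow> 'a \<Rightarrow> 'a set \<Rightarrow> 'a set" where
  "coset_map G B C f g D =
     the_elem ((\<lambda>a. double_coset G B (f \<otimes>\<^bsub>G\<^esub> a \<otimes>\<^bsub>G\<^esub> inv\<^bsub>G\<^esub> g) C) ` D)"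

definition coset_map_fibre ::
  "('a, 'b) monoid_scheme \<Rightarrow> 'a set \<Rightarrow> 'a set \<Rightarrow> 'a set \<Rightarrow> 'a \<Rightarrow> 'a \<Rightarrow> 'a set \<Rightarrow> 'a set set" where
  "coset_map_fibre G A B C f g X =
     {D \<in> double_cosets (G\<lparr>carrier := A\<rparr>) (A \<inter> conj_subgroup G B f) (A \<inter> conj_subgroup G C g).
        coset_map G B C f g D = X}"

text \<open>
  The sums are taken in \<^typ>\<open>enat\<close>, where every family is summable and \<open>\<infinity> - 1 = \<infinity>\<close>.
\<close>

definition fcip_rel :: "('a, 'b) monoid_scheme \<Rightarrow> 'a set \<Rightarrow> bool" where
  "fcip_rel G A \<longleftrightarrow> fg_subgroup A G \<and>
     (\<forall>B C F F'.
        fg_subgroup B G \<longrightarrow> fg_subgroup C G \<longrightarrow>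
        finite F \<longrightarrow> F \<subseteq> carrier G \<longrightarrow> inj_on (\<lambda>f. double_coset G B f A) F \<longrightarrow>
        finite F' \<longrightarrow> F' \<subseteq> carrier G \<longrightarrow> inj_on (\<lambda>g. double_coset G C g A) F' \<longrightarrow>
        (\<Sum>\<^sub>\<infinity>X\<in>double_cosets G B C.
           max 0 ((\<Sum>f\<in>F. \<Sum>g\<in>F'. ecard (coset_map_fibre G A B C f g X)) - 1)) < \<infinity>)"

lemma double_coset_eq: "double_coset G H g K = {h \<otimes>\<^bsub>G\<^esub> g \<otimes>\<^bsub>G\<^esub> k | h k. h \<in> H \<and> k \<in> K}"
  by (auto simp: double_coset_def r_coset_def set_mult_def)

lemma (in group) double_coset_absorb:
  assumes "subgroup H G" "subgroup K G" "h \<in> H" "k \<in> K" "x \<in> carrier G"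
  shows "double_coset G H (h \<otimes> x \<otimes> k) K = double_coset G H x K"
proof -
  have c: "h \<in> carrier G" "k \<in> carrier G" "H \<subseteq> carrier G" "K \<subseteq> carrier G"
    using assms subgroup.subset by blast+
  show ?thesis
  proof (intro equalityI subsetI)
    fix y assume "y \<in> double_coset G H (h \<otimes> x \<otimes> k) K"
    then obtain h' k' where y: "y = h' \<otimes> (h \<otimes> x \<otimes> k) \<otimes> k'" "h' \<in> H" "k' \<in> K"
      by (auto simp: double_coset_eq)
    moreover have "h' \<in> carrier G" "k' \<in> carrier G" using y c by auto
    ultimately have "y = (h' \<otimes> h) \<otimes> x \<otimes> (k \<otimes> k')"
      using c assms(5) by (simp add: m_assoc)
    moreover have "h' \<otimes> h \<in> H" "k \<otimes> k' \<in> K"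
      using y assms by (auto simp: subgroup.m_closed)
    ultimately show "y \<in> double_coset G H x K" unfolding double_coset_eq by blast
  next
    fix y assume "y \<in> double_coset G H x K"
    then obtain h' k' where y: "y = h' \<otimes> x \<otimes> k'" "h' \<in> H" "k' \<in> K"
      by (auto simp: double_coset_eq)
    moreover have h'k': "h' \<in> carrier G" "k' \<in> carrier G" using y c by auto
    moreover have "k \<otimes> (inv k \<otimes> k') = k'" using h'k' c by (simp add: m_assoc[symmetric])
    moreover have "inv h \<otimes> (h \<otimes> (x \<otimes> k')) = x \<otimes> k'"
      using h'k' c assms(5) by (simp add: m_assoc[symmetric])
    ultimately have "y = (h' \<otimes> inv h) \<otimes> (h \<otimes> x \<otimes> k) \<otimes> (inv k \<otimes> k')"
      using c assms(5) by (simp add: m_assoc)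
    moreover have "h' \<otimes> inv h \<in> H" "inv k \<otimes> k' \<in> K"
      using y assms by (auto simp: subgroup.m_closed subgroup.m_inv_closed)
    ultimately show "y \<in> double_coset G H (h \<otimes> x \<otimes> k) K" unfolding double_coset_eq by blast
  qed
qed

lemma (in group) coset_map_double_coset:
  assumes "subgroup A G" "subgroup B G" "subgroup C G"
    and "f \<in> carrier G" "g \<in> carrier G" "a \<in> A"
  shows "coset_map G B C f g
           (double_coset (G\<lparr>carrier := A\<rparr>) (A \<inter> conj_subgroup G B f) a (A \<inter> conj_subgroup G C g))
         = double_coset G B (f \<otimes> a \<otimes> inv g) C"
proof -
  let ?D = "double_coset (G\<lparr>carrier := A\<rparr>) (A \<inter> conj_subgroup G B f) a (A \<inter> conj_subgroup G C g)"
  have a: "a \<in> carrier G" using assms subgroup.subset by blast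
  have "double_coset G B (f \<otimes> x \<otimes> inv g) C = double_coset G B (f \<otimes> a \<otimes> inv g) C"
    if "x \<in> ?D" for x
  proof -
    from that obtain b c where bc: "b \<in> B" "c \<in> C"
      and x: "x = (inv f \<otimes> b \<otimes> f) \<otimes> a \<otimes> (inv g \<otimes> c \<otimes> g)"
      by (auto simp: double_coset_eq conj_subgroup_def)
    have cc: "b \<in> carrier G" "c \<in> carrier G"
      using bc assms subgroup.subset by blast+
    have "\<And>z. z \<in> carrier G \<Longrightarrow> f \<otimes> (inv f \<otimes> z) = z"
      using assms(4) by (simp add: m_assoc[symmetric])
    hence "f \<otimes> x \<otimes> inv g = b \<otimes> (f \<otimes> a \<otimes> inv g) \<otimes> c"
      using assms(4,5) a cc by (simp add: x m_assoc)
    thus ?thesis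
      using double_coset_absorb[OF assms(2,3) bc, of "f \<otimes> a \<otimes> inv g"] assms(4,5) a by simp
  qed
  moreover have "a \<in> ?D"
  proof -
    have one: "\<one> \<in> A \<inter> conj_subgroup G H h" if "subgroup H G" "h \<in> carrier G" for H h
    proof -
      have "inv h \<otimes> \<one> \<otimes> h = \<one>" using that by simp
      thus ?thesis using that assms(1) unfolding conj_subgroup_def
        by (metis IntI image_eqI subgroup.one_closed)
    qed
    have "a = \<one> \<otimes> a \<otimes> \<one>" using a by simp
    thus ?thesis
      using one[OF assms(2,4)] one[OF assms(3,5)] unfolding double_coset_eq
      by (auto intro!: exI[of _ \<one>])
  qed
  ultimately have "(\<lambda>x. double_coset G B (f \<otimes> x \<otimes> inv g) C) ` ?D = {double_coset G B (f \<otimes> a \<otimes> inv g) C}"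
    by blast
  thus ?thesis unfolding coset_map_def by simp
qed


section \<open>HNN extensions\<close>

datatype 'a hnn_letter = Base 'a | Stable | StableInv

definition hnn_words :: "('a, 'b) monoid_scheme \<Rightarrow> 'a hnn_letter list set" where
  "hnn_words A = lists (Base ` carrier A \<union> {Stable, StableInv})"

inductive_set hnn_cong ::
  "('a, 'b) monoid_scheme \<Rightarrow> 'a set \<Rightarrow> ('a \<Rightarrow> 'a) \<Rightarrow> ('a hnn_letter list \<times> 'a hnn_letter list) set"
  for A C \<phi> where
  refl: "u \<in> hnn_words A \<Longrightarrow> (u, u) \<in> hnn_cong A C \<phi>"
| sym: "(u, v) \<in> hnn_cong A C \<phi> \<Longrightarrow> (v, u) \<in> hnn_cong A C \<phi>"
| trans: "(u, v) \<in> hnn_cong A C \<phi> \<Longrightarrow> (v, w) \<in> hnn_cong A C \<phi> \<Longrightarrow> (u, w) \<in> hnn_cong A C \<phi>"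
| append: "(u, u') \<in> hnn_cong A C \<phi> \<Longrightarrow> (v, v') \<in> hnn_cong A C \<phi> \<Longrightarrow>
    (u @ v, u' @ v') \<in> hnn_cong A C \<phi>"
| base_one: "([Base \<one>\<^bsub>A\<^esub>], []) \<in> hnn_cong A C \<phi>"
| base_mult: "a \<in> carrier A \<Longrightarrow> b \<in> carrier A \<Longrightarrow>
    ([Base a, Base b], [Base (a \<otimes>\<^bsub>A\<^esub> b)]) \<in> hnn_cong A C \<phi>"
| stable_inv: "([Stable, StableInv], []) \<in> hnn_cong A C \<phi>"
| inv_stable: "([StableInv, Stable], []) \<in> hnn_cong A C \<phi>"
| relator: "c \<in> C \<Longrightarrow> ([StableInv, Base c, Stable], [Base (\<phi> c)]) \<in> hnn_cong A C \<phi>"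

definition hnn_class ::
  "('a, 'b) monoid_scheme \<Rightarrow> 'a set \<Rightarrow> ('a \<Rightarrow> 'a) \<Rightarrow> 'a hnn_letter list \<Rightarrow> 'a hnn_letter list set" where
  "hnn_class A C \<phi> u = hnn_cong A C \<phi> `` {u}"

text \<open>
  The group presented by \<open>\<langle>A, t | t\<inverse> c t = \<phi> c (c \<in> C)\<rangle>\<close>, where \<open>\<langle>A, \<dots>\<rangle>\<close> includes the
  multiplication table of \<open>A\<close>. The stable letter \<open>t\<close> is the class of \<open>[Stable]\<close>.
\<close>

definition hnn_extension ::
  "('a, 'b) monoid_scheme \<Rightarrow> 'a set \<Rightarrow> ('a \<Rightarrow> 'a) \<Rightarrow> 'a hnn_letter list set monoid" where
  "hnn_extension A C \<phi> =
     \<lparr>carrier = hnn_words A // hnn_cong A C \<phi>,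
      mult = (\<lambda>X Y. \<Union>u\<in>X. \<Union>v\<in>Y. hnn_class A C \<phi> (u @ v)),
      one = hnn_class A C \<phi> []\<rparr>"

definition hnn_base ::
  "('a, 'b) monoid_scheme \<Rightarrow> 'a set \<Rightarrow> ('a \<Rightarrow> 'a) \<Rightarrow> 'a \<Rightarrow> 'a hnn_letter list set" where
  "hnn_base A C \<phi> a = hnn_class A C \<phi> [Base a]"

locale hnn_data = group A for A (structure) +
  fixes C :: "'a set" and \<phi> :: "'a \<Rightarrow> 'a"
  assumes C_sub: "C \<subseteq> carrier A" and \<phi>_closed: "c \<in> C \<Longrightarrow> \<phi> c \<in> carrier A"
begin

lemma hnn_cong_words: "(u, v) \<in> hnn_cong A C \<phi> \<Longrightarrow> u \<in> hnn_words A \<and> v \<in> hnn_words A"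
  by (induction rule: hnn_cong.induct) (use C_sub \<phi>_closed in \<open>auto simp: hnn_words_def\<close>)

lemma equiv_hnn_cong: "equiv (hnn_words A) (hnn_cong A C \<phi>)"
proof (rule equivI)
  show "hnn_cong A C \<phi> \<subseteq> hnn_words A \<times> hnn_words A" using hnn_cong_words by auto
  show "refl_on (hnn_words A) (hnn_cong A C \<phi>)" by (simp add: refl_on_def hnn_cong.refl)
  show "sym (hnn_cong A C \<phi>)" by (rule symI) (rule hnn_cong.sym)
  show "trans (hnn_cong A C \<phi>)" by (rule transI) (rule hnn_cong.trans)
qed

lemma hnn_class_eq_iff:
  assumes "u \<in> hnn_words A" "v \<in> hnn_words A"
  shows "hnn_class A C \<phi> u = hnn_class A C \<phi> v \<longleftrightarrow> (u, v) \<in> hnn_cong A C \<phi>"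
  unfolding hnn_class_def using eq_equiv_class_iff[OF equiv_hnn_cong assms] by simp

lemma carrier_hnn: "carrier (hnn_extension A C \<phi>) = hnn_class A C \<phi> ` hnn_words A"
  by (auto simp: hnn_extension_def hnn_class_def quotient_def)

lemma one_hnn: "\<one>\<^bsub>hnn_extension A C \<phi>\<^esub> = hnn_class A C \<phi> []"
  by (simp add: hnn_extension_def)

lemma words_append: "u \<in> hnn_words A \<Longrightarrow> v \<in> hnn_words A \<Longrightarrow> u @ v \<in> hnn_words A"
  by (simp add: hnn_words_def)

lemma mult_hnn:
  assumes "u \<in> hnn_words A" "v \<in> hnn_words A"
  shows "hnn_class A C \<phi> u \<otimes>\<^bsub>hnn_extension A C \<phi>\<^esub> hnn_class A C \<phi> v = hnn_class A C \<phi> (u @ v)"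
proof -
  have "hnn_class A C \<phi> (x @ y) = hnn_class A C \<phi> (u @ v)"
    if "x \<in> hnn_class A C \<phi> u" "y \<in> hnn_class A C \<phi> v" for x y
  proof -
    have "(u, x) \<in> hnn_cong A C \<phi>" "(v, y) \<in> hnn_cong A C \<phi>"
      using that by (auto simp: hnn_class_def)
    hence "(x @ y, u @ v) \<in> hnn_cong A C \<phi>" by (blast intro: hnn_cong.append hnn_cong.sym)
    thus ?thesis using hnn_cong_words hnn_class_eq_iff by blast
  qed
  moreover have "u \<in> hnn_class A C \<phi> u" "v \<in> hnn_class A C \<phi> v"
    using assms by (auto simp: hnn_class_def hnn_cong.refl)
  ultimately have "(\<Union>x\<in>hnn_class A C \<phi> u. \<Union>y\<in>hnn_class A C \<phi> v. hnn_class A C \<phi> (x @ y))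
      = hnn_class A C \<phi> (u @ v)"
    by (intro equalityI UN_least) blast+
  thus ?thesis by (simp add: hnn_extension_def)
qed

lemma ex_left_inverse_word:
  "u \<in> hnn_words A \<Longrightarrow> \<exists>v \<in> hnn_words A. (v @ u, []) \<in> hnn_cong A C \<phi>"
proof (induction u)
  case Nil
  show ?case by (intro bexI[of _ "[]"]) (auto simp: hnn_words_def intro: hnn_cong.refl)
next
  case (Cons x u)
  then obtain v where v: "v \<in> hnn_words A" "(v @ u, []) \<in> hnn_cong A C \<phi>" and u: "u \<in> hnn_words A"
    by (auto simp: hnn_words_def)
  have "\<exists>y. [y] \<in> hnn_words A \<and> ([y, x], []) \<in> hnn_cong A C \<phi>"
  proof (cases x)
    case (Base a)
    hence a: "a \<in> carrier A" using Cons.prems by (auto simp: hnn_words_def)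
    hence "([Base (inv a), Base a], [Base \<one>]) \<in> hnn_cong A C \<phi>"
      using hnn_cong.base_mult[of "inv a" A a C \<phi>] by simp
    hence "([Base (inv a), x], []) \<in> hnn_cong A C \<phi>"
      unfolding Base by (rule hnn_cong.trans) (rule hnn_cong.base_one)
    thus ?thesis using a by (intro exI[of _ "Base (inv a)"]) (auto simp: hnn_words_def)
  next
    case Stable
    thus ?thesis
      by (intro exI[of _ StableInv]) (auto simp: hnn_words_def intro: hnn_cong.inv_stable)
  next
    case StableInv
    thus ?thesis
      by (intro exI[of _ Stable]) (auto simp: hnn_words_def intro: hnn_cong.stable_inv)
  qed
  then obtain y where y: "[y] \<in> hnn_words A" "([y, x], []) \<in> hnn_cong A C \<phi>" by blast
  have "(v @ ([y, x] @ u), v @ ([] @ u)) \<in> hnn_cong A C \<phi>"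
    by (intro hnn_cong.append hnn_cong.refl v u y)
  hence "((v @ [y]) @ x # u, v @ u) \<in> hnn_cong A C \<phi>" by simp
  hence "((v @ [y]) @ x # u, []) \<in> hnn_cong A C \<phi>"
    by (rule hnn_cong.trans) (rule v(2))
  thus ?case using v(1) y(1) words_append by blast
qed

theorem group_hnn_extension: "group (hnn_extension A C \<phi>)"
proof (rule groupI)
  let ?G = "hnn_extension A C \<phi>"
  have nil: "[] \<in> hnn_words A" by (simp add: hnn_words_def)
  show "\<one>\<^bsub>?G\<^esub> \<in> carrier ?G" using nil by (auto simp: one_hnn carrier_hnn)
  fix x assume "x \<in> carrier ?G"
  then obtain u where u: "u \<in> hnn_words A" "x = hnn_class A C \<phi> u" by (auto simp: carrier_hnn)
  show "\<one>\<^bsub>?G\<^esub> \<otimes>\<^bsub>?G\<^esub> x = x" using u nil by (simp add: one_hnn mult_hnn)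
  obtain v where v: "v \<in> hnn_words A" "(v @ u, []) \<in> hnn_cong A C \<phi>"
    using ex_left_inverse_word u by blast
  hence "hnn_class A C \<phi> v \<otimes>\<^bsub>?G\<^esub> x = \<one>\<^bsub>?G\<^esub>"
    using u nil words_append by (simp add: one_hnn mult_hnn hnn_class_eq_iff)
  thus "\<exists>y\<in>carrier ?G. y \<otimes>\<^bsub>?G\<^esub> x = \<one>\<^bsub>?G\<^esub>" using v by (auto simp: carrier_hnn)
next
  fix x y assume "x \<in> carrier (hnn_extension A C \<phi>)" "y \<in> carrier (hnn_extension A C \<phi>)"
  thus "x \<otimes>\<^bsub>hnn_extension A C \<phi>\<^esub> y \<in> carrier (hnn_extension A C \<phi>)"
    by (auto simp: carrier_hnn mult_hnn words_append)
qed (auto simp: carrier_hnn mult_hnn words_append)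

lemma hnn_base_hom: "hnn_base A C \<phi> \<in> hom A (hnn_extension A C \<phi>)"
proof (rule homI)
  show "hnn_base A C \<phi> a \<in> carrier (hnn_extension A C \<phi>)" if "a \<in> carrier A" for a
    using that by (auto simp: hnn_base_def carrier_hnn hnn_words_def)
  show "hnn_base A C \<phi> (a \<otimes> b) =
      hnn_base A C \<phi> a \<otimes>\<^bsub>hnn_extension A C \<phi>\<^esub> hnn_base A C \<phi> b"
    if "a \<in> carrier A" "b \<in> carrier A" for a b
    using that hnn_cong.sym[OF hnn_cong.base_mult[of a A b C \<phi>]]
    by (simp add: hnn_base_def mult_hnn hnn_words_def hnn_class_eq_iff)
qed

lemma hnn_relation:
  assumes "c \<in> C"
  defines "G \<equiv> hnn_extension A C \<phi>" and "t \<equiv> hnn_class A C \<phi> [Stable]"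
  shows "inv\<^bsub>G\<^esub> t \<otimes>\<^bsub>G\<^esub> hnn_base A C \<phi> c \<otimes>\<^bsub>G\<^esub> t = hnn_base A C \<phi> (\<phi> c)"
proof -
  interpret G: group G unfolding G_def by (rule group_hnn_extension)
  let ?t' = "hnn_class A C \<phi> [StableInv]"
  have c: "c \<in> carrier A" "\<phi> c \<in> carrier A" using assms(1) C_sub \<phi>_closed by auto
  have "t \<in> carrier G" "?t' \<in> carrier G" "?t' \<otimes>\<^bsub>G\<^esub> t = \<one>\<^bsub>G\<^esub>"
    using hnn_cong.inv_stable[of A C \<phi>]
    by (auto simp: G_def t_def carrier_hnn mult_hnn one_hnn hnn_words_def hnn_class_eq_iff)
  hence "inv\<^bsub>G\<^esub> t = ?t'" by (simp add: G.inv_equality)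
  thus ?thesis
    using hnn_cong.relator[OF assms(1), where A = A and \<phi> = \<phi>] c
    by (simp add: G_def t_def hnn_base_def mult_hnn hnn_words_def hnn_class_eq_iff)
qed

text \<open>The universal property of the presentation.\<close>

theorem hnn_extension_lift:
  fixes H :: "('c, 'd) monoid_scheme"
  assumes "group H" and \<psi>: "\<psi> \<in> hom A H" and s: "s \<in> carrier H"
    and rel: "\<And>c. c \<in> C \<Longrightarrow> inv\<^bsub>H\<^esub> s \<otimes>\<^bsub>H\<^esub> \<psi> c \<otimes>\<^bsub>H\<^esub> s = \<psi> (\<phi> c)"
  shows "\<exists>h \<in> hom (hnn_extension A C \<phi>) H.
           (\<forall>a \<in> carrier A. h (hnn_base A C \<phi> a) = \<psi> a) \<and> h (hnn_class A C \<phi> [Stable]) = s"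
proof -
  interpret H: group H by fact
  define val where "val = rec_hnn_letter \<psi> s (inv\<^bsub>H\<^esub> s)"
  define ev where "ev = (\<lambda>u. foldr (\<lambda>x y. val x \<otimes>\<^bsub>H\<^esub> y) u \<one>\<^bsub>H\<^esub>)"
  have val [simp]: "val (Base a) = \<psi> a" "val Stable = s" "val StableInv = inv\<^bsub>H\<^esub> s" for a
    by (simp_all add: val_def)
  have ev_simps [simp]: "ev [] = \<one>\<^bsub>H\<^esub>" "ev (x # u) = val x \<otimes>\<^bsub>H\<^esub> ev u" for x u
    by (simp_all add: ev_def)
  have \<psi>_closed: "\<psi> a \<in> carrier H" if "a \<in> carrier A" for a
    using \<psi> that by (auto simp: hom_def)
  have \<psi>_mult: "\<psi> (a \<otimes>\<^bsub>A\<^esub> b) = \<psi> a \<otimes>\<^bsub>H\<^esub> \<psi> b" if "a \<in> carrier A" "b \<in> carrier A" for a b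
    using \<psi> that by (auto simp: hom_def)
  have \<psi>_one: "\<psi> \<one>\<^bsub>A\<^esub> = \<one>\<^bsub>H\<^esub>"
    using \<psi> H.is_group group_axioms by (intro hom_one)
  have val_closed: "val x \<in> carrier H" if "x \<in> Base ` carrier A \<union> {Stable, StableInv}" for x
    using that s \<psi>_closed by auto
  have ev_closed: "ev u \<in> carrier H" if "u \<in> hnn_words A" for u
    using that unfolding hnn_words_def by (induction u) (use val_closed in simp_all)
  have ev_append: "ev (u @ v) = ev u \<otimes>\<^bsub>H\<^esub> ev v" if "u \<in> hnn_words A" "v \<in> hnn_words A" for u v
    using that(1) unfolding hnn_words_def
  proof (induction u)
    case Nil
    show ?case using ev_closed[OF that(2)] by simp
  next
    case (Cons x u)
    hence "ev u \<in> carrier H" "val x \<in> carrier H"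
      using ev_closed[of u] val_closed[of x] by (simp_all add: hnn_words_def)
    thus ?case using Cons ev_closed[OF that(2)] by (simp add: H.m_assoc)
  qed
  have ev_cong: "ev u = ev v" if "(u, v) \<in> hnn_cong A C \<phi>" for u v
    using that
  proof (induction rule: hnn_cong.induct)
    case (append u u' v v')
    thus ?case using ev_append hnn_cong_words by metis
  next
    case (relator c)
    hence "c \<in> carrier A" "\<phi> c \<in> carrier A" using C_sub \<phi>_closed by auto
    thus ?case using rel[OF relator] s \<psi>_closed by (simp add: H.m_assoc)
  qed (use s \<psi>_closed \<psi>_mult \<psi>_one in simp_all)
  define h where "h = (\<lambda>X. the_elem (ev ` X))"
  have h: "h (hnn_class A C \<phi> u) = ev u" if "u \<in> hnn_words A" for u
  proof -
    have "u \<in> hnn_class A C \<phi> u" using that by (simp add: hnn_class_def hnn_cong.refl)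
    moreover have "ev v = ev u" if "v \<in> hnn_class A C \<phi> u" for v
      using that ev_cong by (auto simp: hnn_class_def)
    ultimately have "ev ` hnn_class A C \<phi> u = {ev u}" by blast
    thus ?thesis by (simp add: h_def)
  qed
  have "h \<in> hom (hnn_extension A C \<phi>) H"
  proof (rule homI)
    show "h X \<in> carrier H" if "X \<in> carrier (hnn_extension A C \<phi>)" for X
      using that ev_closed by (auto simp: carrier_hnn h)
    show "h (X \<otimes>\<^bsub>hnn_extension A C \<phi>\<^esub> Y) = h X \<otimes>\<^bsub>H\<^esub> h Y"
      if "X \<in> carrier (hnn_extension A C \<phi>)" "Y \<in> carrier (hnn_extension A C \<phi>)" for X Y
      using that by (auto simp: carrier_hnn h mult_hnn words_append ev_append)
  qed
  moreover have "h (hnn_base A C \<phi> a) = \<psi> a" if "a \<in> carrier A" for a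
    using that \<psi>_closed by (simp add: hnn_base_def h hnn_words_def)
  moreover have "h (hnn_class A C \<phi> [Stable]) = s"
    using s by (simp add: h hnn_words_def)
  ultimately show ?thesis by blast
qed

end

end

theory Submission
  imports Defs "HOL-Algebra.Bij"
begin

text \<open>
  One implication is immediate: \<open>C\<close> is finitely generated because \<open>A\<close> has the f.c.i.p. relative to
  it, so its image in the HNN extension \<open>G\<close> is one of the subgroups the f.g.i.p. speaks about. For
  the converse \<open>G\<close> acts on its Bass--Serre tree: vertices are the left cosets of the image of \<open>A\<close>,
  edges are the left cosets of the image \<open>E\<close> of \<open>C\<close>, and the edge \<open>xE\<close> runs from \<open>xA\<close> to \<open>xtA\<close>.
  That this graph is a tree enters only through the finite set \<open>d g\<close> of edges on the geodesic from
  \<open>A\<close> to \<open>gA\<close>. Modulo 2 these sets satisfy \<open>d (gh) = d g + g d h\<close>, with \<open>d\<close> trivial on \<open>A\<close> and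
  \<open>d t = {E}\<close>; such a \<open>d\<close> exists by the universal property of the presentation
  (\<open>hnn_tree_structure\<close>), without any normal form. The replacement for ``a tree has no
  cycles'' is that the chain \<open>d g\<close> has boundary \<open>A + gA\<close> (\<open>odd_card_separates_iff\<close>). The hypotheses on \<open>A\<close>
  apply to the vertex groups because \<open>A\<close> embeds in \<open>G\<close>, by a permutation representation
  (\<open>hnn_base_inj\<close>).

  Vertex groups. If \<open>H\<close> is finitely generated and all its edge groups \<open>H \<inter> xEx\<inverse>\<close> are finitely
  generated, as they are by the f.g.i.p. relative to \<open>C\<close>, then \<open>H \<inter> A\<close> is finitely generated (\<open>fgip_rel_base\<close>). The
  subtree \<open>H\<close> spans has finitely many edges modulo \<open>H\<close>, so a finitely generated \<open>P \<le> H \<inter> A\<close> controls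
  how they attach to the vertex \<open>A\<close>. Splitting this vertex into the cosets of \<open>P\<close> keeps the graph
  connected, but splitting a vertex of a tree disconnects it unless \<open>P\<close> is everything.

  Intersections. Let \<open>L = H \<inter> K\<close> act on the subtree spanned by the orbit of the base vertex. It lies
  in the subtrees of \<open>H\<close> and of \<open>K\<close>, which have finitely many edges modulo \<open>H\<close> and modulo \<open>K\<close>; so the
  edges modulo \<open>L\<close> are distributed over finitely many double coset spaces. Up to finitely many
  \<open>L\<close>-orbits, the s.f.g.i.p. of \<open>C\<close> makes the edge groups trivial, the \<open>C\<close>-f.g.i.p. and the f.c.i.p. put the
  group of the source of an edge into the edge group, and by the f.c.i.p. the source has only one
  orbit of outgoing edges, hence, its group being trivial, only one outgoing edge. So all
  edges outside finitely many \<open>L\<close>-orbits are good: the source has trivial stabiliser and no other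
  way out (\<open>bad_edges\<close>).

  Following the good edges is a deterministic flow on the vertices that commutes with \<open>L\<close>.
  Identify two vertices when their trajectories merge. The bad edges connect the resulting classes,
  with finitely many orbits; the stabiliser of a class is a vertex group if the trajectories stop, and
  cyclic if they run forever. So \<open>L\<close> acts on a connected graph with finitely many orbits of edges
  and finitely generated vertex groups, and is finitely generated (\<open>fg_subgroup_if_flow\<close>).
\<close>

text \<open>Here \<open><#\<close> always forms a left coset; read also as strict inclusion of multisets it would make
  every coset ambiguous.\<close>

no_notation (ASCII) subset_mset (infix \<open><#\<close> 50)

section \<open>Finitely generated subgroups\<close>

lemma fg_subgroupD: "fg_subgroup H G \<Longrightarrow> subgroup H G"
  by (simp add: fg_subgroup_def)

context group
begin

lemma cancel_left:
  assumes "x \<in> carrier G" "y \<in> carrier G"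
  shows "inv x \<otimes> (x \<otimes> y) = y" "x \<otimes> (inv x \<otimes> y) = y"
  using assms by (simp_all add: m_assoc[symmetric])

lemma fg_subgroup_generate: "finite S \<Longrightarrow> S \<subseteq> carrier G \<Longrightarrow> fg_subgroup (generate G S) G"
  using generate_is_subgroup by (auto simp: fg_subgroup_def)

lemma fg_subgroup_conj:
  assumes "fg_subgroup H G" "x \<in> carrier G"
  shows "fg_subgroup ((\<lambda>h. x \<otimes> h \<otimes> inv x) ` H) G"
proof -
  let ?f = "\<lambda>h. x \<otimes> h \<otimes> inv x"
  from assms obtain S where S: "finite S" "S \<subseteq> carrier G" "H = generate G S"
    by (auto simp: fg_subgroup_def)
  have "?f \<in> hom G G"
    using assms(2) by (auto simp: hom_def m_assoc cancel_left)
  then interpret f: group_hom G G ?f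
    by (simp add: group_hom_def group_hom_axioms_def is_group)
  have "?f ` H = generate G (?f ` S)"
    using f.generate_img S by simp
  moreover have "?f ` S \<subseteq> carrier G" using S assms(2) by auto
  ultimately show ?thesis using S fg_subgroup_generate[of "?f ` S"] by auto
qed

text \<open>
  Each piece \<open>X j\<close> may be an infinite set, such as a coset of a finitely generated subgroup; it is
  enough that finitely many elements of the group generated by all pieces capture it.
\<close>

lemma fg_subgroup_finite_Un:
  assumes "finite I" "\<And>j. j \<in> I \<Longrightarrow> \<exists>S. finite S \<and> S \<subseteq> carrier G \<and> S \<subseteq> P \<and> X j \<subseteq> generate G S"
    and P: "P = generate G (\<Union>j\<in>I. X j)" and X: "(\<Union>j\<in>I. X j) \<subseteq> carrier G"
  shows "fg_subgroup P G"
proof -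
  obtain S where S: "\<And>j. j \<in> I \<Longrightarrow> finite (S j) \<and> S j \<subseteq> carrier G \<and> S j \<subseteq> P \<and> X j \<subseteq> generate G (S j)"
    using assms(2) by metis
  have sP: "subgroup P G" unfolding P using X by (rule generate_is_subgroup)
  have S': "(\<Union>j\<in>I. S j) \<subseteq> carrier G" using S by blast
  have "P = generate G (\<Union>j\<in>I. S j)"
  proof
    show "generate G (\<Union>j\<in>I. S j) \<subseteq> P" by (rule generate_subgroup_incl[OF _ sP]) (use S in blast)
    have "X j \<subseteq> generate G (\<Union>j\<in>I. S j)" if "j \<in> I" for j
      using S[OF that] mono_generate[of "S j" "\<Union>j\<in>I. S j"] that by blast
    thus "P \<subseteq> generate G (\<Union>j\<in>I. S j)" unfolding P
      by (intro generate_subgroup_incl[OF _ generate_is_subgroup[OF S']]) blast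
  qed
  thus ?thesis using fg_subgroup_generate[OF _ S'] S assms(1) by auto
qed

end

lemma fg_subgroup_hom_image:
  assumes "group G" "group A" "i \<in> hom A G" "fg_subgroup B A"
  shows "fg_subgroup (i ` B) G"
proof -
  interpret i: group_hom A G i using assms by (simp add: group_hom_def group_hom_axioms_def)
  from assms obtain S where S: "finite S" "S \<subseteq> carrier A" "B = generate A S"
    by (auto simp: fg_subgroup_def)
  have "i ` S \<subseteq> carrier G" using S by auto
  thus ?thesis using i.generate_img[OF S(2)] S i.H.fg_subgroup_generate[of "i ` S"] by simp
qed

text \<open>An injective homomorphism reflects finite generation: generators of the image come from
  unique generators upstairs.\<close>

lemma fg_subgroup_vimage:
  assumes "group G" "group A" "i \<in> hom A G" "inj_on i (carrier A)"
    and "fg_subgroup (H \<inter> i ` carrier A) G"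
  shows "fg_subgroup {a \<in> carrier A. i a \<in> H} A"
proof -
  interpret i: group_hom A G i using assms by (simp add: group_hom_def group_hom_axioms_def)
  from assms(5) obtain S where S: "finite S" "S \<subseteq> carrier G" "H \<inter> i ` carrier A = generate G S"
    by (auto simp: fg_subgroup_def)
  have "S \<subseteq> i ` carrier A" using S(3) generate.incl[of _ S G] by blast
  then obtain T where T: "T \<subseteq> carrier A" "finite T" "S = i ` T"
    using finite_subset_image[OF S(1)] by metis
  have "i ` generate A T = H \<inter> i ` carrier A" using i.generate_img[OF T(1)] T S by simp
  moreover have "i ` {a \<in> carrier A. i a \<in> H} = H \<inter> i ` carrier A" by auto
  moreover have "generate A T \<subseteq> carrier A" using i.G.generate_incl[OF T(1)] .
  ultimately have "{a \<in> carrier A. i a \<in> H} = generate A T"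
    using inj_on_image_eq_iff[OF assms(4), of "{a \<in> carrier A. i a \<in> H}" "generate A T"] by auto
  thus ?thesis using i.G.fg_subgroup_generate[OF T(2,1)] by simp
qed

lemma (in group) fg_subgroup_subgroup_iff:
  assumes "subgroup C G" "B \<subseteq> C"
  shows "fg_subgroup B (G\<lparr>carrier := C\<rparr>) \<longleftrightarrow> fg_subgroup B G"
proof -
  interpret C: group "G\<lparr>carrier := C\<rparr>" using assms subgroup_imp_group by blast
  show ?thesis
  proof
    assume "fg_subgroup B (G\<lparr>carrier := C\<rparr>)"
    then obtain S where S: "finite S" "S \<subseteq> C" "B = generate (G\<lparr>carrier := C\<rparr>) S"
      by (auto simp: fg_subgroup_def)
    thus "fg_subgroup B G" using generate_consistent[OF S(2) assms(1)] subgroup.subset[OF assms(1)]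
        fg_subgroup_generate[of S] by auto
  next
    assume "fg_subgroup B G"
    then obtain S where S: "finite S" "S \<subseteq> carrier G" "B = generate G S"
      by (auto simp: fg_subgroup_def)
    hence "S \<subseteq> C" using assms(2) generate.incl[of _ S G] by blast
    thus "fg_subgroup B (G\<lparr>carrier := C\<rparr>)"
      using generate_consistent[OF _ assms(1)] S C.fg_subgroup_generate[of S] by auto
  qed
qed

lemma finite_representatives:
  assumes "finite (f ` X)"
  obtains Y where "finite Y" "Y \<subseteq> X" "\<And>x. x \<in> X \<Longrightarrow> \<exists>y\<in>Y. f x = f y"
proof -
  obtain Y where "Y \<subseteq> X" "finite Y" "f ` X = f ` Y"
    using finite_subset_image[OF assms order.refl] by metis
  thus ?thesis using that by (metis (no_types, lifting) imageE imageI)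
qed

section \<open>A criterion for finite generation\<close>

lemma funpow_merge:
  fixes F :: "'v \<Rightarrow> 'v"
  assumes "(F ^^ a) u = (F ^^ b) w"
  shows "(F ^^ (n + a)) u = (F ^^ (n + b)) w"
  using assms by (simp add: funpow_add)

text \<open>
  A group acting on a connected graph with finitely many orbits of edges and finitely generated vertex
  groups is finitely generated. The graph here is the quotient of \<open>V\<close> in which two points are
  identified when their trajectories under \<open>F\<close> merge; its edges are the translates of the pairs in
  \<open>Bd\<close>, and \<open>conn\<close> expresses its connectedness: a set of vertices that respects the flow and these
  edges contains the whole orbit of \<open>base\<close> as soon as it contains \<open>base\<close>. The group of a class is
  finitely generated because every point is fixed by the flow or has trivial stabiliser.
\<close>

lemma (in group) fg_subgroup_if_flow:
  fixes V :: "'v set" and act :: "'a \<Rightarrow> 'v \<Rightarrow> 'v" and F :: "'v \<Rightarrow> 'v"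
  assumes L: "subgroup L G"
    and act_closed: "\<And>l v. l \<in> L \<Longrightarrow> v \<in> V \<Longrightarrow> act l v \<in> V"
    and act_one: "\<And>v. v \<in> V \<Longrightarrow> act \<one> v = v"
    and act_mult: "\<And>l m v. l \<in> L \<Longrightarrow> m \<in> L \<Longrightarrow> v \<in> V \<Longrightarrow> act (l \<otimes> m) v = act l (act m v)"
    and F_closed: "\<And>v. v \<in> V \<Longrightarrow> F v \<in> V"
    and F_act: "\<And>l v. l \<in> L \<Longrightarrow> v \<in> V \<Longrightarrow> F (act l v) = act l (F v)"
    and F_free: "\<And>v l. v \<in> V \<Longrightarrow> F v \<noteq> v \<Longrightarrow> l \<in> L \<Longrightarrow> act l v = v \<Longrightarrow> l = \<one>"
    and stab: "\<And>v. v \<in> V \<Longrightarrow> fg_subgroup {l \<in> L. act l v = v} G"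
    and Bd: "finite Bd" "Bd \<subseteq> V \<times> V" and base: "base \<in> V"
    and conn: "\<And>W l. W \<subseteq> V \<Longrightarrow> base \<in> W \<Longrightarrow> (\<And>v. v \<in> V \<Longrightarrow> v \<in> W \<longleftrightarrow> F v \<in> W) \<Longrightarrow>
        (\<And>m u w. m \<in> L \<Longrightarrow> (u, w) \<in> Bd \<Longrightarrow> act m u \<in> W \<longleftrightarrow> act m w \<in> W) \<Longrightarrow> l \<in> L \<Longrightarrow> act l base \<in> W"
  shows "fg_subgroup L G"
proof -
  define rel where "rel = (\<lambda>u w. \<exists>a b. (F ^^ a) u = (F ^^ b) w)"
  interpret L: subgroup L G by (rule L)
  have LG: "l \<in> carrier G" if "l \<in> L" for l using that by (rule L.mem_carrier)
  have Fp_closed: "(F ^^ n) v \<in> V" if "v \<in> V" for n v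
    using that by (induction n) (auto intro: F_closed)
  have Fp_act: "(F ^^ n) (act l v) = act l ((F ^^ n) v)" if "l \<in> L" "v \<in> V" for n l v
    using that by (induction n) (auto simp: F_act Fp_closed)
  have act_inv: "act (inv l) (act l v) = v" "act l (act (inv l) v) = v" if "l \<in> L" "v \<in> V" for l v
    using that act_mult[of "inv l" l v] act_mult[of l "inv l" v] by (auto simp: act_one)
  have rel_refl: "rel u u" for u unfolding rel_def by blast
  have rel_sym: "rel u w \<Longrightarrow> rel w u" for u w unfolding rel_def by metis
  have rel_trans: "rel u x" if "rel u w" "rel w x" for u w x
  proof -
    from that obtain a b c d where ab: "(F ^^ a) u = (F ^^ b) w" and cd: "(F ^^ c) w = (F ^^ d) x"
      unfolding rel_def by blast
    have "(F ^^ (c + a)) u = (F ^^ (c + b)) w" using ab by (rule funpow_merge)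
    also have "\<dots> = (F ^^ (b + c)) w" by (simp add: add.commute)
    also have "\<dots> = (F ^^ (b + d)) x" using cd by (rule funpow_merge)
    finally show ?thesis unfolding rel_def by blast
  qed
  have rel_act: "rel (act l u) (act l w)" if "rel u w" "l \<in> L" "u \<in> V" "w \<in> V" for l u w
    using that unfolding rel_def by (metis Fp_act)
  have rel_F: "rel v (F v)" for v
  proof -
    have "(F ^^ 1) v = (F ^^ 0) (F v)" by simp
    thus ?thesis unfolding rel_def by blast
  qed
  \<comment> \<open>The stabiliser of a class is the stabiliser of the end point of its trajectories, or cyclic.\<close>
  have cls: "\<exists>S. finite S \<and> S \<subseteq> {l \<in> L. rel (act l z) z} \<and> {l \<in> L. rel (act l z) z} \<subseteq> generate G S"
    if z: "z \<in> V" for z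
  proof (cases "\<exists>n. F ((F ^^ n) z) = (F ^^ n) z")
    case True
    then obtain n where n: "F ((F ^^ n) z) = (F ^^ n) z" by blast
    define w where "w = (F ^^ n) z"
    have wV: "w \<in> V" using z unfolding w_def by (rule Fp_closed)
    have fixed: "(F ^^ k) w = w" for k by (induction k) (use n in \<open>auto simp: w_def\<close>)
    have "rel (act l z) z \<longleftrightarrow> act l w = w" if "l \<in> L" for l
    proof
      assume "rel (act l z) z"
      then obtain a b where "(F ^^ a) (act l z) = (F ^^ b) z" unfolding rel_def by blast
      hence "(F ^^ (n + a)) (act l z) = (F ^^ (n + b)) z" by (rule funpow_merge)
      hence "(F ^^ (a + n)) (act l z) = (F ^^ (b + n)) z" by (simp add: add.commute)
      hence "(F ^^ a) (act l w) = (F ^^ b) w"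
        using that z by (simp add: funpow_add w_def Fp_act)
      thus "act l w = w" using that wV by (simp add: Fp_act fixed)
    next
      assume "act l w = w"
      hence "(F ^^ n) (act l z) = (F ^^ n) z" using that z by (simp add: Fp_act w_def)
      thus "rel (act l z) z" unfolding rel_def by blast
    qed
    hence "{l \<in> L. rel (act l z) z} = {l \<in> L. act l w = w}" by blast
    moreover obtain S where "finite S" "S \<subseteq> carrier G" "{l \<in> L. act l w = w} = generate G S"
      using stab[OF wV] by (auto simp: fg_subgroup_def)
    ultimately show ?thesis using generate.incl[of _ S G] by (intro exI[of _ S]) auto
  next
    case False
    hence free: "l = \<one>" if "l \<in> L" "act l ((F ^^ n) z) = (F ^^ n) z" for l n
      using F_free[OF Fp_closed[OF z], of n l] that by auto
    \<comment> \<open>On an infinite trajectory a group element acts as a shift, and the shift determines it; the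
      least positive shift in \<open>D\<close> belongs to a generator, as in the Euclidean algorithm.\<close>
    define D where "D = {k. k > 0 \<and> (\<exists>l\<in>L. \<exists>a. act l ((F ^^ a) z) = (F ^^ (a + k)) z)}"
    have shift: "act l ((F ^^ (n + a)) z) = (F ^^ (n + b)) z"
      if "act l ((F ^^ a) z) = (F ^^ b) z" "l \<in> L" for l a b n
    proof -
      have "(F ^^ n) (act l ((F ^^ a) z)) = act l ((F ^^ n) ((F ^^ a) z))"
        by (rule Fp_act[OF that(2) Fp_closed[OF z]])
      thus ?thesis using that by (simp add: funpow_add)
    qed
    have in_rel: "rel (act l z) z" if "act l ((F ^^ a) z) = (F ^^ b) z" "l \<in> L" for l a b
      using that z unfolding rel_def by (metis Fp_act)
    have reduce: "{l \<in> L. rel (act l z) z} \<subseteq> generate G S" if S: "S \<subseteq> L" and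
      *: "\<And>l a b. l \<in> L \<Longrightarrow> a \<le> b \<Longrightarrow> act l ((F ^^ a) z) = (F ^^ b) z \<Longrightarrow> l \<in> generate G S" for S
    proof
      fix l assume "l \<in> {l \<in> L. rel (act l z) z}"
      then obtain a b where l: "l \<in> L" and ab: "act l ((F ^^ a) z) = (F ^^ b) z"
        using z unfolding rel_def by (auto simp: Fp_act)
      show "l \<in> generate G S"
      proof (cases "a \<le> b")
        case True
        thus ?thesis using * l ab by blast
      next
        case False
        have "act (inv l) ((F ^^ b) z) = (F ^^ a) z"
          using ab l z act_inv(1)[of l "(F ^^ a) z"] by (simp add: Fp_closed)
        hence "inv l \<in> generate G S" using *[of "inv l" b a] l False by simp
        moreover have "S \<subseteq> carrier G" using S LG by blast
        ultimately have "inv (inv l) \<in> generate G S" by (metis generate_m_inv_closed)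
        thus ?thesis using l LG by simp
      qed
    qed
    show ?thesis
    proof (cases "D = {}")
      case True
      have "{l \<in> L. rel (act l z) z} \<subseteq> generate G {}"
      proof (rule reduce)
        fix l a b assume l: "l \<in> L" "a \<le> b" "act l ((F ^^ a) z) = (F ^^ b) z"
        have ab: "act l ((F ^^ a) z) = (F ^^ (a + (b - a))) z" using l by simp
        have "b - a \<in> D" if "b - a > 0"
          unfolding D_def using that by (intro CollectI conjI bexI[OF _ l(1)] exI[of _ a] ab)
        hence "\<not> b - a > 0" using True by blast
        hence "b = a" using l(2) by simp
        hence "l = \<one>" using l by (intro free[of l a]) auto
        thus "l \<in> generate G {}" by (simp add: generate.one)
      qed simp
      thus ?thesis by blast
    next
      case False
      define k where "k = (LEAST k. k \<in> D)"
      have "k \<in> D" using False unfolding k_def by (metis LeastI ex_in_conv)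
      then obtain g a0 where k: "k > 0" and g: "g \<in> L" "act g ((F ^^ a0) z) = (F ^^ (a0 + k)) z"
        unfolding D_def by blast
      have min: "k \<le> k'" if "k' \<in> D" for k' using that unfolding k_def by (rule Least_le)
      have "l \<in> generate G {g}" if "l \<in> L" "act l ((F ^^ a) z) = (F ^^ (a + n)) z" for l a n
        using that
      proof (induction n arbitrary: l a rule: less_induct)
        case (less n)
        show ?case
        proof (cases "n = 0")
          case True
          hence "act l ((F ^^ a) z) = (F ^^ a) z" using less.prems(2) by simp
          hence "l = \<one>" by (rule free[OF less.prems(1)])
          thus ?thesis by (simp add: generate.one)
        next
          case False
          hence "n \<in> D" unfolding D_def
            by (intro CollectI conjI bexI[OF _ less.prems(1)] exI[of _ a] less.prems(2)) simp
          hence kn: "k \<le> n" by (rule min)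
          define m where "m = a0 + a"
          have 1: "act l ((F ^^ m) z) = (F ^^ (m + n)) z"
            using shift[OF less.prems(2,1), of a0] unfolding m_def add.assoc .
          have mn: "a + n - k + a0 = m + n - k" "a + n - k + (a0 + k) = m + n"
            using kn by (simp_all add: m_def)
          have "act g ((F ^^ (m + n - k)) z) = (F ^^ (m + n)) z"
            using shift[OF g(2,1), of "a + n - k"] unfolding mn .
          hence "act (inv g) ((F ^^ (m + n)) z) = (F ^^ (m + n - k)) z"
            using act_inv(1)[OF g(1) Fp_closed[OF z, of "m + n - k"]] by simp
          hence "act (inv g \<otimes> l) ((F ^^ m) z) = (F ^^ (m + (n - k))) z"
            using act_mult[of "inv g" l "(F ^^ m) z"] 1 g(1) less.prems(1) Fp_closed[OF z] kn
            by (simp only: L.m_inv_closed Nat.add_diff_assoc)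
          hence IH: "inv g \<otimes> l \<in> generate G {g}"
            using k kn by (intro less.IH[of "n - k" "inv g \<otimes> l" m] L.m_closed L.m_inv_closed
                g(1) less.prems(1)) auto
          have "l = g \<otimes> (inv g \<otimes> l)" using g(1) less.prems(1) LG by (simp add: cancel_left)
          thus ?thesis using IH generate.eng[OF generate.incl[of g "{g}" G] IH] by simp
        qed
      qed
      hence "{l \<in> L. rel (act l z) z} \<subseteq> generate G {g}"
        using g(1) by (intro reduce) (simp, metis le_add_diff_inverse)
      moreover have "g \<in> {l \<in> L. rel (act l z) z}" using in_rel[OF g(2,1)] g(1) by simp
      ultimately show ?thesis by (intro exI[of _ "{g}"]) auto
    qed
  qed
  \<comment> \<open>\<open>Q\<close> contains the class stabilisers at the finitely many points of \<open>Z\<close> and one element for each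
    pair of such points with equivalent orbits; the vertices \<open>W\<close> that \<open>Q\<close> reaches are closed under
    adjacency.\<close>
  define Z where "Z = insert base (fst ` Bd \<union> snd ` Bd)"
  have Z: "finite Z" "Z \<subseteq> V" using Bd base unfolding Z_def by auto
  have "\<forall>z\<in>Z. \<exists>S. finite S \<and> S \<subseteq> {l \<in> L. rel (act l z) z} \<and>
      {l \<in> L. rel (act l z) z} \<subseteq> generate G S" using cls Z(2) by (meson subsetD)
  then obtain S where "\<forall>z\<in>Z. finite (S z) \<and> S z \<subseteq> {l \<in> L. rel (act l z) z} \<and>
      {l \<in> L. rel (act l z) z} \<subseteq> generate G (S z)" unfolding bchoice_iff by (elim exE)
  hence S: "finite (S z)" "S z \<subseteq> {l \<in> L. rel (act l z) z}"
      "{l \<in> L. rel (act l z) z} \<subseteq> generate G (S z)" if "z \<in> Z" for z using that by simp_all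
  define c where "c = (\<lambda>(z, z'). SOME l. l \<in> L \<and> rel (act l z) z')"
  define T where "T = (\<Union>z\<in>Z. S z) \<union> (c ` (Z \<times> Z) \<inter> L)"
  define Q where "Q = generate G T"
  have TL: "T \<subseteq> L" using S(2) unfolding T_def by blast
  have TG: "T \<subseteq> carrier G" using TL LG by blast
  have finT: "finite T" unfolding T_def using Z(1) S(1) by simp
  have QL: "Q \<subseteq> L" unfolding Q_def by (rule generate_subgroup_incl[OF TL L])
  have sQ: "subgroup Q G" unfolding Q_def by (rule generate_is_subgroup[OF TG])
  have key: "l \<in> Q" if "z \<in> Z" "z' \<in> Z" "l \<in> L" "rel (act l z) z'" for z z' l
  proof -
    have zV: "z \<in> V" "z' \<in> V" using that Z by auto
    have cc: "c (z, z') \<in> L \<and> rel (act (c (z, z')) z) z'"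
      unfolding c_def using someI[of "\<lambda>l. l \<in> L \<and> rel (act l z) z'" l] that by simp
    let ?c = "c (z, z')"
    have cQ: "?c \<in> Q" unfolding Q_def T_def using that cc by (intro generate.incl) auto
    have "rel (act l z) (act ?c z)" using rel_trans[OF that(4) rel_sym] cc by blast
    hence "rel (act (inv ?c) (act l z)) (act (inv ?c) (act ?c z))"
      using cc that zV by (intro rel_act) (auto intro: act_closed)
    hence "rel (act (inv ?c \<otimes> l) z) z" using cc that zV by (simp add: act_mult act_inv)
    hence "inv ?c \<otimes> l \<in> generate G (S z)" using S(3)[OF that(1)] cc that(3) by blast
    moreover have "generate G (S z) \<subseteq> Q"
      unfolding Q_def T_def using that by (intro mono_generate) blast
    ultimately have "?c \<otimes> (inv ?c \<otimes> l) \<in> Q" using cQ subgroup.m_closed[OF sQ cQ] by blast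
    thus ?thesis using cc that LG by (simp add: cancel_left)
  qed
  define W where "W = {u \<in> V. \<exists>q\<in>Q. \<exists>z\<in>Z. rel u (act q z)}"
  have W_rel: "w \<in> W" if "u \<in> W" "rel u w" "w \<in> V" for u w
  proof -
    from that(1) obtain q z where "q \<in> Q" "z \<in> Z" "rel u (act q z)" unfolding W_def by blast
    thus ?thesis using rel_trans[OF rel_sym[OF that(2)]] that(3) unfolding W_def by blast
  qed
  have orbit: "m \<in> Q" if "m \<in> L" "z \<in> Z" "act m z \<in> W" for m z
  proof -
    from that obtain q z' where q: "q \<in> Q" "z' \<in> Z" "rel (act m z) (act q z')"
      unfolding W_def by blast
    have qL: "q \<in> L" using q QL by blast
    have "rel (act (inv q) (act m z)) (act (inv q) (act q z'))"
      using q qL that Z by (intro rel_act) (auto intro: act_closed)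
    hence "rel (act (inv q \<otimes> m) z) z'" using qL that q Z by (simp add: act_mult act_inv subset_iff)
    hence "inv q \<otimes> m \<in> Q" using key that q qL by blast
    hence "q \<otimes> (inv q \<otimes> m) \<in> Q" by (rule subgroup.m_closed[OF sQ q(1)])
    thus ?thesis using qL that LG by (simp add: cancel_left)
  qed

  have Z_W: "act m z \<in> W" if "m \<in> Q" "z \<in> Z" for m z
  proof -
    have "act m z \<in> V" using that QL Z act_closed by blast
    thus ?thesis using that rel_refl unfolding W_def by blast
  qed
  have "L \<subseteq> Q"
  proof
    fix l assume l: "l \<in> L"
    have "act l base \<in> W"
    proof (rule conn[OF _ _ _ _ l])
      show "W \<subseteq> V" unfolding W_def by blast
      show "base \<in> W" using Z_W[of \<one> base] act_one[OF base] subgroup.one_closed[OF sQ]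
        by (simp add: Z_def)
      show "v \<in> W \<longleftrightarrow> F v \<in> W" if "v \<in> V" for v
        using W_rel[OF _ rel_F[of v]] W_rel[OF _ rel_sym[OF rel_F[of v]]] that F_closed[OF that] by blast
      show "act m u \<in> W \<longleftrightarrow> act m w \<in> W" if "m \<in> L" "(u, w) \<in> Bd" for m u w
      proof -
        have "u \<in> Z" "w \<in> Z" using that(2) unfolding Z_def by force+
        thus ?thesis using orbit[OF that(1)] Z_W[of m] by blast
      qed
    qed
    thus "l \<in> Q" by (intro orbit[of l base]) (auto simp: l Z_def)
  qed
  hence "L = generate G T" using QL unfolding Q_def by blast
  thus ?thesis using fg_subgroup_generate[OF finT TG] by simp
qed

section \<open>Consequences of the finite coset interaction property\<close>

lemma ecard_ge_1: "x \<in> S \<Longrightarrow> 1 \<le> ecard S"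
  by (auto simp: ecard_def one_enat_def Suc_le_eq card_gt_0_iff)

lemma ecard_ge_2:
  assumes "x \<in> S" "y \<in> S" "x \<noteq> y"
  shows "1 < ecard S"
proof (cases "finite S")
  case True
  have "card {x, y} \<le> card S" by (rule card_mono) (use True assms in auto)
  thus ?thesis using True assms(3) by (simp add: ecard_def one_enat_def)
qed (simp add: ecard_def one_enat_def)

lemma infsum_enat_finite:
  fixes f :: "'x \<Rightarrow> enat"
  assumes "(\<Sum>\<^sub>\<infinity>x\<in>S. f x) < \<infinity>"
  shows "finite {x \<in> S. f x > 0}" and "x \<in> S \<Longrightarrow> f x < \<infinity>"
proof -
  have mono: "infsum f T \<le> infsum f S" if "T \<subseteq> S" for T
    using that by (intro infsum_mono_neutral) auto
  show "finite {x \<in> S. f x > 0}"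
  proof (rule ccontr)
    assume "infinite {x \<in> S. f x > 0}"
    hence "infsum f {x \<in> S. f x > 0} = \<infinity>"
      by (intro infsum_superconst_infinite_enat[where b = 1]) (auto simp: ileI1 one_eSuc)
    thus False using mono[of "{x \<in> S. f x > 0}"] assms by auto
  qed
  show "f x < \<infinity>" if "x \<in> S"
  proof -
    have "f x \<le> infsum f S" using mono[of "{x}"] that by simp
    thus ?thesis using assms by (rule order.strict_trans1)
  qed
qed

context group
begin

lemma conj_subgroup_one: "B \<subseteq> carrier G \<Longrightarrow> conj_subgroup G B \<one> = B"
  unfolding conj_subgroup_def by (force simp: subset_iff)

text \<open>
  The sum in the f.c.i.p. counts, over every double coset \<open>BhD\<close>, the preimages in excess of one. Its
  finiteness has two consequences, stated for the classes of elements \<open>c \<in> C\<close>, that is the preimages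
  belonging to \<open>f = g = 1\<close>: over finitely many double cosets there are finitely many of them, and
  only finitely many share their image with a different preimage.
\<close>

lemma fcip_rel_finite:
  assumes fcip: "fcip_rel G C" and B: "fg_subgroup B G" and D: "fg_subgroup D G"
    and F: "finite F" "F \<subseteq> carrier G" "inj_on (\<lambda>f. double_coset G B f C) F" "\<one> \<in> F"
    and F': "finite F'" "F' \<subseteq> carrier G" "inj_on (\<lambda>g. double_coset G D g C) F'" "\<one> \<in> F'"
  defines "cls \<equiv> \<lambda>f g c. double_coset (G\<lparr>carrier := C\<rparr>) (C \<inter> conj_subgroup G B f) c
      (C \<inter> conj_subgroup G D g)"
  shows fcip_rel_finite_fibre:
      "finite XS \<Longrightarrow> finite {cls \<one> \<one> c | c. c \<in> C \<and> double_coset G B c D \<in> XS}"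
    and fcip_rel_finite_ambiguous:
      "finite {cls \<one> \<one> c | c. c \<in> C \<and> (\<exists>f\<in>F. \<exists>g\<in>F'. \<exists>c'\<in>C. (f, g, cls f g c') \<noteq> (\<one>, \<one>, cls \<one> \<one> c) \<and>
         double_coset G B (f \<otimes> c' \<otimes> inv g) D = double_coset G B c D)}"
proof -
  define fib where "fib = (\<lambda>f g. coset_map_fibre G C B D f g)"
  define total where "total = (\<lambda>X. \<Sum>f\<in>F. \<Sum>g\<in>F'. ecard (fib f g X))"
  have C: "subgroup C G" and sB: "subgroup B G" and sD: "subgroup D G"
    using fcip B D fg_subgroupD unfolding fcip_rel_def by auto
  have CG: "c \<in> carrier G" if "c \<in> C" for c using that C by (rule subgroup.mem_carrier[rotated])
  have sum: "(\<Sum>\<^sub>\<infinity>X\<in>double_cosets G B D. max 0 (total X - 1)) < \<infinity>"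
    using fcip B D F F' unfolding fcip_rel_def total_def fib_def by blast
  have total_fin: "total X < \<infinity>" if "X \<in> double_cosets G B D" for X
    using infsum_enat_finite(2)[OF sum that] by (cases "total X") auto
  have fib_le: "(\<Sum>p\<in>P. ecard (fib (fst p) (snd p) X)) \<le> total X" if "P \<subseteq> F \<times> F'" for P X
    unfolding total_def sum.cartesian_product
    using that F F' by (intro order.trans[OF sum_mono2[of "F \<times> F'" P]])
      (auto simp: case_prod_beta)
  have fib_fin: "finite (fib f g X)" if "f \<in> F" "g \<in> F'" "X \<in> double_cosets G B D" for f g X
    using fib_le[of "{(f, g)}" X] total_fin[OF that(3)] that by (auto simp: ecard_def split: if_splits)
  have in_fib: "cls f g c \<in> fib f g (double_coset G B (f \<otimes> c \<otimes> inv g) D)"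
    if "f \<in> F" "g \<in> F'" "c \<in> C" for f g c
    unfolding fib_def coset_map_fibre_def cls_def double_cosets_def
    using that coset_map_double_coset[OF C sB sD, of f g c] F F' by auto
  have fin: "finite {cls \<one> \<one> c | c. c \<in> C \<and> double_coset G B c D \<in> XS}" if "finite XS" for XS
  proof (rule finite_subset)
    show "finite (\<Union>X\<in>XS \<inter> double_cosets G B D. fib \<one> \<one> X)"
      using that fib_fin F F' by auto
    have "cls \<one> \<one> c \<in> fib \<one> \<one> (double_coset G B c D)" if "c \<in> C" for c
      using in_fib[of \<one> \<one> c] that F F' CG by simp
    thus "{cls \<one> \<one> c | c. c \<in> C \<and> double_coset G B c D \<in> XS}
        \<subseteq> (\<Union>X\<in>XS \<inter> double_cosets G B D. fib \<one> \<one> X)"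
      using CG unfolding double_cosets_def by blast
  qed
  thus "finite XS \<Longrightarrow> finite {cls \<one> \<one> c | c. c \<in> C \<and> double_coset G B c D \<in> XS}" .
  define XS where "XS = {X \<in> double_cosets G B D. max 0 (total X - 1) > 0}"
  have XS: "finite XS" unfolding XS_def by (rule infsum_enat_finite(1)[OF sum])
  show "finite {cls \<one> \<one> c | c. c \<in> C \<and> (\<exists>f\<in>F. \<exists>g\<in>F'. \<exists>c'\<in>C. (f, g, cls f g c') \<noteq> (\<one>, \<one>, cls \<one> \<one> c) \<and>
         double_coset G B (f \<otimes> c' \<otimes> inv g) D = double_coset G B c D)}"
    (is "finite ?L")
  proof (rule finite_subset[OF subsetI fin[OF XS]])
    fix x assume "x \<in> ?L"
    then obtain c f g c' where x: "x = cls \<one> \<one> c" and c: "c \<in> C" and fg: "f \<in> F" "g \<in> F'" "c' \<in> C"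
      and ne: "(f, g, cls f g c') \<noteq> (\<one>, \<one>, cls \<one> \<one> c)"
      and eq: "double_coset G B (f \<otimes> c' \<otimes> inv g) D = double_coset G B c D"
      by blast
    let ?X = "double_coset G B c D"
    have 1: "cls \<one> \<one> c \<in> fib \<one> \<one> ?X" using in_fib[of \<one> \<one> c] c F F' CG by simp
    have 2: "cls f g c' \<in> fib f g ?X" using in_fib[OF fg] eq by simp
    have "1 < total ?X"
    proof (cases "(f, g) = (\<one>, \<one>)")
      case True
      hence "1 < ecard (fib \<one> \<one> ?X)" using 1 2 ne by (intro ecard_ge_2) auto
      thus ?thesis using fib_le[of "{(\<one>, \<one>)}" ?X] F F' by auto
    next
      case False
      have "1 < (1 + 1 :: enat)" by (simp add: one_enat_def)
      also have "\<dots> \<le> ecard (fib \<one> \<one> ?X) + ecard (fib f g ?X)"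
        using 1 2 by (intro add_mono ecard_ge_1)
      also have "\<dots> \<le> total ?X"
        using fib_le[of "{(\<one>, \<one>), (f, g)}" ?X] fg F F' False by (auto split: if_splits)
      finally show ?thesis .
    qed
    hence "max 0 (total ?X - 1) > 0"
      by (cases "total ?X") (auto simp: one_enat_def zero_enat_def)
    hence "?X \<in> XS" using CG[OF c] unfolding XS_def double_cosets_def by blast
    thus "x \<in> {cls \<one> \<one> c | c. c \<in> C \<and> double_coset G B c D \<in> XS}" using x c by blast
  qed
qed

end

section \<open>Left cosets and their stabilisers\<close>

context group
begin

lemma lcoset_mult:
  assumes "S \<subseteq> carrier G" "x \<in> carrier G" "y \<in> carrier G"
  shows "x <# (y <# S) = (x \<otimes> y) <# S"
  using lcos_m_assoc[OF assms] .

lemma lcoset_eq_iff: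
  assumes "subgroup S G" "x \<in> carrier G" "y \<in> carrier G"
  shows "x <# S = y <# S \<longleftrightarrow> inv x \<otimes> y \<in> S"
proof
  assume "x <# S = y <# S"
  moreover have "y \<in> y <# S"
    using assms subgroup.one_closed[OF assms(1)] unfolding l_coset_def by force
  ultimately obtain s where "s \<in> S" "y = x \<otimes> s" unfolding l_coset_def by blast
  thus "inv x \<otimes> y \<in> S" using assms by (simp add: cancel_left subgroup.mem_carrier)
next
  assume *: "inv x \<otimes> y \<in> S"
  have "y <# S = (x \<otimes> (inv x \<otimes> y)) <# S" using assms by (simp add: cancel_left)
  also have "\<dots> = x <# ((inv x \<otimes> y) <# S)"
    using assms by (simp add: lcoset_mult subgroup.subset)
  also have "(inv x \<otimes> y) <# S = S" using * assms by (intro coset_join3) auto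
  finally show "x <# S = y <# S" ..
qed

lemma lcoset_cancel:
  assumes "M \<subseteq> carrier G" "x \<in> carrier G"
  shows "inv x <# (x <# M) = M" "x <# (inv x <# M) = M"
  using assms lcoset_mult[of M "inv x" x] lcoset_mult[of M x "inv x"] by (simp_all add: lcos_mult_one)

lemma subset_set_mult_left:
  assumes "\<one> \<in> S" "M \<subseteq> carrier G"
  shows "M \<subseteq> S <#> M"
proof
  fix y assume "y \<in> M"
  hence "y = \<one> \<otimes> y" using assms by auto
  thus "y \<in> S <#> M" using assms(1) \<open>y \<in> M\<close> unfolding set_mult_def by blast
qed

text \<open>
  The stabiliser of the coset \<open>xS\<close> in \<open>L\<close> is conjugate to the intersection of a conjugate of \<open>L\<close>
  with \<open>S\<close>.
\<close>

lemma fg_subgroup_lcoset_stabilizer: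
  assumes S: "subgroup S G" and L: "L \<subseteq> carrier G" and x: "x \<in> carrier G"
    and fg: "fg_subgroup ((\<lambda>h. inv x \<otimes> h \<otimes> x) ` L \<inter> S) G"
  shows "fg_subgroup {l \<in> L. l <# (x <# S) = x <# S} G"
proof -
  have SG: "S \<subseteq> carrier G" using S subgroup.subset by blast
  have eq: "(\<lambda>h. x \<otimes> h \<otimes> inv x) ` ((\<lambda>h. inv x \<otimes> h \<otimes> x) ` L \<inter> S) = {l \<in> L. l <# (x <# S) = x <# S}"
  proof -
    have stab: "l <# (x <# S) = x <# S \<longleftrightarrow> inv x \<otimes> l \<otimes> x \<in> S" if "l \<in> L" for l
    proof -
      have lG: "l \<in> carrier G" using that L by blast
      have "l <# (x <# S) = x <# S \<longleftrightarrow> x <# S = (l \<otimes> x) <# S"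
        using lG x SG by (auto simp: lcoset_mult)
      thus ?thesis using lcoset_eq_iff[OF S x, of "l \<otimes> x"] x lG by (simp add: m_assoc)
    qed
    have inv: "x \<otimes> (inv x \<otimes> l \<otimes> x) \<otimes> inv x = l" if "l \<in> L" for l
      using that L x by (auto simp: m_assoc cancel_left subset_iff)
    show ?thesis
    proof (intro equalityI subsetI)
      fix y assume "y \<in> (\<lambda>h. x \<otimes> h \<otimes> inv x) ` ((\<lambda>h. inv x \<otimes> h \<otimes> x) ` L \<inter> S)"
      then obtain l where "l \<in> L" "inv x \<otimes> l \<otimes> x \<in> S" "y = x \<otimes> (inv x \<otimes> l \<otimes> x) \<otimes> inv x" by blast
      thus "y \<in> {l \<in> L. l <# (x <# S) = x <# S}" using inv stab by simp
    next
      fix l assume "l \<in> {l \<in> L. l <# (x <# S) = x <# S}"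
      hence l: "l \<in> L" "inv x \<otimes> l \<otimes> x \<in> S" using stab by auto
      thus "l \<in> (\<lambda>h. x \<otimes> h \<otimes> inv x) ` ((\<lambda>h. inv x \<otimes> h \<otimes> x) ` L \<inter> S)"
        using inv[OF l(1)] by (intro image_eqI[of l _ "inv x \<otimes> l \<otimes> x"]) auto
    qed
  qed
  show ?thesis using fg_subgroup_conj[OF fg x] unfolding eq .
qed

lemma fg_subgroup_conj_inv: "fg_subgroup H G \<Longrightarrow> x \<in> carrier G \<Longrightarrow> fg_subgroup ((\<lambda>h. inv x \<otimes> h \<otimes> x) ` H) G"
  using fg_subgroup_conj[of H "inv x"] by simp

lemma fgip_rel_lcoset_stabilizer:
  assumes "fgip_rel G S" "subgroup S G" "fg_subgroup H G" "x \<in> carrier G"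
  shows "fg_subgroup {h \<in> H. h <# (x <# S) = x <# S} G"
  using assms fg_subgroup_conj_inv[OF assms(3,4)] subgroup.subset[OF fg_subgroupD[OF assms(3)]]
  by (intro fg_subgroup_lcoset_stabilizer) (auto simp: fgip_rel_def)

end

section \<open>The Bass--Serre tree as a cocycle\<close>

lemma odd_card_sym_diff:
  assumes "finite X" "finite Y"
  shows "odd (card (sym_diff X Y)) \<longleftrightarrow> odd (card X) \<noteq> odd (card Y)"
proof -
  have "card X = card (X - Y) + card (X \<inter> Y)" "card Y = card (Y - X) + card (X \<inter> Y)"
    using assms by (metis add.commute card_Diff_subset_Int card_Int_Diff finite_Int Int_commute)+
  moreover have "card (sym_diff X Y) = card (X - Y) + card (Y - X)"
    using assms by (intro card_Un_disjoint) auto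
  ultimately show ?thesis by auto
qed

text \<open>
  The Bass--Serre tree of a splitting of \<open>G\<close> over the image of \<open>C\<close>. Think of \<open>d g\<close> as the set of
  edges on the geodesic from the base vertex to its translate by \<open>g\<close>. Passing from \<open>g\<close> to \<open>gh\<close>
  appends a translated geodesic, and the edges traversed twice cancel; this is \<open>d_mult\<close>.
  The group \<open>A\<close> is kept apart from its image, so that the finiteness hypotheses can be applied
  in \<open>A\<close> itself.
\<close>

locale hnn_tree = group G for G :: "('g, 'h) monoid_scheme" (structure) +
  fixes A :: "('a, 'b) monoid_scheme" and i :: "'a \<Rightarrow> 'g" and C :: "'a set" and t :: 'g
    and d :: "'g \<Rightarrow> 'g set set"
  assumes A: "group A" and i_hom: "i \<in> hom A G" and i_inj: "inj_on i (carrier A)"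
    and C: "subgroup C A" and t: "t \<in> carrier G"
    and t_conj: "c \<in> C \<Longrightarrow> inv t \<otimes> i c \<otimes> t \<in> i ` carrier A"
    and d_finite: "g \<in> carrier G \<Longrightarrow> finite (d g)"
    and d_edges: "g \<in> carrier G \<Longrightarrow> d g \<subseteq> {x <# i ` C | x. x \<in> carrier G}"
    and d_base: "a \<in> carrier A \<Longrightarrow> d (i a) = {}"
    and d_t: "d t = {i ` C}"
    and d_mult: "g \<in> carrier G \<Longrightarrow> h \<in> carrier G \<Longrightarrow>
      d (g \<otimes> h) = sym_diff (d g) ((\<lambda>e. g <# e) ` d h)"
    and gen: "g \<in> carrier G \<Longrightarrow> R \<one> \<Longrightarrow>
      (\<And>x a. x \<in> carrier G \<Longrightarrow> a \<in> carrier A \<Longrightarrow> R x \<Longrightarrow> R (x \<otimes> i a)) \<Longrightarrow>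
      (\<And>x. x \<in> carrier G \<Longrightarrow> R x \<longleftrightarrow> R (x \<otimes> t)) \<Longrightarrow> R g"
begin

text \<open>
  \<open>VA\<close> and \<open>E\<close> are subgroups of \<open>G\<close> and at the same time the base vertex and the base edge of the
  tree. As the product of the edge \<open>xE\<close> with \<open>tA\<close> is the coset \<open>xtA\<close>, the end points of an edge are
  given by set products.
\<close>

abbreviation "VA \<equiv> i ` carrier A"
abbreviation "E \<equiv> i ` C"
abbreviation "edges \<equiv> {x <# E | x. x \<in> carrier G}"
definition src :: "'g set \<Rightarrow> 'g set" where "src e = e <#> VA"
definition tgt :: "'g set \<Rightarrow> 'g set" where "tgt e = e <#> (t <# VA)"
definition separates :: "'g set set \<Rightarrow> 'g set \<Rightarrow> bool" where "separates W e \<longleftrightarrow> (src e \<in> W) \<noteq> (tgt e \<in> W)"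

sublocale A: group A by (rule A)
sublocale i: group_hom A G i using i_hom by unfold_locales

lemma VA_subgroup: "subgroup VA G" by (rule i.img_is_subgroup)

lemma E_subgroup: "subgroup E G" using C by (rule i.subgroup_img_is_subgroup)

lemma C_carrier: "c \<in> C \<Longrightarrow> c \<in> carrier A" using C subgroup.mem_carrier by metis

lemma E_VA: "E \<subseteq> VA" using C_carrier by auto

lemma VA_carrier: "VA \<subseteq> carrier G" and E_carrier: "E \<subseteq> carrier G"
  using VA_subgroup E_subgroup subgroup.subset by blast+

lemma lcoset_carrier: "e \<in> edges \<Longrightarrow> e \<subseteq> carrier G"
  using l_coset_subset_G[OF E_carrier] by auto

lemma VA_lcoset: "x \<in> carrier G \<Longrightarrow> x <# VA = VA \<longleftrightarrow> x \<in> VA"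
  using lcoset_eq_iff[OF VA_subgroup one_closed, of x] VA_carrier by (auto simp: lcos_mult_one)

lemma src_lcoset:
  assumes "x \<in> carrier G"
  shows "src (x <# E) = x <# VA"
proof -
  have "E <#> VA = VA"
  proof
    show "E <#> VA \<subseteq> VA"
      using E_VA subgroup.m_closed[OF VA_subgroup] by (auto simp: set_mult_def subset_iff simp del: image_iff)
    show "VA \<subseteq> E <#> VA"
      by (rule subset_set_mult_left[OF subgroup.one_closed[OF E_subgroup] VA_carrier])
  qed
  thus ?thesis
    unfolding src_def using setmult_lcos_assoc[OF E_carrier VA_carrier assms] by simp
qed

lemma tgt_lcoset:
  assumes "x \<in> carrier G"
  shows "tgt (x <# E) = (x \<otimes> t) <# VA"
proof -
  have "E <#> (t <# VA) = t <# VA"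
  proof
    show "E <#> (t <# VA) \<subseteq> t <# VA"
    proof
      fix y assume "y \<in> E <#> (t <# VA)"
      then obtain c v where cv: "c \<in> C" "v \<in> VA" "y = i c \<otimes> (t \<otimes> v)"
        unfolding set_mult_def l_coset_def by blast
      have vG: "v \<in> carrier G" using cv VA_carrier by blast
      have "inv t \<otimes> i c \<otimes> t \<otimes> v \<in> VA"
        using t_conj[OF cv(1)] cv(2) subgroup.m_closed[OF VA_subgroup] by blast
      moreover have "y = t \<otimes> (inv t \<otimes> i c \<otimes> t \<otimes> v)"
        using cv t vG C_carrier by (simp add: m_assoc cancel_left)
      ultimately show "y \<in> t <# VA" unfolding l_coset_def by blast
    qed
    show "t <# VA \<subseteq> E <#> (t <# VA)"
      by (rule subset_set_mult_left[OF subgroup.one_closed[OF E_subgroup]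
            l_coset_subset_G[OF VA_carrier t]])
  qed
  moreover have "t <# VA \<subseteq> carrier G" using l_coset_subset_G[OF VA_carrier t] .
  ultimately show ?thesis
    unfolding tgt_def using setmult_lcos_assoc[OF E_carrier _ assms, of "t <# VA"]
      lcoset_mult[OF VA_carrier assms t] by simp
qed

lemma edge_act: "g \<in> carrier G \<Longrightarrow> e \<in> edges \<Longrightarrow> g <# e \<in> edges"
  using lcoset_mult[OF E_carrier] by blast

lemma src_act: "g \<in> carrier G \<Longrightarrow> e \<in> edges \<Longrightarrow> src (g <# e) = g <# src e"
  and tgt_act: "g \<in> carrier G \<Longrightarrow> e \<in> edges \<Longrightarrow> tgt (g <# e) = g <# tgt e"
  using E_carrier VA_carrier t by (auto simp: src_lcoset tgt_lcoset lcoset_mult m_assoc)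

lemma src_vertex: "e \<in> edges \<Longrightarrow> \<exists>x\<in>carrier G. src e = x <# VA"
  and tgt_vertex: "e \<in> edges \<Longrightarrow> \<exists>x\<in>carrier G. tgt e = x <# VA"
  using t by (auto simp: src_lcoset tgt_lcoset)

lemma d_one: "d \<one> = {}"
  using d_base[of "\<one>\<^bsub>A\<^esub>"] by simp

text \<open>
  Stokes' theorem modulo 2: the chain \<open>d g\<close> has boundary \<open>A + gA\<close>, so a set \<open>W\<close> of vertices cuts an
  odd number of its edges exactly when it contains one of \<open>A\<close> and \<open>gA\<close>. Both sides change in the same
  way when a generator is appended to \<open>g\<close>. With \<open>W\<close> the component of \<open>A\<close> in the graph with edge
  set \<open>d g\<close> this shows that \<open>d g\<close> connects \<open>A\<close> to \<open>gA\<close>.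
\<close>

lemma odd_card_separates_iff:
  assumes "g \<in> carrier G"
  shows "odd (card {e \<in> d g. separates W e}) \<longleftrightarrow> (VA \<in> W) \<noteq> (g <# VA \<in> W)"
  using assms
proof (rule gen[where R = "\<lambda>g. odd (card {e \<in> d g. separates W e}) \<longleftrightarrow> (VA \<in> W) \<noteq> (g <# VA \<in> W)"])
  show "odd (card {e \<in> d \<one>. separates W e}) \<longleftrightarrow> (VA \<in> W) \<noteq> (\<one> <# VA \<in> W)"
    using VA_carrier by (simp add: d_one lcos_mult_one)
next
  fix x a assume x: "x \<in> carrier G" and a: "a \<in> carrier A"
    and IH: "odd (card {e \<in> d x. separates W e}) \<longleftrightarrow> (VA \<in> W) \<noteq> (x <# VA \<in> W)"
  have "(x \<otimes> i a) <# VA = x <# VA"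
    using x a lcoset_eq_iff[OF VA_subgroup x, of "x \<otimes> i a"] by (simp add: cancel_left)
  thus "odd (card {e \<in> d (x \<otimes> i a). separates W e}) \<longleftrightarrow> (VA \<in> W) \<noteq> ((x \<otimes> i a) <# VA \<in> W)"
    using IH x a by (simp add: d_mult d_base)
next
  fix x assume x: "x \<in> carrier G"
  have "{e \<in> d (x \<otimes> t). separates W e} = sym_diff {e \<in> d x. separates W e} {e \<in> {x <# E}. separates W e}"
    using x t by (auto simp: d_mult d_t)
  hence "odd (card {e \<in> d (x \<otimes> t). separates W e}) \<longleftrightarrow>
      odd (card {e \<in> d x. separates W e}) \<noteq> odd (card {e \<in> {x <# E}. separates W e})"
    using odd_card_sym_diff[of "{e \<in> d x. separates W e}" "{e \<in> {x <# E}. separates W e}"] x d_finite by simp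
  moreover have "{e \<in> {x <# E}. separates W e} = (if separates W (x <# E) then {x <# E} else {})"
    by auto
  hence "odd (card {e \<in> {x <# E}. separates W e}) \<longleftrightarrow> separates W (x <# E)" by simp
  moreover have "separates W (x <# E) \<longleftrightarrow> (x <# VA \<in> W) \<noteq> ((x \<otimes> t) <# VA \<in> W)"
    unfolding separates_def src_lcoset[OF x] tgt_lcoset[OF x] ..
  ultimately show "(odd (card {e \<in> d x. separates W e}) \<longleftrightarrow> (VA \<in> W) \<noteq> (x <# VA \<in> W)) \<longleftrightarrow>
      (odd (card {e \<in> d (x \<otimes> t). separates W e}) \<longleftrightarrow> (VA \<in> W) \<noteq> ((x \<otimes> t) <# VA \<in> W))"
    by argo
qed

end

section \<open>Vertex groups of finitely generated subgroups\<close>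

context hnn_tree
begin

lemma separates_act:
  assumes g: "g \<in> carrier G" and e: "e \<in> edges" and h: "h \<in> carrier G"
  shows "separates {h <# VA} (g <# e) \<longleftrightarrow> separates {(inv g \<otimes> h) <# VA} e"
proof -
  have "g <# v = h <# VA \<longleftrightarrow> v = (inv g \<otimes> h) <# VA" if v: "\<exists>x\<in>carrier G. v = x <# VA" for v
  proof -
    have vG: "v \<subseteq> carrier G" using v l_coset_subset_G[OF VA_carrier] by auto
    have "(inv g \<otimes> h) <# VA = inv g <# (h <# VA)"
      using lcoset_mult[OF VA_carrier, of "inv g" h] g h by simp
    moreover have "h <# VA \<subseteq> carrier G" by (rule l_coset_subset_G[OF VA_carrier h])
    ultimately show ?thesis using lcoset_cancel[OF vG g] lcoset_cancel[OF _ g, of "h <# VA"] by metis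
  qed
  thus ?thesis
    using src_vertex[OF e] tgt_vertex[OF e] by (simp add: separates_def src_act[OF g e] tgt_act[OF g e])
qed

text \<open>
  Let \<open>H\<close> be generated by the finite set \<open>S\<close>. The subgroup \<open>P\<close> of \<open>H \<inter> A\<close> is chosen so large, yet
  finitely generated, that the edges of the subtree of \<open>H\<close> at the base vertex can be attached to
  cosets of \<open>P\<close> consistently. In the graph where the orbit of the base vertex is replaced by \<open>H/P\<close>,
  the boundary of \<open>d g\<close> is then \<open>P + gP\<close> modulo 2: both are cocycles in \<open>g\<close>, and they agree
  on \<open>S\<close>. For \<open>g \<in> H \<inter> A\<close> the chain \<open>d g\<close> is empty, whence \<open>gP = P\<close>.
\<close>

theorem fgip_rel_base:
  assumes E_fgip: "fgip_rel G E"
  shows "fgip_rel G VA"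
  unfolding fgip_rel_def
proof (intro allI impI)
  fix H assume fgH: "fg_subgroup H G"
  then obtain S where S: "finite S" "S \<subseteq> carrier G" "H = generate G S"
    by (auto simp: fg_subgroup_def)
  have H: "subgroup H G" using fgH by (rule fg_subgroupD)
  interpret H: subgroup H G by (rule H)
  interpret VA: subgroup VA G by (rule VA_subgroup)
  have HG: "h \<in> carrier G" if "h \<in> H" for h using that by (rule H.mem_carrier)
  have SH: "s \<in> H" if "s \<in> S" for s using that S generate.incl[of s S G] by blast
  \<comment> \<open>\<open>n\<close> chooses an element of \<open>H\<close> moving the base vertex to a given vertex of its orbit, and \<open>U0\<close>
    collects the edges of the geodesics \<open>d s\<close> that meet this orbit, moved back to the base vertex.\<close>
  define n where "n = (\<lambda>v. if v = VA then \<one> else SOME h. h \<in> H \<and> h <# VA = v)"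
  have n: "n (h <# VA) \<in> H" "n (h <# VA) <# VA = h <# VA" if "h \<in> H" for h
  proof -
    have "n (h <# VA) \<in> H \<and> n (h <# VA) <# VA = h <# VA"
      using someI[of "\<lambda>k. k \<in> H \<and> k <# VA = h <# VA" h] that VA_carrier
      unfolding n_def by (auto simp: lcos_mult_one)
    thus "n (h <# VA) \<in> H" "n (h <# VA) <# VA = h <# VA" by auto
  qed
  have n_VA: "n VA = \<one>" by (simp add: n_def)
  define Y where "Y = (\<Union>s\<in>S. d s)"
  have Y: "finite Y" "Y \<subseteq> edges"
    using S d_finite d_edges unfolding Y_def by (auto simp: subset_iff)
  define U0 where "U0 = {inv (n v) <# e | v e. e \<in> Y \<and> (v = src e \<or> v = tgt e) \<and> (\<exists>h\<in>H. v = h <# VA)}"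
  have "finite U0"
  proof (rule finite_subset)
    show "U0 \<subseteq> (\<lambda>(v, e). inv (n v) <# e) ` ((src ` Y \<union> tgt ` Y) \<times> Y)" unfolding U0_def by auto
  qed (use Y in simp)
  have U0: "u \<in> edges" "src u = VA \<or> tgt u = VA" if "u \<in> U0" for u
  proof -
    from that obtain v e h where "e \<in> Y"
      and v': "u = inv (n v) <# e" "v = src e \<or> v = tgt e" "h \<in> H" "v = h <# VA"
      unfolding U0_def by blast
    hence v: "u = inv (n v) <# e" "e \<in> edges" "v = src e \<or> v = tgt e" "h \<in> H" "v = h <# VA"
      using Y(2) by (blast+)
    have nG: "n v \<in> carrier G" using n[OF v(4)] v(5) HG by simp
    show "u \<in> edges" using v nG edge_act by simp
    have "inv (n v) <# v = VA"
      using n(2)[OF v(4)] v(5) lcoset_cancel(1)[OF VA_carrier nG] by simp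
    thus "src u = VA \<or> tgt u = VA"
      using v(1,2,3) nG src_act[of "inv (n v)" e] tgt_act[of "inv (n v)" e] by auto
  qed
  \<comment> \<open>Two edges of \<open>U0\<close> in one orbit of \<open>H \<inter> A\<close> have to lie in one orbit of \<open>P\<close>, and edge stabilisers
    have to lie in \<open>P\<close>; the transporters \<open>T u u'\<close> provide both. The elements indexed by \<open>S\<close> make
    \<open>n\<close> agree with \<open>s\<close> up to \<open>P\<close> on the vertex \<open>sA\<close>.\<close>
  define T where "T = (\<lambda>u u'. {q \<in> H \<inter> VA. q <# u = u'})"
  define X where "X = case_sum (\<lambda>(u, u'). T u u') (\<lambda>s. {inv (n (s <# VA)) \<otimes> s})"
  define I where "I = (Inl ` (U0 \<times> U0) \<union> Inr ` S :: ('g set \<times> 'g set + 'g) set)"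
  define P where "P = generate G (\<Union>j\<in>I. X j)"
  have T_P: "T u u' \<subseteq> P" if "u \<in> U0" "u' \<in> U0" for u u'
  proof -
    have "T u u' = X (Inl (u, u'))" by (simp add: X_def)
    moreover have "Inl (u, u') \<in> I" using that unfolding I_def by blast
    ultimately show ?thesis unfolding P_def by (blast intro: generate.incl)
  qed
  have s_P: "inv (n (s <# VA)) \<otimes> s \<in> P" if "s \<in> S" for s
  proof -
    have "inv (n (s <# VA)) \<otimes> s \<in> X (Inr s)" by (simp add: X_def)
    moreover have "Inr s \<in> I" using that unfolding I_def by blast
    ultimately show ?thesis unfolding P_def by (blast intro: generate.incl)
  qed
  have ns_VA: "inv (n (s <# VA)) \<otimes> s \<in> H \<inter> VA" if "s \<in> S" for s
    using n[OF SH[OF that]] SH[OF that] HG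
      lcoset_eq_iff[OF VA_subgroup, of "n (s <# VA)" s] by auto
  have X_sub: "(\<Union>j\<in>I. X j) \<subseteq> H \<inter> VA"
    using ns_VA by (auto simp: I_def X_def T_def)
  have sub_HVA: "subgroup (H \<inter> VA) G" by (rule subgroups_Inter_pair[OF H VA_subgroup])
  have X_G: "(\<Union>j\<in>I. X j) \<subseteq> carrier G" using X_sub H.subset by blast
  have P: "subgroup P G" unfolding P_def using X_G by (rule generate_is_subgroup)
  interpret P: subgroup P G by (rule P)
  have P_sub: "P \<subseteq> H \<inter> VA" unfolding P_def by (rule generate_subgroup_incl[OF X_sub sub_HVA])
  \<comment> \<open>A transporter is empty or a coset of an edge stabiliser. That stabiliser lies in \<open>A\<close> because an
    edge of \<open>U0\<close> is incident with the base vertex, and so is a full stabiliser in \<open>H\<close>.\<close>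
  have stab: "fg_subgroup (T u u) G" if u: "u \<in> U0" for u
  proof -
    obtain x where x: "x \<in> carrier G" "u = x <# E" using U0(1)[OF u] by blast
    have "h \<in> VA" if "h \<in> H" "h <# u = u" for h
    proof -
      have "h <# src u = src u" "h <# tgt u = tgt u"
        using src_act[OF HG[OF that(1)] U0(1)[OF u]] tgt_act[OF HG[OF that(1)] U0(1)[OF u]] that by auto
      thus ?thesis using U0(2)[OF u] VA_lcoset[OF HG[OF that(1)]] by auto
    qed
    hence "T u u = {h \<in> H. h <# (x <# E) = x <# E}" unfolding T_def x(2)[symmetric] by blast
    thus ?thesis using fgip_rel_lcoset_stabilizer[OF E_fgip E_subgroup fgH x(1)] by simp
  qed
  have fgP: "fg_subgroup P G"
  proof (rule fg_subgroup_finite_Un[OF _ _ P_def X_G])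
    show "finite I" using \<open>finite U0\<close> S unfolding I_def by simp
    fix j assume j: "j \<in> I"
    show "\<exists>S'. finite S' \<and> S' \<subseteq> carrier G \<and> S' \<subseteq> P \<and> X j \<subseteq> generate G S'"
    proof (cases j)
      case (Inr s)
      hence s: "s \<in> S" using j unfolding I_def by auto
      show ?thesis unfolding Inr X_def
        using s_P[OF s] P.subset by (intro exI[of _ "{inv (n (s <# VA)) \<otimes> s}"]) (auto intro: generate.incl)
    next
      case (Inl p)
      then obtain u u' where p: "p = (u, u')" "u \<in> U0" "u' \<in> U0" using j unfolding I_def by auto
      have Xj: "X j = T u u'" by (simp add: X_def Inl p)
      show ?thesis
      proof (cases "T u u' = {}")
        case False
        then obtain q0 where q0: "q0 \<in> T u u'" by blast
        have q0H: "q0 \<in> H \<inter> VA" and q0u: "q0 <# u = u'" using q0 by (auto simp: T_def)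
        have q0G: "q0 \<in> carrier G" using q0H HG by blast
        obtain S' where S': "finite S'" "S' \<subseteq> carrier G" "T u u = generate G S'"
          using stab[OF p(2)] by (auto simp: fg_subgroup_def)
        have "T u u' \<subseteq> generate G (insert q0 S')"
        proof
          fix q assume q: "q \<in> T u u'"
          hence qH: "q \<in> H \<inter> VA" "q <# u = q0 <# u" using q0u by (auto simp: T_def)
          have qG: "q \<in> carrier G" using qH HG by blast
          have uG: "u \<subseteq> carrier G" using U0(1)[OF p(2)] by (rule lcoset_carrier)
          have "(inv q0 \<otimes> q) <# u = u"
            using lcoset_mult[OF uG, of "inv q0" q] qH(2) lcoset_cancel(1)[OF uG q0G] qG q0G by simp
          moreover have "inv q0 \<otimes> q \<in> H \<inter> VA"
            using subgroup.m_closed[OF sub_HVA subgroup.m_inv_closed[OF sub_HVA q0H] qH(1)] .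
          ultimately have "inv q0 \<otimes> q \<in> generate G S'" using S'(3) unfolding T_def by blast
          hence "inv q0 \<otimes> q \<in> generate G (insert q0 S')" using mono_generate[of S' "insert q0 S'"] by blast
          hence "q0 \<otimes> (inv q0 \<otimes> q) \<in> generate G (insert q0 S')"
            by (rule generate.eng[OF generate.incl[OF insertI1]])
          thus "q \<in> generate G (insert q0 S')" using qG q0G by (simp add: cancel_left)
        qed
        moreover have "S' \<subseteq> T u u" using S'(3) generate.incl[of _ S' G] by blast
        hence "insert q0 S' \<subseteq> P" using T_P[OF p(2,2)] T_P[OF p(2,3)] q0 by blast
        ultimately show ?thesis unfolding Xj
          using S' q0G by (intro exI[of _ "insert q0 S'"]) auto
      qed (use Xj in \<open>auto intro!: exI[of _ "{}"]\<close>)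
    qed
  qed
  \<comment> \<open>\<open>\<beta> h e\<close>: the edge \<open>e\<close> is attached to the coset \<open>hP\<close> of the split vertex. \<open>\<Phi> g\<close>: the boundary of
    \<open>d g\<close> in the split graph is \<open>P + gP\<close>.\<close>
  define \<beta> where "\<beta> = (\<lambda>h e. separates {h <# VA} e \<and> (\<exists>p\<in>P. \<exists>u\<in>U0. inv h <# e = p <# u))"
  have \<beta>_act: "\<beta> h (g <# e) \<longleftrightarrow> \<beta> (inv g \<otimes> h) e" if "g \<in> H" "h \<in> H" "e \<in> edges" for g h e
    using separates_act[OF HG[OF that(1)] that(3) HG[OF that(2)]]
      lcoset_mult[OF lcoset_carrier[OF that(3)], of "inv h" g] HG[OF that(1)] HG[OF that(2)]
    by (simp add: \<beta>_def inv_mult_group)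
  define \<Phi> where "\<Phi> = (\<lambda>g. \<forall>h\<in>H. odd (card {e \<in> d g. \<beta> h e}) \<longleftrightarrow> (h \<in> P) \<noteq> (inv g \<otimes> h \<in> P))"
  have count: "card {e \<in> (\<lambda>e. g <# e) ` D. \<beta> h e} = card {e \<in> D. \<beta> (inv g \<otimes> h) e}"
    if "g \<in> H" "h \<in> H" "D \<subseteq> edges" for g h D
  proof -
    have "{e \<in> (\<lambda>e. g <# e) ` D. \<beta> h e} = (\<lambda>e. g <# e) ` {e \<in> D. \<beta> (inv g \<otimes> h) e}"
      using \<beta>_act[OF that(1,2)] that(3) by blast
    moreover have "inj_on (\<lambda>e. g <# e) {e \<in> D. \<beta> (inv g \<otimes> h) e}"
      using that(3) lcoset_cancel(1)[OF lcoset_carrier HG[OF that(1)]]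
      by (intro inj_on_inverseI[where g = "\<lambda>e. inv g <# e"]) blast
    ultimately show ?thesis by (simp add: card_image)
  qed
  have gen_case: "\<Phi> s" if s: "s \<in> S" for s
    unfolding \<Phi>_def
  proof
    fix h assume h: "h \<in> H"
    note sH = SH[OF s]
    have hG: "h \<in> carrier G" and sG: "s \<in> carrier G" using h sH HG by auto
    define m where "m = n (h <# VA)"
    have m: "m \<in> H" "m <# VA = h <# VA" unfolding m_def using n[OF h] by auto
    have mG: "m \<in> carrier G" using m HG by blast
    have q_HVA: "inv h \<otimes> m \<in> H \<inter> VA"
      using m h hG mG lcoset_eq_iff[OF VA_subgroup hG mG] by auto
    have u': "inv m <# e \<in> U0" if "e \<in> d s" "separates {h <# VA} e" for e
    proof -
      have "e \<in> Y" using that s unfolding Y_def by blast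
      moreover have "h <# VA = src e \<or> h <# VA = tgt e" using that(2) by (auto simp: separates_def)
      ultimately show ?thesis unfolding U0_def m_def using h by blast
    qed
    have eq_VA: "inv h \<otimes> m \<in> P \<and> VA = h <# VA \<Longrightarrow> h \<in> P"
    proof -
      assume *: "inv h \<otimes> m \<in> P \<and> VA = h <# VA"
      hence "m = \<one>" using n_VA m_def by metis
      hence "inv h \<in> P" using * hG by simp
      thus "h \<in> P" using P.m_inv_closed hG by fastforce
    qed
    have split: "inv h \<otimes> s = (inv h \<otimes> m) \<otimes> (inv m \<otimes> s)"
      using hG mG sG by (simp add: m_assoc cancel_left)
    have ms: "inv m \<otimes> s \<in> P" if "s <# VA = h <# VA" using s_P[OF s] that unfolding m_def by simp
    have inv_sh: "inv s \<otimes> h \<in> P \<longleftrightarrow> inv h \<otimes> s \<in> P"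
    proof -
      have "inv (inv s \<otimes> h) = inv h \<otimes> s" "inv (inv h \<otimes> s) = inv s \<otimes> h"
        using sG hG by (simp_all add: inv_mult_group)
      thus ?thesis using P.m_inv_closed by metis
    qed
    have sh_VA: "s <# VA = h <# VA" if "inv s \<otimes> h \<in> P"
      using that P_sub lcoset_eq_iff[OF VA_subgroup sG hG] by blast
    have h_VA: "VA = h <# VA" if "h \<in> P" using that P_sub VA_lcoset[OF hG] by blast
    \<comment> \<open>All edges of \<open>d s\<close> at the vertex \<open>hA\<close> are attached to the one coset \<open>mP\<close>. If \<open>hP\<close> is that
      coset, the boundary in the tree decides; otherwise nothing is attached to \<open>hP\<close>.\<close>
    show "odd (card {e \<in> d s. \<beta> h e}) \<longleftrightarrow> (h \<in> P) \<noteq> (inv s \<otimes> h \<in> P)"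
    proof (cases "inv h \<otimes> m \<in> P")
      case True
      have "\<beta> h e \<longleftrightarrow> separates {h <# VA} e" if e: "e \<in> d s" for e
      proof -
        have eG: "e \<subseteq> carrier G" using e d_edges[OF sG] lcoset_carrier by blast
        have "inv h <# e = (inv h \<otimes> m) <# (inv m <# e)"
          using eG hG mG lcoset_mult[OF eG, of "inv h \<otimes> m" "inv m"] by (simp add: m_assoc)
        thus ?thesis using True u'[OF e] unfolding \<beta>_def by blast
      qed
      hence "{e \<in> d s. \<beta> h e} = {e \<in> d s. separates {h <# VA} e}" by blast
      hence "odd (card {e \<in> d s. \<beta> h e}) \<longleftrightarrow> (VA = h <# VA) \<noteq> (s <# VA = h <# VA)"
        using odd_card_separates_iff[OF sG, of "{h <# VA}"] by simp
      moreover have "VA = h <# VA \<longleftrightarrow> h \<in> P" using True eq_VA h_VA by blast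
      moreover have "s <# VA = h <# VA \<longleftrightarrow> inv s \<otimes> h \<in> P"
        using sh_VA ms True split P.m_closed inv_sh by metis
      ultimately show ?thesis by simp
    next
      case False
      have "\<not> \<beta> h e" if e: "e \<in> d s" for e
      proof
        assume b: "\<beta> h e"
        then obtain p u where pu: "p \<in> P" "u \<in> U0" "inv h <# e = p <# u" and sp: "separates {h <# VA} e"
          unfolding \<beta>_def by blast
        let ?u' = "inv m <# e"
        have eG: "e \<subseteq> carrier G" using e d_edges[OF sG] lcoset_carrier by blast
        have uG: "u \<subseteq> carrier G" using U0(1)[OF pu(2)] by (rule lcoset_carrier)
        have pG: "p \<in> carrier G" using pu(1) by (rule P.mem_carrier)
        have u'G: "?u' \<subseteq> carrier G" using U0(1)[OF u'[OF e sp]] by (rule lcoset_carrier)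
        have "(inv h \<otimes> m) <# ?u' = p <# u"
          using pu(3) eG hG mG lcoset_mult[OF eG, of "inv h \<otimes> m" "inv m"] by (simp add: m_assoc)
        hence "(inv p \<otimes> (inv h \<otimes> m)) <# ?u' = u"
          using lcoset_mult[OF u'G, of "inv p" "inv h \<otimes> m"] lcoset_cancel(1)[OF uG pG] pG hG mG by simp
        moreover have "inv p \<otimes> (inv h \<otimes> m) \<in> H \<inter> VA"
          using subgroup.m_closed[OF sub_HVA subgroup.m_inv_closed[OF sub_HVA] q_HVA] pu(1) P_sub by blast
        ultimately have "inv p \<otimes> (inv h \<otimes> m) \<in> P"
          using T_P[OF u'[OF e sp] pu(2)] unfolding T_def by blast
        hence "p \<otimes> (inv p \<otimes> (inv h \<otimes> m)) \<in> P" by (rule P.m_closed[OF pu(1)])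
        thus False using False pG hG mG by (simp add: cancel_left)
      qed
      hence "{e \<in> d s. \<beta> h e} = {}" by blast
      moreover have "h \<notin> P"
      proof
        assume hP: "h \<in> P"
        hence "m = \<one>" using h_VA n_VA m_def by metis
        thus False using False hP hG by simp
      qed
      moreover have "inv s \<otimes> h \<notin> P"
      proof
        assume *: "inv s \<otimes> h \<in> P"
        have "inv h \<otimes> s \<in> P" "inv m \<otimes> s \<in> P" using * inv_sh ms sh_VA by auto
        hence "(inv h \<otimes> s) \<otimes> inv (inv m \<otimes> s) \<in> P" by simp
        thus False using False hG mG sG by (simp add: inv_mult_group m_assoc cancel_left)
      qed
      ultimately show ?thesis by (simp only: card.empty) simp
    qed
  qed
  have d_sub: "d g \<subseteq> edges" if "g \<in> H" for g using d_edges[OF HG[OF that]] .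
  have mult_case: "\<Phi> (g \<otimes> g')" if "g \<in> H" "g' \<in> H" "\<Phi> g" "\<Phi> g'" for g g'
    unfolding \<Phi>_def
  proof
    fix h assume h: "h \<in> H"
    let ?X = "{e \<in> d g. \<beta> h e}" and ?Y = "{e \<in> (\<lambda>e. g <# e) ` d g'. \<beta> h e}"
    have "{e \<in> d (g \<otimes> g'). \<beta> h e} = sym_diff ?X ?Y"
      unfolding d_mult[OF HG[OF that(1)] HG[OF that(2)]] by blast
    hence 1: "odd (card {e \<in> d (g \<otimes> g'). \<beta> h e}) \<longleftrightarrow> odd (card ?X) \<noteq> odd (card ?Y)"
      using odd_card_sym_diff[of ?X ?Y] d_finite[OF HG[OF that(1)]] d_finite[OF HG[OF that(2)]] by simp
    have 2: "card ?Y = card {e \<in> d g'. \<beta> (inv g \<otimes> h) e}"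
      by (rule count[OF that(1) h d_sub[OF that(2)]])
    have 3: "odd (card ?X) \<longleftrightarrow> (h \<in> P) \<noteq> (inv g \<otimes> h \<in> P)" using that(3) h by (simp add: \<Phi>_def)
    have "inv g' \<otimes> (inv g \<otimes> h) = inv (g \<otimes> g') \<otimes> h"
      using that h HG by (simp add: inv_mult_group m_assoc)
    hence 4: "odd (card {e \<in> d g'. \<beta> (inv g \<otimes> h) e}) \<longleftrightarrow>
        (inv g \<otimes> h \<in> P) \<noteq> (inv (g \<otimes> g') \<otimes> h \<in> P)"
      using that h by (simp add: \<Phi>_def)
    show "odd (card {e \<in> d (g \<otimes> g'). \<beta> h e}) \<longleftrightarrow> (h \<in> P) \<noteq> (inv (g \<otimes> g') \<otimes> h \<in> P)"
      unfolding 1 2 3 4 by blast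
  qed
  have inv_case: "\<Phi> (inv g)" if "g \<in> H" "\<Phi> g" for g
    unfolding \<Phi>_def
  proof
    fix h assume h: "h \<in> H"
    have gG: "g \<in> carrier G" using HG that by blast
    have "sym_diff (d g) ((\<lambda>e. g <# e) ` d (inv g)) = {}"
      using d_mult[OF gG, of "inv g"] gG d_one by simp
    hence "(\<lambda>e. g <# e) ` d (inv g) = d g" by blast
    hence "card {e \<in> d (inv g). \<beta> h e} = card {e \<in> d g. \<beta> (g \<otimes> h) e}"
      using count[OF that(1), of "g \<otimes> h" "d (inv g)"] that(1) h gG HG d_sub[of "inv g"]
      by (simp add: cancel_left)
    thus "odd (card {e \<in> d (inv g). \<beta> h e}) \<longleftrightarrow> (h \<in> P) \<noteq> (inv (inv g) \<otimes> h \<in> P)"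
      using that h gG HG unfolding \<Phi>_def by (auto simp: cancel_left)
  qed
  have all: "\<Phi> g" if "g \<in> H" for g
  proof -
    have "g \<in> generate G S" using that S by simp
    hence "g \<in> H \<and> \<Phi> g"
    proof (induction rule: generate.induct)
      case one
      show ?case using d_one HG by (auto simp: \<Phi>_def)
    next
      case (incl s) thus ?case using SH gen_case by blast
    next
      case (inv s) thus ?case using SH gen_case inv_case by blast
    next
      case (eng g g') thus ?case using mult_case by blast
    qed
    thus ?thesis by blast
  qed
  have "H \<inter> VA \<subseteq> P"
  proof
    fix g assume g: "g \<in> H \<inter> VA"
    hence "d g = {}" using d_base by auto
    hence "(\<one> \<in> P) = (inv g \<otimes> \<one> \<in> P)" using all[of g] g by (auto simp: \<Phi>_def)
    hence "inv g \<in> P" using g HG by simp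
    hence "inv (inv g) \<in> P" by (rule P.m_inv_closed)
    thus "g \<in> P" using g HG by simp
  qed
  hence "H \<inter> VA = P" using P_sub by blast
  thus "fg_subgroup (H \<inter> VA) G" using fgP by simp
qed

end

section \<open>Edges common to two subtrees\<close>

lemma (in group) double_coset_self:
  assumes "subgroup B G" "subgroup C G" "a \<in> carrier G"
  shows "a \<in> double_coset G B a C"
proof -
  have "a = \<one> \<otimes> a \<otimes> \<one>" using assms(3) by simp
  thus ?thesis using subgroup.one_closed[OF assms(1)] subgroup.one_closed[OF assms(2)]
    unfolding double_coset_eq by blast
qed

context hnn_tree
begin

text \<open>
  A point in the domain of the map \<open>q\<close> that the f.c.i.p. attaches to \<open>f\<close> and \<open>g\<close>. For \<open>f = g = 1\<close> these
  points record orbits of edges common to two subtrees, see \<open>same_class_same_orbit\<close>.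
\<close>

definition edge_class :: "'a set \<Rightarrow> 'a set \<Rightarrow> 'a \<Rightarrow> 'a \<Rightarrow> 'a \<Rightarrow> 'a set" where
  "edge_class B D f g c = double_coset (A\<lparr>carrier := C\<rparr>) (C \<inter> conj_subgroup A B f) c (C \<inter> conj_subgroup A D g)"

definition base_part :: "'g set \<Rightarrow> 'a set" where
  "base_part H = {a \<in> carrier A. i a \<in> H}"

lemma base_part_subgroup: "subgroup H G \<Longrightarrow> subgroup (base_part H) A"
  by (rule subgroup.intro)
    (auto simp: base_part_def subgroup.m_closed subgroup.m_inv_closed subgroup.one_closed)

lemma i_eq_iff: "a \<in> carrier A \<Longrightarrow> b \<in> carrier A \<Longrightarrow> i a = i b \<longleftrightarrow> a = b"
  using i_inj by (auto dest: inj_onD)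

lemma E_lcoset_eq: "x \<in> carrier G \<Longrightarrow> c \<in> C \<Longrightarrow> (x \<otimes> i c) <# E = x <# E"
  using lcoset_eq_iff[OF E_subgroup, of x "x \<otimes> i c"] C_carrier by (auto simp: cancel_left)

lemma VA_lcoset_eq: "x \<in> carrier G \<Longrightarrow> a \<in> carrier A \<Longrightarrow> (x \<otimes> i a) <# VA = x <# VA"
  using lcoset_eq_iff[OF VA_subgroup, of x "x \<otimes> i a"] by (auto simp: cancel_left)

text \<open>
  Edges that leave the base vertex and lie in finitely many \<open>H\<close>-orbits lie in finitely many orbits of
  \<open>H \<inter> A\<close>: if \<open>aE\<close> and \<open>bE\<close> are \<open>H\<close>-translates of the same edge, the element of \<open>H\<close> moving one to the
  other fixes the base vertex. Representatives in distinct double cosets are what the f.c.i.p. takes as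
  input, with \<open>1\<close> among them to represent the base edge.
\<close>

lemma edge_representatives:
  assumes H: "subgroup H G" and Y: "finite Y" "Y \<subseteq> edges"
    and EH: "\<And>e. e \<in> EH \<Longrightarrow> \<exists>h\<in>H. \<exists>y\<in>Y. e = h <# y"
  obtains F where "finite F" "F \<subseteq> carrier A" "\<one>\<^bsub>A\<^esub> \<in> F"
    "inj_on (\<lambda>f. double_coset A (base_part H) f C) F"
    "\<And>a. a \<in> carrier A \<Longrightarrow> i a <# E \<in> EH \<Longrightarrow> \<exists>f\<in>F. a \<in> double_coset A (base_part H) f C"
proof -
  define DC where "DC = (\<lambda>a. double_coset A (base_part H) a C)"
  define Q where "Q = {a \<in> carrier A. i a <# E \<in> EH}"
  define y where "y = (\<lambda>a. SOME y. y \<in> Y \<and> (\<exists>h\<in>H. i a <# E = h <# y))"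
  have y: "y a \<in> Y" "\<exists>h\<in>H. i a <# E = h <# y a" if "a \<in> Q" for a
  proof -
    have "\<exists>y. y \<in> Y \<and> (\<exists>h\<in>H. i a <# E = h <# y)" using that EH unfolding Q_def by blast
    from someI_ex[OF this] show "y a \<in> Y" "\<exists>h\<in>H. i a <# E = h <# y a" unfolding y_def by auto
  qed
  have "finite (y ` Q)" using y(1) Y(1) by (meson finite_subset image_subsetI)
  then obtain Q' where Q': "finite Q'" "Q' \<subseteq> Q" "\<And>a. a \<in> Q \<Longrightarrow> \<exists>b\<in>Q'. y a = y b"
    using finite_representatives by blast
  have DC_self: "a \<in> DC a" if "a \<in> carrier A" for a
    unfolding DC_def using A.double_coset_self[OF base_part_subgroup[OF H] C that] .
  have same: "a \<in> DC b" if ab: "a \<in> Q" "b \<in> Q" "y a = y b" for a b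
  proof -
    obtain h k where hk: "h \<in> H" "k \<in> H" "i a <# E = h <# y a" "i b <# E = k <# y a"
      using y(2)[OF ab(1)] y(2)[OF ab(2)] ab(3) by auto
    have aA: "a \<in> carrier A" and bA: "b \<in> carrier A" using that unfolding Q_def by auto
    have hG: "h \<in> carrier G" and kG: "k \<in> carrier G" using hk H subgroup.mem_carrier by metis+
    have yG: "y a \<subseteq> carrier G" using y(1)[OF that(1)] Y(2) lcoset_carrier by blast
    have "y a = inv k <# (i b <# E)" using hk(4) lcoset_cancel(1)[OF yG kG] by simp
    hence "i a <# E = h <# (inv k <# (i b <# E))" using hk(3) by simp
    also have "\<dots> = (h \<otimes> inv k \<otimes> i b) <# E"
      using hG kG bA E_carrier by (simp add: lcoset_mult l_coset_subset_G m_assoc)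
    finally have "(h \<otimes> inv k \<otimes> i b) <# E = i a <# E" ..
    hence "inv (h \<otimes> inv k \<otimes> i b) \<otimes> i a \<in> E"
      using lcoset_eq_iff[OF E_subgroup, of "h \<otimes> inv k \<otimes> i b" "i a"] hG kG aA bA by simp
    then obtain c where c: "c \<in> C" "inv (h \<otimes> inv k \<otimes> i b) \<otimes> i a = i c" by auto
    have cA: "c \<in> carrier A" using c(1) by (rule C_carrier)
    have ia: "i a = h \<otimes> inv k \<otimes> i b \<otimes> i c"
      unfolding c(2)[symmetric] using hG kG aA bA by (simp add: cancel_left)
    define p where "p = a \<otimes>\<^bsub>A\<^esub> inv\<^bsub>A\<^esub> c \<otimes>\<^bsub>A\<^esub> inv\<^bsub>A\<^esub> b"
    have pA: "p \<in> carrier A" using aA bA cA by (simp add: p_def)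
    have "i p = h \<otimes> inv k"
      using aA bA cA hG kG by (simp add: p_def ia m_assoc cancel_left)
    hence "p \<in> base_part H" using pA hk H unfolding base_part_def
      by (simp add: subgroup.m_closed subgroup.m_inv_closed)
    moreover have "a = p \<otimes>\<^bsub>A\<^esub> b \<otimes>\<^bsub>A\<^esub> c"
      using aA bA cA by (simp add: p_def A.m_assoc A.cancel_left)
    ultimately show ?thesis using c(1) unfolding DC_def double_coset_eq by blast
  qed
  have "DC ` Q' - {DC \<one>\<^bsub>A\<^esub>} \<subseteq> DC ` Q'" by (rule Diff_subset)
  then obtain F0 where "F0 \<subseteq> Q' \<and> inj_on DC F0 \<and> DC ` Q' - {DC \<one>\<^bsub>A\<^esub>} = DC ` F0"
    unfolding subset_image_inj by (elim exE)
  hence F0: "F0 \<subseteq> Q'" "inj_on DC F0" "DC ` Q' - {DC \<one>\<^bsub>A\<^esub>} = DC ` F0" by simp_all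
  show thesis
  proof (rule that[of "insert \<one>\<^bsub>A\<^esub> F0"])
    show "finite (insert \<one>\<^bsub>A\<^esub> F0)" using finite_subset[OF F0(1) Q'(1)] by simp
    show "insert \<one>\<^bsub>A\<^esub> F0 \<subseteq> carrier A" using F0(1) Q'(2) unfolding Q_def by auto
    show "\<one>\<^bsub>A\<^esub> \<in> insert \<one>\<^bsub>A\<^esub> F0" by simp
    have "DC \<one>\<^bsub>A\<^esub> \<notin> DC ` F0" unfolding F0(3)[symmetric] by simp
    hence "inj_on DC (insert \<one>\<^bsub>A\<^esub> F0)"
      using F0(2) unfolding inj_on_insert by blast
    thus "inj_on (\<lambda>f. double_coset A (base_part H) f C) (insert \<one>\<^bsub>A\<^esub> F0)" unfolding DC_def .
    fix a assume a: "a \<in> carrier A" "i a <# E \<in> EH"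
    hence aQ: "a \<in> Q" by (simp add: Q_def)
    then obtain b where b: "b \<in> Q'" "y a = y b" using Q'(3) by blast
    have "a \<in> DC b" by (rule same[OF aQ subsetD[OF Q'(2) b(1)] b(2)])
    have "\<exists>f\<in>insert \<one>\<^bsub>A\<^esub> F0. DC b = DC f"
    proof (cases "DC b = DC \<one>\<^bsub>A\<^esub>")
      case False
      hence "DC b \<in> DC ` Q' - {DC \<one>\<^bsub>A\<^esub>}" using imageI[OF b(1), of DC] by simp
      hence "DC b \<in> DC ` F0" unfolding F0(3) .
      thus ?thesis by (elim imageE) (rule bexI[rotated], rule insertI2)
    qed (rule bexI[OF _ insertI1])
    then obtain f where f: "f \<in> insert \<one>\<^bsub>A\<^esub> F0" "DC b = DC f" by (elim bexE)
    have "a \<in> DC f" using \<open>a \<in> DC b\<close> unfolding f(2) .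
    thus "\<exists>f\<in>insert \<one>\<^bsub>A\<^esub> F0. a \<in> double_coset A (base_part H) f C"
      using f(1) unfolding DC_def by (rule bexI)
  qed
qed

text \<open>
  The source of a good edge has trivial stabiliser and no other outgoing edge in \<open>EL\<close>, so the edge
  can be followed without any choice.
\<close>

definition good :: "'g set \<Rightarrow> 'g set set \<Rightarrow> 'g set \<Rightarrow> bool" where
  "good L EL e \<longleftrightarrow> (\<forall>l\<in>L. l <# src e = src e \<longrightarrow> l = \<one>) \<and> (\<forall>e'\<in>EL. src e' = src e \<longrightarrow> e' = e)"

text \<open>
  An edge in the \<open>H\<close>-orbit and in the \<open>K\<close>-orbit of the base edge is \<open>hE = kE\<close> with \<open>h \<in> H\<close>, \<open>k \<in> K\<close>, and
  is recorded by \<open>\<gamma> = h\<inverse>k\<close> in \<open>C\<close>. Changing \<open>h\<close> and \<open>k\<close> multiplies \<open>\<gamma>\<close> from the two sides by elements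
  of \<open>C \<inter> H\<close> and \<open>C \<inter> K\<close>; so orbits of \<open>H \<inter> K\<close> on such edges inject into double cosets in \<open>C\<close>.
\<close>

lemma same_class_same_orbit:
  assumes H: "subgroup H G" and K: "subgroup K G"
    and hk: "h \<in> H" "k \<in> K" "\<gamma> \<in> C" "i \<gamma> = inv h \<otimes> k"
    and hk': "h' \<in> H" "k' \<in> K" "\<gamma>' \<in> C" "i \<gamma>' = inv h' \<otimes> k'"
    and edge_class: "edge_class (base_part H) (base_part K) \<one>\<^bsub>A\<^esub> \<one>\<^bsub>A\<^esub> \<gamma> = edge_class (base_part H) (base_part K) \<one>\<^bsub>A\<^esub> \<one>\<^bsub>A\<^esub> \<gamma>'"
  shows "\<exists>l\<in>H \<inter> K. h' <# E = l <# (h <# E)"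
proof -
  have G: "h \<in> carrier G" "k \<in> carrier G" "h' \<in> carrier G" "k' \<in> carrier G"
    using hk hk' subgroup.mem_carrier[OF H] subgroup.mem_carrier[OF K] by auto
  have preA: "base_part H \<subseteq> carrier A" "base_part K \<subseteq> carrier A" by (auto simp: base_part_def)
  interpret CC: group "A\<lparr>carrier := C\<rparr>" by (rule A.subgroup_imp_group[OF C])
  have conj: "conj_subgroup A (base_part H) \<one>\<^bsub>A\<^esub> = base_part H" "conj_subgroup A (base_part K) \<one>\<^bsub>A\<^esub> = base_part K"
    using A.conj_subgroup_one preA by auto
  have "\<gamma>' \<in> edge_class (base_part H) (base_part K) \<one>\<^bsub>A\<^esub> \<one>\<^bsub>A\<^esub> \<gamma>'"
  proof -
    have one: "\<one>\<^bsub>A\<^esub> \<in> C \<inter> base_part H" "\<one>\<^bsub>A\<^esub> \<in> C \<inter> base_part K"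
      using subgroup.one_closed[OF C] subgroup.one_closed[OF base_part_subgroup[OF H]]
        subgroup.one_closed[OF base_part_subgroup[OF K]] by auto
    have "\<gamma>' = \<one>\<^bsub>A\<^esub> \<otimes>\<^bsub>A\<^esub> \<gamma>' \<otimes>\<^bsub>A\<^esub> \<one>\<^bsub>A\<^esub>" using C_carrier[OF hk'(3)] by simp
    thus ?thesis unfolding edge_class_def conj double_coset_eq using one by auto
  qed
  then obtain u v where uv: "u \<in> C" "u \<in> base_part H" "v \<in> C" "v \<in> base_part K" "\<gamma>' = u \<otimes>\<^bsub>A\<^esub> \<gamma> \<otimes>\<^bsub>A\<^esub> v"
    unfolding edge_class[symmetric] unfolding edge_class_def conj double_coset_eq by auto
  have uvA: "u \<in> carrier A" "v \<in> carrier A" "\<gamma> \<in> carrier A" using uv hk C_carrier by auto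
  have H_u: "i u \<in> H" and K_v: "i v \<in> K" using uv by (auto simp: base_part_def)
  define l where "l = h' \<otimes> i u \<otimes> inv h"
  have "l \<in> H" unfolding l_def using H hk(1) hk'(1) H_u by (simp add: subgroup.m_closed subgroup.m_inv_closed)
  have "k = h \<otimes> i \<gamma>" using hk(4) G by (simp add: cancel_left)
  moreover have "k' = h' \<otimes> i \<gamma>'" using hk'(4) G by (simp add: cancel_left)
  ultimately have "l = k' \<otimes> inv (i v) \<otimes> inv k"
    using G uvA by (simp add: l_def uv(5) inv_mult_group m_assoc cancel_left)
  hence "l \<in> K" using K hk(2) hk'(2) K_v by (simp add: subgroup.m_closed subgroup.m_inv_closed)
  have "l <# (h <# E) = (h' \<otimes> i u) <# E"
    using G uvA E_carrier by (simp add: lcoset_mult l_def m_assoc)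
  also have "\<dots> = h' <# E" by (rule E_lcoset_eq[OF G(3) uv(1)])
  finally show ?thesis using \<open>l \<in> H\<close> \<open>l \<in> K\<close> by blast
qed

text \<open>
  Conjugation by \<open>k = h\<gamma>\<close> turns the group of the edge \<open>hE = kE\<close> in \<open>H \<inter> K\<close> into \<open>(C \<inter> H)\<^sup>\<gamma> \<inter> (C \<inter> K)\<close>
  and the group of its source into \<open>(A \<inter> H)\<^sup>\<gamma> \<inter> (A \<inter> K)\<close>. Condition \<open>b\<close> puts the vertex group into the
  edge group, and \<open>a\<close> makes the latter trivial. Another edge with
  the same source is \<open>hbfE = k\<delta>gE\<close> for representatives \<open>f\<close>, \<open>g\<close>, and determines a preimage, under the
  map \<open>q\<close> for \<open>f\<close> and \<open>g\<close>, of the double coset of \<open>\<gamma>\<close>; condition \<open>c\<close> leaves only the edge itself.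
\<close>

lemma good_edge:
  assumes H: "subgroup H G" and K: "subgroup K G"
    and hk: "h \<in> H" "k \<in> K" "\<gamma> \<in> C" "i \<gamma> = inv h \<otimes> k"
    and EH: "EH \<subseteq> edges" "\<And>h e. h \<in> H \<Longrightarrow> e \<in> EH \<Longrightarrow> h <# e \<in> EH"
    and EK: "EK \<subseteq> edges" "\<And>k e. k \<in> K \<Longrightarrow> e \<in> EK \<Longrightarrow> k <# e \<in> EK"
    and F: "F \<subseteq> carrier A" "\<And>a. a \<in> carrier A \<Longrightarrow> i a <# E \<in> EH \<Longrightarrow> \<exists>f\<in>F. a \<in> double_coset A (base_part H) f C"
    and F': "F' \<subseteq> carrier A" "\<And>a. a \<in> carrier A \<Longrightarrow> i a <# E \<in> EK \<Longrightarrow> \<exists>f\<in>F'. a \<in> double_coset A (base_part K) f C"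
    and a: "conj_subgroup (A\<lparr>carrier := C\<rparr>) (C \<inter> base_part H) \<gamma> \<inter> (C \<inter> base_part K) = {\<one>\<^bsub>A\<^esub>}"
    and b: "conj_subgroup A (base_part H) \<gamma> \<inter> base_part K \<subseteq> C"
    and c: "\<And>f g c'. f \<in> F \<Longrightarrow> g \<in> F' \<Longrightarrow> c' \<in> C \<Longrightarrow>
      double_coset A (base_part H) (f \<otimes>\<^bsub>A\<^esub> c' \<otimes>\<^bsub>A\<^esub> inv\<^bsub>A\<^esub> g) (base_part K) = double_coset A (base_part H) \<gamma> (base_part K) \<Longrightarrow>
      (f, g, edge_class (base_part H) (base_part K) f g c') = (\<one>\<^bsub>A\<^esub>, \<one>\<^bsub>A\<^esub>, edge_class (base_part H) (base_part K) \<one>\<^bsub>A\<^esub> \<one>\<^bsub>A\<^esub> \<gamma>)"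
  shows "good (H \<inter> K) (EH \<inter> EK) (h <# E)"
proof -
  have G: "h \<in> carrier G" "k \<in> carrier G"
    using hk subgroup.mem_carrier[OF H] subgroup.mem_carrier[OF K] by auto
  have \<gamma>A: "\<gamma> \<in> carrier A" using hk(3) by (rule C_carrier)
  have k_eq: "k = h \<otimes> i \<gamma>" using hk(4) G by (simp add: cancel_left)
  have src_e: "src (h <# E) = h <# VA" by (rule src_lcoset[OF G(1)])
  have k_src: "k <# VA = h <# VA" unfolding k_eq by (rule VA_lcoset_eq[OF G(1) \<gamma>A])
  have pH: "subgroup (base_part H) A" and pK: "subgroup (base_part K) A" using H K base_part_subgroup by auto
  have preA: "base_part H \<subseteq> carrier A" "base_part K \<subseteq> carrier A" by (auto simp: base_part_def)
  have stab: "l = \<one>" if l: "l \<in> H" "l \<in> K" and fixes_src: "l <# (h <# VA) = h <# VA" for l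
  proof -
    have lG: "l \<in> carrier G" using l subgroup.mem_carrier[OF H] by blast
    have "h <# VA = (l \<otimes> h) <# VA" using fixes_src lcoset_mult[OF VA_carrier lG G(1)] by simp
    hence "inv h \<otimes> (l \<otimes> h) \<in> VA" using lcoset_eq_iff[OF VA_subgroup G(1), of "l \<otimes> h"] lG G by simp
    then obtain b where b': "b \<in> carrier A" "inv h \<otimes> (l \<otimes> h) = i b" by auto
    have "i b \<in> H" unfolding b'(2)[symmetric] using H l hk(1) by (simp add: subgroup.m_closed subgroup.m_inv_closed)
    hence bH: "b \<in> base_part H" using b'(1) by (simp add: base_part_def)
    define \<delta> where "\<delta> = inv\<^bsub>A\<^esub> \<gamma> \<otimes>\<^bsub>A\<^esub> b \<otimes>\<^bsub>A\<^esub> \<gamma>"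
    have \<delta>A: "\<delta> \<in> carrier A" using \<gamma>A b' by (simp add: \<delta>_def)
    have "i \<delta> = inv k \<otimes> l \<otimes> k"
      using \<gamma>A b'(1) G lG by (simp add: \<delta>_def k_eq b'(2)[symmetric] inv_mult_group m_assoc)
    hence "i \<delta> \<in> K" using K l hk(2) by (simp add: subgroup.m_closed subgroup.m_inv_closed)
    hence \<delta>K: "\<delta> \<in> base_part K" using \<delta>A by (simp add: base_part_def)
    have "\<delta> \<in> conj_subgroup A (base_part H) \<gamma>" using bH unfolding \<delta>_def conj_subgroup_def by blast
    hence \<delta>C: "\<delta> \<in> C" using b \<delta>K by blast
    have "b = \<gamma> \<otimes>\<^bsub>A\<^esub> \<delta> \<otimes>\<^bsub>A\<^esub> inv\<^bsub>A\<^esub> \<gamma>"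
      using \<gamma>A b'(1) by (simp add: \<delta>_def A.m_assoc A.cancel_left)
    hence bC: "b \<in> C" using \<delta>C hk(3) C by (simp add: subgroup.m_closed subgroup.m_inv_closed)
    have "\<delta> \<in> conj_subgroup (A\<lparr>carrier := C\<rparr>) (C \<inter> base_part H) \<gamma>"
      unfolding conj_subgroup_def \<delta>_def using bC bH A.m_inv_consistent[OF C hk(3)] by auto
    hence "\<delta> = \<one>\<^bsub>A\<^esub>" using a \<delta>C \<delta>K by blast
    hence "b = \<one>\<^bsub>A\<^esub>" using \<open>b = \<gamma> \<otimes>\<^bsub>A\<^esub> \<delta> \<otimes>\<^bsub>A\<^esub> inv\<^bsub>A\<^esub> \<gamma>\<close> \<gamma>A by simp
    hence "inv h \<otimes> (l \<otimes> h) = \<one>" using b'(2) by simp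
    hence "h \<otimes> (inv h \<otimes> (l \<otimes> h)) \<otimes> inv h = \<one>" using G by simp
    thus "l = \<one>" using G lG by (simp add: cancel_left m_assoc)
  qed
  have uniq: "e' = h <# E" if e': "e' \<in> EH \<inter> EK" "src e' = h <# VA" for e'
  proof -
    obtain y where y: "y \<in> carrier G" "e' = y <# E" using e' EH(1) by blast
    have srcy: "y <# VA = h <# VA" using e'(2) y src_lcoset by simp
    have split: "\<exists>b\<in>base_part M. \<exists>f\<in>FF. e' = (x \<otimes> i (b \<otimes>\<^bsub>A\<^esub> f)) <# E"
      if M: "subgroup M G" "x \<in> M" "x <# VA = y <# VA" "inv x <# e' \<in> EM" "FF \<subseteq> carrier A"
        and reps: "\<And>a. a \<in> carrier A \<Longrightarrow> i a <# E \<in> EM \<Longrightarrow> \<exists>f\<in>FF. a \<in> double_coset A (base_part M) f C"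
      for M x EM FF
    proof -
      have xG: "x \<in> carrier G" using M subgroup.mem_carrier by metis
      have "inv x \<otimes> y \<in> VA" using lcoset_eq_iff[OF VA_subgroup xG y(1)] M(3) by simp
      then obtain a where a: "a \<in> carrier A" "inv x \<otimes> y = i a" by auto
      have "inv x <# e' = i a <# E"
        unfolding y(2) a(2)[symmetric] using xG y(1) E_carrier by (simp add: lcoset_mult)
      then obtain f where f: "f \<in> FF" "a \<in> double_coset A (base_part M) f C" using reps[OF a(1)] M(4) by auto
      then obtain b c where bc: "b \<in> base_part M" "c \<in> C" "a = b \<otimes>\<^bsub>A\<^esub> f \<otimes>\<^bsub>A\<^esub> c" unfolding double_coset_eq by blast
      have A': "b \<in> carrier A" "f \<in> carrier A" "c \<in> carrier A"
        using bc f M(5) C_carrier by (auto simp: base_part_def)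
      have "y = x \<otimes> i a" unfolding a(2)[symmetric] using xG y(1) by (simp add: cancel_left)
      hence "y = (x \<otimes> i (b \<otimes>\<^bsub>A\<^esub> f)) \<otimes> i c" unfolding bc(3) using A' xG by (simp add: m_assoc)
      hence "e' = (x \<otimes> i (b \<otimes>\<^bsub>A\<^esub> f)) <# E" unfolding y(2) using E_lcoset_eq[OF _ bc(2)] xG A' by simp
      thus ?thesis using bc(1) f(1) by blast
    qed
    obtain b f where bf: "b \<in> base_part H" "f \<in> F" "e' = (h \<otimes> i (b \<otimes>\<^bsub>A\<^esub> f)) <# E"
      using split[OF H hk(1) _ _ F, of EH] EH(2)[of "inv h"] e'(1) srcy hk(1) subgroup.m_inv_closed[OF H] by auto
    obtain \<delta> g where \<delta>g: "\<delta> \<in> base_part K" "g \<in> F'" "e' = (k \<otimes> i (\<delta> \<otimes>\<^bsub>A\<^esub> g)) <# E"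
      using split[OF K hk(2) _ _ F', of EK] EK(2)[of "inv k"] e'(1) srcy k_src hk(2) subgroup.m_inv_closed[OF K] by auto
    have A': "b \<in> carrier A" "f \<in> carrier A" "\<delta> \<in> carrier A" "g \<in> carrier A"
      using bf \<delta>g F F' preA by auto
    have "inv (h \<otimes> i (b \<otimes>\<^bsub>A\<^esub> f)) \<otimes> (k \<otimes> i (\<delta> \<otimes>\<^bsub>A\<^esub> g)) \<in> E"
      using lcoset_eq_iff[OF E_subgroup, of "h \<otimes> i (b \<otimes>\<^bsub>A\<^esub> f)" "k \<otimes> i (\<delta> \<otimes>\<^bsub>A\<^esub> g)"] bf(3) \<delta>g(3) G A' by simp
    then obtain c2 where c2: "c2 \<in> C" "inv (h \<otimes> i (b \<otimes>\<^bsub>A\<^esub> f)) \<otimes> (k \<otimes> i (\<delta> \<otimes>\<^bsub>A\<^esub> g)) = i c2" by auto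
    have c2A: "c2 \<in> carrier A" using c2(1) by (rule C_carrier)
    have "i c2 = i (inv\<^bsub>A\<^esub> f \<otimes>\<^bsub>A\<^esub> inv\<^bsub>A\<^esub> b \<otimes>\<^bsub>A\<^esub> \<gamma> \<otimes>\<^bsub>A\<^esub> \<delta> \<otimes>\<^bsub>A\<^esub> g)"
      unfolding c2(2)[symmetric] k_eq using G A' \<gamma>A by (simp add: inv_mult_group m_assoc cancel_left)
    hence c2_eq: "c2 = inv\<^bsub>A\<^esub> f \<otimes>\<^bsub>A\<^esub> inv\<^bsub>A\<^esub> b \<otimes>\<^bsub>A\<^esub> \<gamma> \<otimes>\<^bsub>A\<^esub> \<delta> \<otimes>\<^bsub>A\<^esub> g"
      by (rule i_eq_iff[THEN iffD1, rotated 2]) (use c2A A' \<gamma>A in simp_all)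
    have fcg: "f \<otimes>\<^bsub>A\<^esub> c2 \<otimes>\<^bsub>A\<^esub> inv\<^bsub>A\<^esub> g = inv\<^bsub>A\<^esub> b \<otimes>\<^bsub>A\<^esub> \<gamma> \<otimes>\<^bsub>A\<^esub> \<delta>"
      unfolding c2_eq using A' \<gamma>A by (simp add: A.m_assoc A.cancel_left)
    have "double_coset A (base_part H) (f \<otimes>\<^bsub>A\<^esub> c2 \<otimes>\<^bsub>A\<^esub> inv\<^bsub>A\<^esub> g) (base_part K) = double_coset A (base_part H) \<gamma> (base_part K)"
      unfolding fcg using A.double_coset_absorb[OF pH pK _ \<delta>g(1) \<gamma>A, of "inv\<^bsub>A\<^esub> b"]
        subgroup.m_inv_closed[OF pH bf(1)] by simp
    from c[OF bf(2) \<delta>g(2) c2(1) this]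
    have f1: "f = \<one>\<^bsub>A\<^esub>" and g1: "g = \<one>\<^bsub>A\<^esub>"
      and cl: "edge_class (base_part H) (base_part K) f g c2 = edge_class (base_part H) (base_part K) \<one>\<^bsub>A\<^esub> \<one>\<^bsub>A\<^esub> \<gamma>" by auto
    have conj: "conj_subgroup A (base_part H) \<one>\<^bsub>A\<^esub> = base_part H" "conj_subgroup A (base_part K) \<one>\<^bsub>A\<^esub> = base_part K"
      using A.conj_subgroup_one preA by auto
    have "c2 \<in> edge_class (base_part H) (base_part K) \<one>\<^bsub>A\<^esub> \<one>\<^bsub>A\<^esub> c2"
    proof -
      have one: "\<one>\<^bsub>A\<^esub> \<in> C \<inter> base_part H" "\<one>\<^bsub>A\<^esub> \<in> C \<inter> base_part K"
        using subgroup.one_closed[OF C] subgroup.one_closed[OF pH] subgroup.one_closed[OF pK] by auto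
      have "c2 = \<one>\<^bsub>A\<^esub> \<otimes>\<^bsub>A\<^esub> c2 \<otimes>\<^bsub>A\<^esub> \<one>\<^bsub>A\<^esub>" using c2A by simp
      thus ?thesis unfolding edge_class_def conj double_coset_eq using one by auto
    qed
    hence "c2 \<in> edge_class (base_part H) (base_part K) \<one>\<^bsub>A\<^esub> \<one>\<^bsub>A\<^esub> \<gamma>" using cl unfolding f1 g1 by simp
    then obtain u v where uv: "u \<in> C" "u \<in> base_part H" "v \<in> C" "v \<in> base_part K" "c2 = u \<otimes>\<^bsub>A\<^esub> \<gamma> \<otimes>\<^bsub>A\<^esub> v"
      unfolding edge_class_def conj double_coset_eq by auto
    have uvA: "u \<in> carrier A" "v \<in> carrier A" using uv C_carrier by auto
    have c2': "inv\<^bsub>A\<^esub> b \<otimes>\<^bsub>A\<^esub> \<gamma> \<otimes>\<^bsub>A\<^esub> \<delta> = u \<otimes>\<^bsub>A\<^esub> \<gamma> \<otimes>\<^bsub>A\<^esub> v"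
      using fcg uv(5) c2A unfolding f1 g1 by simp
    have bu: "b \<otimes>\<^bsub>A\<^esub> u = \<gamma> \<otimes>\<^bsub>A\<^esub> \<delta> \<otimes>\<^bsub>A\<^esub> inv\<^bsub>A\<^esub> v \<otimes>\<^bsub>A\<^esub> inv\<^bsub>A\<^esub> \<gamma>"
    proof -
      have "b \<otimes>\<^bsub>A\<^esub> u = b \<otimes>\<^bsub>A\<^esub> (u \<otimes>\<^bsub>A\<^esub> \<gamma> \<otimes>\<^bsub>A\<^esub> v) \<otimes>\<^bsub>A\<^esub> inv\<^bsub>A\<^esub> v \<otimes>\<^bsub>A\<^esub> inv\<^bsub>A\<^esub> \<gamma>"
        using A' uvA \<gamma>A by (simp add: A.m_assoc A.cancel_left)
      also have "\<dots> = \<gamma> \<otimes>\<^bsub>A\<^esub> \<delta> \<otimes>\<^bsub>A\<^esub> inv\<^bsub>A\<^esub> v \<otimes>\<^bsub>A\<^esub> inv\<^bsub>A\<^esub> \<gamma>"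
        unfolding c2'[symmetric] using A' uvA \<gamma>A by (simp add: A.m_assoc A.cancel_left)
      finally show ?thesis .
    qed
    \<comment> \<open>The other edge has turned out to lie in the same orbit, and the element \<open>l\<close> moving one to the
      other fixes the common source.\<close>
    define l where "l = h \<otimes> i (b \<otimes>\<^bsub>A\<^esub> u) \<otimes> inv h"
    have buH: "i (b \<otimes>\<^bsub>A\<^esub> u) \<in> H" using subgroup.m_closed[OF pH bf(1) uv(2)] by (simp add: base_part_def)
    have "l \<in> H" unfolding l_def using H hk(1) buH by (simp add: subgroup.m_closed subgroup.m_inv_closed)
    have "\<delta> \<otimes>\<^bsub>A\<^esub> inv\<^bsub>A\<^esub> v \<in> base_part K" using pK \<delta>g(1) uv(4) by (simp add: subgroup.m_closed subgroup.m_inv_closed)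
    hence "i (\<delta> \<otimes>\<^bsub>A\<^esub> inv\<^bsub>A\<^esub> v) \<in> K" by (simp add: base_part_def)
    moreover have "l = k \<otimes> i (\<delta> \<otimes>\<^bsub>A\<^esub> inv\<^bsub>A\<^esub> v) \<otimes> inv k"
      unfolding l_def bu k_eq using A' uvA \<gamma>A G by (simp add: inv_mult_group m_assoc)
    ultimately have "l \<in> K" using K hk(2) by (simp add: subgroup.m_closed subgroup.m_inv_closed)
    have "l <# (h <# VA) = (h \<otimes> i (b \<otimes>\<^bsub>A\<^esub> u)) <# VA"
      using G A' uvA VA_carrier by (simp add: lcoset_mult l_def m_assoc)
    also have "\<dots> = h <# VA" using A' uvA G by (intro VA_lcoset_eq) auto
    finally have "l = \<one>" using stab \<open>l \<in> H\<close> \<open>l \<in> K\<close> by blast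
    hence "inv h \<otimes> (h \<otimes> i (b \<otimes>\<^bsub>A\<^esub> u) \<otimes> inv h) \<otimes> h = \<one>" unfolding l_def using G by simp
    hence "i (b \<otimes>\<^bsub>A\<^esub> u) = i \<one>\<^bsub>A\<^esub>" using G A' uvA by (simp add: m_assoc cancel_left)
    hence "b \<otimes>\<^bsub>A\<^esub> u = \<one>\<^bsub>A\<^esub>" using i_eq_iff A' uvA by blast
    hence "b = inv\<^bsub>A\<^esub> u" using A' uvA A.inv_equality by metis
    hence "b \<in> C" using uv(1) subgroup.m_inv_closed[OF C] by simp
    thus "e' = h <# E" unfolding bf(3) f1 using E_lcoset_eq[OF G(1)] A' by simp
  qed
  show ?thesis unfolding good_def src_e using stab uniq by blast
qed

lemma base_part_fg:
  assumes "fgip_rel G VA" "fg_subgroup H G"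
  shows "fg_subgroup (base_part H) A"
  unfolding base_part_def
  using fg_subgroup_vimage[OF is_group A i_hom i_inj] assms by (simp add: fgip_rel_def)

text \<open>
  The classes violating the conditions of \<open>good_edge\<close> are finite in number: those of \<open>a\<close> by the
  s.f.g.i.p. of \<open>C\<close>; those of \<open>c\<close> by the f.c.i.p.; those of \<open>b\<close> because the \<open>C\<close>-f.g.i.p. leaves
  finitely many double cosets in \<open>A\<close>, each of which splits into finitely many classes by the f.c.i.p.
\<close>

lemma bad_edges_at_base:
  assumes fcip: "fcip_rel A C" and pair: "pair_fgip A C" and sfgip: "sfgip (A\<lparr>carrier := C\<rparr>)"
    and E_fgip: "fgip_rel G E" and VA_fgip: "fgip_rel G VA"
    and fgH: "fg_subgroup H G" and fgK: "fg_subgroup K G"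
    and EH: "EH \<subseteq> edges" "\<And>h e. h \<in> H \<Longrightarrow> e \<in> EH \<Longrightarrow> h <# e \<in> EH"
    and YH: "finite YH" "YH \<subseteq> edges" "\<And>e. e \<in> EH \<Longrightarrow> \<exists>h\<in>H. \<exists>y\<in>YH. e = h <# y"
    and EK: "EK \<subseteq> edges" "\<And>k e. k \<in> K \<Longrightarrow> e \<in> EK \<Longrightarrow> k <# e \<in> EK"
    and YK: "finite YK" "YK \<subseteq> edges" "\<And>e. e \<in> EK \<Longrightarrow> \<exists>k\<in>K. \<exists>y\<in>YK. e = k <# y"
  defines "bad \<equiv> {e \<in> (\<lambda>h. h <# E) ` H \<inter> (\<lambda>k. k <# E) ` K. \<not> good (H \<inter> K) (EH \<inter> EK) e}"
  shows "\<exists>Z. finite Z \<and> Z \<subseteq> edges \<and> (\<forall>e\<in>bad. \<exists>l\<in>H \<inter> K. \<exists>z\<in>Z. e = l <# z)"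
proof -
  have H: "subgroup H G" and K: "subgroup K G" using fgH fgK fg_subgroupD by auto
  have fgB: "fg_subgroup (base_part H) A" and fgD: "fg_subgroup (base_part K) A"
    using base_part_fg[OF VA_fgip] fgH fgK by auto
  have fgE: "fg_subgroup (C \<inter> base_part M) (A\<lparr>carrier := C\<rparr>)" if M: "fg_subgroup M G" for M
  proof -
    have "fg_subgroup ((M \<inter> E) \<inter> VA) G"
      using E_fgip E_VA M unfolding fgip_rel_def by (metis Int_absorb2 inf.coboundedI2)
    hence "fg_subgroup {a \<in> carrier A. i a \<in> M \<inter> E} A"
      by (rule fg_subgroup_vimage[OF is_group A i_hom i_inj])
    moreover have "{a \<in> carrier A. i a \<in> M \<inter> E} = C \<inter> base_part M"
      using i_eq_iff C_carrier unfolding base_part_def by blast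
    ultimately show ?thesis using A.fg_subgroup_subgroup_iff[OF C, of "C \<inter> base_part M"] by simp
  qed
  obtain F where F: "finite F" "F \<subseteq> carrier A" "\<one>\<^bsub>A\<^esub> \<in> F"
    "inj_on (\<lambda>f. double_coset A (base_part H) f C) F"
    "\<And>a. a \<in> carrier A \<Longrightarrow> i a <# E \<in> EH \<Longrightarrow> \<exists>f\<in>F. a \<in> double_coset A (base_part H) f C"
    by (rule edge_representatives[OF H YH]) blast+
  obtain F' where F': "finite F'" "F' \<subseteq> carrier A" "\<one>\<^bsub>A\<^esub> \<in> F'"
    "inj_on (\<lambda>f. double_coset A (base_part K) f C) F'"
    "\<And>a. a \<in> carrier A \<Longrightarrow> i a <# E \<in> EK \<Longrightarrow> \<exists>f\<in>F'. a \<in> double_coset A (base_part K) f C"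
    by (rule edge_representatives[OF K YK]) blast+
  let ?c = "edge_class (base_part H) (base_part K)"
  have preA: "base_part H \<subseteq> carrier A" "base_part K \<subseteq> carrier A" by (auto simp: base_part_def)
  have conj: "conj_subgroup A (base_part H) \<one>\<^bsub>A\<^esub> = base_part H" "conj_subgroup A (base_part K) \<one>\<^bsub>A\<^esub> = base_part K"
    using A.conj_subgroup_one preA by auto
  define Ba where "Ba = {\<gamma> \<in> C. conj_subgroup (A\<lparr>carrier := C\<rparr>) (C \<inter> base_part H) \<gamma> \<inter> (C \<inter> base_part K) \<noteq> {\<one>\<^bsub>A\<^esub>}}"
  define Bb where "Bb = {\<gamma> \<in> C. \<not> conj_subgroup A (base_part H) \<gamma> \<inter> base_part K \<subseteq> C}"
  define Bc where "Bc = {\<gamma> \<in> C. \<exists>f\<in>F. \<exists>g\<in>F'. \<exists>c'\<in>C. (f, g, ?c f g c') \<noteq> (\<one>\<^bsub>A\<^esub>, \<one>\<^bsub>A\<^esub>, ?c \<one>\<^bsub>A\<^esub> \<one>\<^bsub>A\<^esub> \<gamma>) \<and>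
         double_coset A (base_part H) (f \<otimes>\<^bsub>A\<^esub> c' \<otimes>\<^bsub>A\<^esub> inv\<^bsub>A\<^esub> g) (base_part K) = double_coset A (base_part H) \<gamma> (base_part K)}"
  let ?q = "?c \<one>\<^bsub>A\<^esub> \<one>\<^bsub>A\<^esub>"
  have q_eq: "?q \<gamma> = double_coset (A\<lparr>carrier := C\<rparr>) (C \<inter> base_part H) \<gamma> (C \<inter> base_part K)" for \<gamma>
    unfolding edge_class_def conj ..
  have "finite (?q ` Ba)"
  proof -
    have "finite {double_coset (A\<lparr>carrier := C\<rparr>) (C \<inter> base_part H) g (C \<inter> base_part K) | g. g \<in> carrier (A\<lparr>carrier := C\<rparr>) \<and>
        conj_subgroup (A\<lparr>carrier := C\<rparr>) (C \<inter> base_part H) g \<inter> (C \<inter> base_part K) \<noteq> {\<one>\<^bsub>A\<lparr>carrier := C\<rparr>\<^esub>}}"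
      using sfgip fgE[OF fgH] fgE[OF fgK] unfolding sfgip_def by blast
    moreover have "?q ` Ba = {double_coset (A\<lparr>carrier := C\<rparr>) (C \<inter> base_part H) g (C \<inter> base_part K) | g. g \<in> carrier (A\<lparr>carrier := C\<rparr>) \<and>
        conj_subgroup (A\<lparr>carrier := C\<rparr>) (C \<inter> base_part H) g \<inter> (C \<inter> base_part K) \<noteq> {\<one>\<^bsub>A\<lparr>carrier := C\<rparr>\<^esub>}}"
      unfolding Ba_def q_eq by auto
    ultimately show ?thesis by simp
  qed
  moreover have "finite (?q ` Bb)"
  proof -
    have "finite {double_coset A (base_part H) g (base_part K) | g. g \<in> C \<and> \<not> conj_subgroup A (base_part H) g \<inter> base_part K \<subseteq> C}"
      using pair fgB fgD unfolding pair_fgip_def by blast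
    from A.fcip_rel_finite_fibre[OF fcip fgB fgD F(1,2,4,3) F'(1,2,4,3) this]
    have "finite {?q c | c. c \<in> C \<and> double_coset A (base_part H) c (base_part K) \<in>
        {double_coset A (base_part H) g (base_part K) | g. g \<in> C \<and> \<not> conj_subgroup A (base_part H) g \<inter> base_part K \<subseteq> C}}"
      unfolding edge_class_def .
    thus ?thesis by (rule rev_finite_subset) (auto simp: Bb_def)
  qed
  moreover have "finite (?q ` Bc)"
  proof -
    have "?q ` Bc = {?q c | c. c \<in> C \<and> (\<exists>f\<in>F. \<exists>g\<in>F'. \<exists>c'\<in>C. (f, g, ?c f g c') \<noteq> (\<one>\<^bsub>A\<^esub>, \<one>\<^bsub>A\<^esub>, ?q c) \<and>
         double_coset A (base_part H) (f \<otimes>\<^bsub>A\<^esub> c' \<otimes>\<^bsub>A\<^esub> inv\<^bsub>A\<^esub> g) (base_part K) = double_coset A (base_part H) c (base_part K))}"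
      unfolding Bc_def by blast
    thus ?thesis
      using A.fcip_rel_finite_ambiguous[OF fcip fgB fgD F(1,2,4,3) F'(1,2,4,3)] unfolding edge_class_def by simp
  qed
  ultimately have fin: "finite (?q ` (Ba \<union> Bb \<union> Bc))" by (simp add: image_Un)
  define \<gamma> where "\<gamma> = (\<lambda>e. SOME \<gamma>. \<gamma> \<in> C \<and> (\<exists>h\<in>H. \<exists>k\<in>K. i \<gamma> = inv h \<otimes> k \<and> e = h <# E))"
  have \<gamma>: "\<gamma> e \<in> C" "\<exists>h\<in>H. \<exists>k\<in>K. i (\<gamma> e) = inv h \<otimes> k \<and> e = h <# E"
    if "e \<in> (\<lambda>h. h <# E) ` H \<inter> (\<lambda>k. k <# E) ` K" for e
  proof -
    from that obtain h k where hk: "h \<in> H" "k \<in> K" "e = h <# E" "h <# E = k <# E" by auto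
    have "inv h \<otimes> k \<in> E"
      using lcoset_eq_iff[OF E_subgroup, of h k] hk subgroup.mem_carrier[OF H] subgroup.mem_carrier[OF K] by simp
    then obtain c where "c \<in> C" "inv h \<otimes> k = i c" by auto
    hence "\<exists>\<gamma>. \<gamma> \<in> C \<and> (\<exists>h\<in>H. \<exists>k\<in>K. i \<gamma> = inv h \<otimes> k \<and> e = h <# E)"
      using hk by (intro exI[of _ c] conjI bexI[of _ h] bexI[of _ k]) auto
    from someI_ex[OF this] show "\<gamma> e \<in> C" "\<exists>h\<in>H. \<exists>k\<in>K. i (\<gamma> e) = inv h \<otimes> k \<and> e = h <# E"
      unfolding \<gamma>_def by auto
  qed
  have "\<gamma> e \<in> Ba \<union> Bb \<union> Bc" if e: "e \<in> bad" for e
  proof (rule ccontr)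
    assume not: "\<gamma> e \<notin> Ba \<union> Bb \<union> Bc"
    have e': "e \<in> (\<lambda>h. h <# E) ` H \<inter> (\<lambda>k. k <# E) ` K" using e unfolding bad_def by blast
    obtain h k where hk: "h \<in> H" "k \<in> K" "i (\<gamma> e) = inv h \<otimes> k" "e = h <# E"
      using \<gamma>(2)[OF e'] by blast
    have "good (H \<inter> K) (EH \<inter> EK) (h <# E)"
    proof (rule good_edge[OF H K hk(1,2) \<gamma>(1)[OF e'] hk(3) EH EK F(2,5) F'(2,5)])
      show "conj_subgroup (A\<lparr>carrier := C\<rparr>) (C \<inter> base_part H) (\<gamma> e) \<inter> (C \<inter> base_part K) = {\<one>\<^bsub>A\<^esub>}"
        using not \<gamma>(1)[OF e'] unfolding Ba_def by blast
      show "conj_subgroup A (base_part H) (\<gamma> e) \<inter> base_part K \<subseteq> C"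
        using not \<gamma>(1)[OF e'] unfolding Bb_def by blast
      show "(f, g, ?c f g c') = (\<one>\<^bsub>A\<^esub>, \<one>\<^bsub>A\<^esub>, ?q (\<gamma> e))"
        if "f \<in> F" "g \<in> F'" "c' \<in> C" "double_coset A (base_part H) (f \<otimes>\<^bsub>A\<^esub> c' \<otimes>\<^bsub>A\<^esub> inv\<^bsub>A\<^esub> g) (base_part K)
          = double_coset A (base_part H) (\<gamma> e) (base_part K)" for f g c'
        using not \<gamma>(1)[OF e'] that unfolding Bc_def by blast
    qed assumption+
    thus False using e hk(4) unfolding bad_def by simp
  qed
  hence "(\<lambda>e. ?q (\<gamma> e)) ` bad \<subseteq> ?q ` (Ba \<union> Bb \<union> Bc)" by blast
  hence "finite ((\<lambda>e. ?q (\<gamma> e)) ` bad)" using fin finite_subset by blast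
  then obtain Z where Z: "finite Z" "Z \<subseteq> bad" "\<And>e. e \<in> bad \<Longrightarrow> \<exists>z\<in>Z. ?q (\<gamma> e) = ?q (\<gamma> z)"
    by (rule finite_representatives) blast
  have "\<exists>l\<in>H \<inter> K. \<exists>z\<in>Z. e = l <# z" if e: "e \<in> bad" for e
  proof -
    obtain z where z: "z \<in> Z" "?q (\<gamma> e) = ?q (\<gamma> z)" using Z(3)[OF e] by blast
    have e': "e \<in> (\<lambda>h. h <# E) ` H \<inter> (\<lambda>k. k <# E) ` K" using e unfolding bad_def by blast
    have z': "z \<in> (\<lambda>h. h <# E) ` H \<inter> (\<lambda>k. k <# E) ` K" using z(1) Z(2) unfolding bad_def by blast
    obtain h k where hk: "h \<in> H" "k \<in> K" "i (\<gamma> e) = inv h \<otimes> k" "e = h <# E"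
      using \<gamma>(2)[OF e'] by blast
    obtain h' k' where hk': "h' \<in> H" "k' \<in> K" "i (\<gamma> z) = inv h' \<otimes> k'" "z = h' <# E"
      using \<gamma>(2)[OF z'] by blast
    have "\<exists>l\<in>H \<inter> K. h <# E = l <# (h' <# E)"
      by (rule same_class_same_orbit[OF H K hk'(1,2) \<gamma>(1)[OF z'] hk'(3) hk(1,2) \<gamma>(1)[OF e'] hk(3)])
        (use z(2) in simp)
    thus ?thesis using hk(4) hk'(4) z(1) by blast
  qed
  moreover have "Z \<subseteq> edges"
    using Z(2) subgroup.subset[OF H] unfolding bad_def by blast
  ultimately show ?thesis using Z(1) by blast
qed

text \<open>
  The edges of the subtree spanned by the \<open>H\<close>-orbit of the base vertex.
\<close>

definition orbit_hull :: "'g set \<Rightarrow> 'g set set" where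
  "orbit_hull H = (\<Union>h\<in>H. d h)"

lemma orbit_hull_edges: "subgroup H G \<Longrightarrow> orbit_hull H \<subseteq> edges"
  unfolding orbit_hull_def by (intro UN_least d_edges) (rule subgroup.mem_carrier)

lemma orbit_hull_act:
  assumes H: "subgroup H G" and h: "h \<in> H" and e: "e \<in> orbit_hull H"
  shows "h <# e \<in> orbit_hull H"
proof -
  obtain h' where h': "h' \<in> H" "e \<in> d h'" using e unfolding orbit_hull_def by blast
  have "d (h \<otimes> h') = sym_diff (d h) ((\<lambda>e. h <# e) ` d h')"
    using h h' subgroup.mem_carrier[OF H] by (intro d_mult) auto
  hence "h <# e \<in> d (h \<otimes> h') \<union> d h" using h'(2) by blast
  thus ?thesis using h h' subgroup.m_closed[OF H] unfolding orbit_hull_def by blast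
qed

text \<open>
  By the cocycle identity the geodesic of a product of generators is covered by translates of the
  geodesics of the generators.
\<close>

lemma orbit_hull_cofinite:
  assumes "fg_subgroup H G"
  obtains Y where "finite Y" "Y \<subseteq> edges" "\<And>e. e \<in> orbit_hull H \<Longrightarrow> \<exists>h\<in>H. \<exists>y\<in>Y. e = h <# y"
proof -
  obtain S where S: "finite S" "S \<subseteq> carrier G" "H = generate G S" and H: "subgroup H G"
    using assms by (auto simp: fg_subgroup_def)
  define Y where "Y = (\<Union>s\<in>S. d s)"
  have Ysub: "Y \<subseteq> edges" using S(2) d_edges unfolding Y_def by blast
  have HG: "h \<in> carrier G" if "h \<in> H" for h using that subgroup.mem_carrier[OF H] by blast
  have SH: "s \<in> H" if "s \<in> S" for s using that S(3) generate.incl[of s S G] by simp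
  define Orb where "Orb = {h <# y | h y. h \<in> H \<and> y \<in> Y}"
  have O_act: "h <# e \<in> Orb" if "h \<in> H" "e \<in> Orb" for h e
  proof -
    from that(2) obtain h' y where hy: "h' \<in> H" "y \<in> Y" "e = h' <# y" unfolding Orb_def by blast
    have yG: "y \<subseteq> carrier G" by (rule lcoset_carrier[OF subsetD[OF Ysub hy(2)]])
    have "h <# e = (h \<otimes> h') <# y"
      unfolding hy(3) by (rule lcoset_mult[OF yG HG[OF that(1)] HG[OF hy(1)]])
    thus ?thesis unfolding Orb_def using hy that subgroup.m_closed[OF H] by blast
  qed
  have d_O: "d s \<subseteq> Orb" if "s \<in> S" for s
  proof
    fix e assume "e \<in> d s"
    hence e: "e \<in> Y" using that unfolding Y_def by blast
    hence "e = \<one> <# e" using lcos_mult_one[OF lcoset_carrier[OF subsetD[OF Ysub e]]] by simp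
    thus "e \<in> Orb" unfolding Orb_def using e subgroup.one_closed[OF H] by blast
  qed
  have "h \<in> H \<and> d h \<subseteq> Orb" if "h \<in> generate G S" for h
    using that
  proof (induction rule: generate.induct)
    case one
    thus ?case using subgroup.one_closed[OF H] by (simp add: d_one)
  next
    case (incl s) thus ?case using SH d_O by blast
  next
    case (inv s)
    have sG: "s \<in> carrier G" and sH: "s \<in> H" "inv s \<in> H"
      using inv S(2) SH subgroup.m_inv_closed[OF H] by auto
    have "sym_diff (d (inv s)) ((\<lambda>e. inv s <# e) ` d s) = {}"
      using d_mult[of "inv s" s] sG by (simp add: d_one)
    hence eq: "d (inv s) = (\<lambda>e. inv s <# e) ` d s" by blast
    have "d (inv s) \<subseteq> Orb"
      unfolding eq by (rule image_subsetI) (rule O_act[OF sH(2) subsetD[OF d_O[OF inv]]])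
    thus ?case using sH(2) by simp
  next
    case (eng g h)
    hence gh: "g \<in> H" "h \<in> H" and sub: "d g \<subseteq> Orb" "d h \<subseteq> Orb" by simp_all
    have "(\<lambda>e. g <# e) ` d h \<subseteq> Orb"
      by (rule image_subsetI) (rule O_act[OF gh(1) subsetD[OF sub(2)]])
    hence "d (g \<otimes> h) \<subseteq> Orb" unfolding d_mult[OF HG[OF gh(1)] HG[OF gh(2)]] using sub(1) by blast
    thus ?case using subgroup.m_closed[OF H gh] by simp
  qed
  hence "orbit_hull H \<subseteq> Orb" using S(3) unfolding orbit_hull_def by blast
  moreover have "finite Y" using S d_finite unfolding Y_def by auto
  ultimately show thesis by (intro that[of Y] Ysub) (auto simp: Orb_def dest!: subsetD)
qed

text \<open>
  The edges of the subtrees of \<open>H\<close> and \<open>K\<close> lie in finitely many orbits \<open>Hy\<close> and \<open>Ky'\<close>. If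
  \<open>Hy\<close> and \<open>Ky'\<close> have an edge \<open>xE\<close> in common, translating by \<open>x\<inverse>\<close> turns it into the base edge and
  reduces their intersection to \<open>bad_edges_at_base\<close>.
\<close>

lemma bad_edges:
  assumes fcip: "fcip_rel A C" and pair: "pair_fgip A C" and sfgip: "sfgip (A\<lparr>carrier := C\<rparr>)"
    and E_fgip: "fgip_rel G E"
    and fgH: "fg_subgroup H G" and fgK: "fg_subgroup K G"
  shows "\<exists>Z. finite Z \<and> Z \<subseteq> edges \<and>
    (\<forall>e\<in>orbit_hull (H \<inter> K). \<not> good (H \<inter> K) (orbit_hull (H \<inter> K)) e \<longrightarrow> (\<exists>l\<in>H \<inter> K. \<exists>z\<in>Z. e = l <# z))"
proof -
  have VA_fgip: "fgip_rel G VA" by (rule fgip_rel_base[OF E_fgip])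
  have H: "subgroup H G" and K: "subgroup K G" using fgH fgK fg_subgroupD by auto
  obtain YH where YH: "finite YH" "YH \<subseteq> edges" "\<And>e. e \<in> orbit_hull H \<Longrightarrow> \<exists>h\<in>H. \<exists>y\<in>YH. e = h <# y"
    by (rule orbit_hull_cofinite[OF fgH]) blast
  obtain YK where YK: "finite YK" "YK \<subseteq> edges" "\<And>e. e \<in> orbit_hull K \<Longrightarrow> \<exists>h\<in>K. \<exists>y\<in>YK. e = h <# y"
    by (rule orbit_hull_cofinite[OF fgK]) blast
  define bad where "bad = {e \<in> orbit_hull (H \<inter> K). \<not> good (H \<inter> K) (orbit_hull (H \<inter> K)) e}"
  have hull_sub: "orbit_hull (H \<inter> K) \<subseteq> orbit_hull H \<inter> orbit_hull K" unfolding orbit_hull_def by blast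
  have pairwise: "\<exists>Z. finite Z \<and> Z \<subseteq> edges \<and> (\<forall>e\<in>bad. e \<in> (\<lambda>h. h <# y) ` H \<longrightarrow> e \<in> (\<lambda>k. k <# y') ` K \<longrightarrow>
      (\<exists>l\<in>H \<inter> K. \<exists>z\<in>Z. e = l <# z))" if y: "y \<in> YH" and y': "y' \<in> YK" for y y'
  proof (cases "(\<lambda>h. h <# y) ` H \<inter> (\<lambda>k. k <# y') ` K = {}")
    case True
    thus ?thesis by (intro exI[of _ "{}"]) blast
  next
    case False
    then obtain h0 k0 where h0: "h0 \<in> H" and k0: "k0 \<in> K" and eq0: "h0 <# y = k0 <# y'" by blast
    have HG: "h \<in> carrier G" if "h \<in> H" for h using that subgroup.mem_carrier[OF H] by blast
    have KG: "h \<in> carrier G" if "h \<in> K" for h using that subgroup.mem_carrier[OF K] by blast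
    have yE: "y \<in> edges" "y' \<in> edges" using y y' YH(2) YK(2) by auto
    have yG: "y \<subseteq> carrier G" "y' \<subseteq> carrier G" using yE lcoset_carrier by auto
    obtain x where x: "x \<in> carrier G" "h0 <# y = x <# E"
      using edge_act[OF HG[OF h0] yE(1)] by auto
    define T where "T = (\<lambda>M. (\<lambda>h. inv x \<otimes> h \<otimes> x) ` M)"
    define TE where "TE = (\<lambda>X. (\<lambda>e. inv x <# e) ` X)"
    have ix: "inv x \<in> carrier G" using x by simp
    have tr: "(inv x \<otimes> h \<otimes> x) <# (inv x <# e) = inv x <# (h <# e)"
      if "h \<in> carrier G" "e \<in> edges" for h e
      using that x lcoset_carrier[OF that(2)] by (simp add: lcoset_mult m_assoc cancel_left l_coset_subset_G)
    have orb: "\<exists>h'\<in>T M. inv x <# e = h' <# E"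
      if M: "subgroup M G" "m0 \<in> M" "e \<in> (\<lambda>h. h <# u) ` M" "u \<in> edges" "m0 <# u = x <# E" for M m0 e and u :: "'g set"
    proof -
      from M(3) obtain h where h: "h \<in> M" "e = h <# u" by blast
      have MG: "m \<in> carrier G" if "m \<in> M" for m using that subgroup.mem_carrier[OF M(1)] by blast
      have uG: "u \<subseteq> carrier G" using M(4) lcoset_carrier by blast
      have u: "u = inv m0 <# (x <# E)" using lcoset_cancel(1)[OF uG MG[OF M(2)]] M(5) by simp
      have "inv x <# e = (inv x \<otimes> (h \<otimes> inv m0) \<otimes> x) <# E"
        unfolding h(2) u using MG[OF h(1)] MG[OF M(2)] x E_carrier
        by (simp add: lcoset_mult l_coset_subset_G m_assoc)
      moreover have "h \<otimes> inv m0 \<in> M" using M(1,2) h(1) by (simp add: subgroup.m_closed subgroup.m_inv_closed)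
      ultimately show ?thesis unfolding T_def by blast
    qed
    have T_fg: "fg_subgroup (T M) G" if "fg_subgroup M G" for M
      unfolding T_def by (rule fg_subgroup_conj_inv[OF that x(1)])
    have TE_edges: "TE X \<subseteq> edges" if "X \<subseteq> edges" for X
      unfolding TE_def using that edge_act[OF ix] by blast
    have TE_act: "h <# e \<in> TE X" if "h \<in> T M" "e \<in> TE X" "M \<subseteq> carrier G" "X \<subseteq> edges"
      "\<And>h e. h \<in> M \<Longrightarrow> e \<in> X \<Longrightarrow> h <# e \<in> X" for h e M X
    proof -
      from that(1,2) obtain h1 e1
        where 1: "h1 \<in> M" "h = inv x \<otimes> h1 \<otimes> x" "e1 \<in> X" "e = inv x <# e1"
        unfolding T_def TE_def by blast
      hence "h <# e = inv x <# (h1 <# e1)" using tr[of h1 e1] that(3,4) by blast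
      thus ?thesis using that(5)[OF 1(1,3)] unfolding TE_def by blast
    qed
    have TE_cof: "\<exists>h\<in>T M. \<exists>y\<in>TE Y. e = h <# y" if "e \<in> TE X" "M \<subseteq> carrier G" "Y \<subseteq> edges"
      "\<And>e. e \<in> X \<Longrightarrow> \<exists>h\<in>M. \<exists>y\<in>Y. e = h <# y" for e M X Y
    proof -
      from that(1) obtain e1 where e1: "e1 \<in> X" "e = inv x <# e1" unfolding TE_def by blast
      from that(4)[OF e1(1)] obtain h1 y1 where 1: "h1 \<in> M" "y1 \<in> Y" "e1 = h1 <# y1" by blast
      have "e = (inv x \<otimes> h1 \<otimes> x) <# (inv x <# y1)" unfolding e1(2) 1(3) using tr[of h1 y1] 1 that(2,3) by auto
      thus ?thesis using 1 unfolding T_def TE_def by blast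
    qed
    note HsubG = subgroup.subset[OF H] subgroup.subset[OF K]
    have "\<exists>Z. finite Z \<and> Z \<subseteq> edges \<and> (\<forall>e\<in>{e \<in> (\<lambda>h. h <# E) ` T H \<inter> (\<lambda>k. k <# E) ` T K.
        \<not> good (T H \<inter> T K) (TE (orbit_hull H) \<inter> TE (orbit_hull K)) e}. \<exists>l\<in>T H \<inter> T K. \<exists>z\<in>Z. e = l <# z)"
    proof (rule bad_edges_at_base[OF fcip pair sfgip E_fgip VA_fgip T_fg[OF fgH] T_fg[OF fgK],
          where YH = "TE YH" and YK = "TE YK"])
      show "TE (orbit_hull H) \<subseteq> edges" "TE (orbit_hull K) \<subseteq> edges" "TE YH \<subseteq> edges" "TE YK \<subseteq> edges"
        by (rule TE_edges[OF orbit_hull_edges[OF H]] TE_edges[OF orbit_hull_edges[OF K]]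
            TE_edges[OF YH(2)] TE_edges[OF YK(2)])+
      show "finite (TE YH)" "finite (TE YK)" unfolding TE_def using YH(1) YK(1) by auto
      show "h <# e \<in> TE (orbit_hull H)" if "h \<in> T H" "e \<in> TE (orbit_hull H)" for h e
        by (rule TE_act[OF that HsubG(1) orbit_hull_edges[OF H] orbit_hull_act[OF H]])
      show "h <# e \<in> TE (orbit_hull K)" if "h \<in> T K" "e \<in> TE (orbit_hull K)" for h e
        by (rule TE_act[OF that HsubG(2) orbit_hull_edges[OF K] orbit_hull_act[OF K]])
      show "\<exists>h\<in>T H. \<exists>y\<in>TE YH. e = h <# y" if "e \<in> TE (orbit_hull H)" for e
        by (rule TE_cof[OF that HsubG(1) YH(2,3)])
      show "\<exists>h\<in>T K. \<exists>y\<in>TE YK. e = h <# y" if "e \<in> TE (orbit_hull K)" for e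
        by (rule TE_cof[OF that HsubG(2) YK(2,3)])
    qed
    then obtain Z where Z: "finite Z" "Z \<subseteq> edges" and Zb0: "\<forall>e\<in>{e \<in> (\<lambda>h. h <# E) ` T H \<inter> (\<lambda>k. k <# E) ` T K.
        \<not> good (T H \<inter> T K) (TE (orbit_hull H) \<inter> TE (orbit_hull K)) e}. \<exists>l\<in>T H \<inter> T K. \<exists>z\<in>Z. e = l <# z"
      by (elim exE conjE)
    have Zb: "\<exists>l\<in>T H \<inter> T K. \<exists>z\<in>Z. e = l <# z" if "\<exists>h\<in>T H. e = h <# E" "\<exists>k\<in>T K. e = k <# E"
      "\<not> good (T H \<inter> T K) (TE (orbit_hull H) \<inter> TE (orbit_hull K)) e" for e
      by (rule Zb0[rule_format]) (use that in blast)
    have T_int: "\<exists>l\<in>H \<inter> K. l' = inv x \<otimes> l \<otimes> x" if l': "l' \<in> T H \<inter> T K" for l'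
    proof -
      from l' obtain h k where hk: "h \<in> H" "k \<in> K" "l' = inv x \<otimes> h \<otimes> x" "inv x \<otimes> h \<otimes> x = inv x \<otimes> k \<otimes> x"
        unfolding T_def by auto
      have "x \<otimes> (inv x \<otimes> h \<otimes> x) \<otimes> inv x = x \<otimes> (inv x \<otimes> k \<otimes> x) \<otimes> inv x" using hk(4) by simp
      hence "h = k" using HG[OF hk(1)] KG[OF hk(2)] x by (simp add: m_assoc cancel_left)
      thus ?thesis using hk by blast
    qed
    show ?thesis
    proof (intro exI[of _ "(\<lambda>z. x <# z) ` Z"] conjI ballI impI)
      show "finite ((\<lambda>z. x <# z) ` Z)" using Z by simp
      show "(\<lambda>z. x <# z) ` Z \<subseteq> edges" using Z edge_act[OF x(1)] by blast
      fix e assume e: "e \<in> bad" and eH: "e \<in> (\<lambda>h. h <# y) ` H" and eK: "e \<in> (\<lambda>k. k <# y') ` K"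
      have e_hull: "e \<in> orbit_hull (H \<inter> K)" and not_good: "\<not> good (H \<inter> K) (orbit_hull (H \<inter> K)) e"
        using e unfolding bad_def by auto
      have e_edge: "e \<in> edges" using e_hull hull_sub orbit_hull_edges[OF H] by blast
      have "\<not> good (T H \<inter> T K) (TE (orbit_hull H) \<inter> TE (orbit_hull K)) (inv x <# e)"
      proof
        assume g: "good (T H \<inter> T K) (TE (orbit_hull H) \<inter> TE (orbit_hull K)) (inv x <# e)"
        have "l = \<one>" if l: "l \<in> H \<inter> K" "l <# src e = src e" for l
        proof -
          have lG: "l \<in> carrier G" using l HG by blast
          have "(inv x \<otimes> l \<otimes> x) <# src (inv x <# e) = src ((inv x \<otimes> l \<otimes> x) <# (inv x <# e))"
            using lG x e_edge edge_act[OF ix e_edge] by (intro src_act[symmetric]) auto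
          also have "\<dots> = inv x <# src (l <# e)"
            unfolding tr[OF lG e_edge] using edge_act[OF lG e_edge] by (rule src_act[OF ix])
          also have "\<dots> = src (inv x <# e)" using l(2) src_act[OF lG e_edge] src_act[OF ix e_edge] by simp
          finally have "(inv x \<otimes> l \<otimes> x) <# src (inv x <# e) = src (inv x <# e)" .
          moreover have "inv x \<otimes> l \<otimes> x \<in> T H \<inter> T K" using l(1) unfolding T_def by blast
          ultimately have "inv x \<otimes> l \<otimes> x = \<one>" using g unfolding good_def by blast
          hence "x \<otimes> (inv x \<otimes> l \<otimes> x) \<otimes> inv x = \<one>" using x by simp
          thus "l = \<one>" using x lG by (simp add: m_assoc cancel_left)
        qed
        moreover have "e' = e" if e': "e' \<in> orbit_hull (H \<inter> K)" "src e' = src e" for e'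
        proof -
          have e'_edge: "e' \<in> edges" using e'(1) hull_sub orbit_hull_edges[OF H] by blast
          have "inv x <# e' \<in> TE (orbit_hull H) \<inter> TE (orbit_hull K)" using e'(1) hull_sub unfolding TE_def by blast
          moreover have "src (inv x <# e') = src (inv x <# e)"
            using src_act[OF ix e'_edge] src_act[OF ix e_edge] e'(2) by simp
          ultimately have "inv x <# e' = inv x <# e" using g unfolding good_def by blast
          thus "e' = e" using lcoset_cancel(2)[OF lcoset_carrier[OF e'_edge] x(1)]
              lcoset_cancel(2)[OF lcoset_carrier[OF e_edge] x(1)] by metis
        qed
        ultimately show False using not_good unfolding good_def by blast
      qed
      moreover have "\<exists>h'\<in>T H. inv x <# e = h' <# E" by (rule orb[OF H h0 eH yE(1) x(2)])
      moreover have "\<exists>k'\<in>T K. inv x <# e = k' <# E" by (rule orb[OF K k0 eK yE(2)]) (use x(2) eq0 in simp)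
      ultimately have "\<exists>l'\<in>T H \<inter> T K. \<exists>z\<in>Z. inv x <# e = l' <# z" by (intro Zb)
      then obtain l' z where lz: "l' \<in> T H \<inter> T K" "z \<in> Z" "inv x <# e = l' <# z" by (elim bexE)
      obtain l where l: "l \<in> H \<inter> K" "l' = inv x \<otimes> l \<otimes> x" using T_int[OF lz(1)] by blast
      have lG: "l \<in> carrier G" using l HG by blast
      have zG: "z \<subseteq> carrier G" using lz(2) Z(2) lcoset_carrier by blast
      have "e = x <# (inv x <# e)" using lcoset_cancel(2)[OF lcoset_carrier[OF e_edge] x(1)] by simp
      also have "\<dots> = l <# (x <# z)"
        unfolding lz(3) l(2) using x lG zG by (simp add: lcoset_mult m_assoc cancel_left)
      finally show "\<exists>l\<in>H \<inter> K. \<exists>z\<in>(\<lambda>z. x <# z) ` Z. e = l <# z" using l(1) lz(2) by blast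
    qed
  qed
  have "\<forall>p\<in>YH \<times> YK. \<exists>Z. finite Z \<and> Z \<subseteq> edges \<and> (\<forall>e\<in>bad. e \<in> (\<lambda>h. h <# fst p) ` H \<longrightarrow>
      e \<in> (\<lambda>k. k <# snd p) ` K \<longrightarrow> (\<exists>l\<in>H \<inter> K. \<exists>z\<in>Z. e = l <# z))"
    using pairwise by auto
  then obtain Z where Z: "\<forall>p\<in>YH \<times> YK. finite (Z p) \<and> Z p \<subseteq> edges \<and> (\<forall>e\<in>bad. e \<in> (\<lambda>h. h <# fst p) ` H \<longrightarrow>
      e \<in> (\<lambda>k. k <# snd p) ` K \<longrightarrow> (\<exists>l\<in>H \<inter> K. \<exists>z\<in>Z p. e = l <# z))"
    unfolding bchoice_iff by (elim exE)
  show ?thesis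
  proof (intro exI[of _ "\<Union>p\<in>YH \<times> YK. Z p"] conjI ballI impI)
    show "finite (\<Union>p\<in>YH \<times> YK. Z p)" using Z YH(1) YK(1) by blast
    show "(\<Union>p\<in>YH \<times> YK. Z p) \<subseteq> edges" using Z by blast
    fix e assume e: "e \<in> orbit_hull (H \<inter> K)" "\<not> good (H \<inter> K) (orbit_hull (H \<inter> K)) e"
    obtain h y where hy: "h \<in> H" "y \<in> YH" "e = h <# y" using YH(3)[of e] e(1) hull_sub by blast
    obtain k y' where ky: "k \<in> K" "y' \<in> YK" "e = k <# y'" using YK(3)[of e] e(1) hull_sub by blast
    have p: "(y, y') \<in> YH \<times> YK" using hy ky by blast
    have "e \<in> bad" using e by (simp add: bad_def)
    moreover have "e \<in> (\<lambda>h. h <# fst (y, y')) ` H" "e \<in> (\<lambda>k. k <# snd (y, y')) ` K" using hy ky by auto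
    ultimately have "\<exists>l\<in>H \<inter> K. \<exists>z\<in>Z (y, y'). e = l <# z" using Z[rule_format, OF p] by blast
    thus "\<exists>l\<in>H \<inter> K. \<exists>z\<in>\<Union>p\<in>YH \<times> YK. Z p. e = l <# z" using p by blast
  qed
qed

lemma good_free: "good L EL e \<Longrightarrow> l \<in> L \<Longrightarrow> l <# src e = src e \<Longrightarrow> l = \<one>"
  and good_unique: "good L EL e \<Longrightarrow> e' \<in> EL \<Longrightarrow> src e' = src e \<Longrightarrow> e' = e"
  by (simp_all add: good_def)

section \<open>Finite generation of intersections\<close>

lemma vertex_group_fg:
  assumes A_fgip: "fgip A" and VA_fgip: "fgip_rel G VA"
    and fgH: "fg_subgroup H G" and fgK: "fg_subgroup K G"
  shows "fg_subgroup (H \<inter> K \<inter> VA) G"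
proof -
  have "fg_subgroup (base_part H \<inter> base_part K) A"
    using A_fgip base_part_fg[OF VA_fgip] fgH fgK unfolding fgip_def by blast
  hence "fg_subgroup (i ` (base_part H \<inter> base_part K)) G"
    by (rule fg_subgroup_hom_image[OF is_group A i_hom])
  moreover have "i ` (base_part H \<inter> base_part K) = H \<inter> K \<inter> VA" unfolding base_part_def by blast
  ultimately show ?thesis by simp
qed

text \<open>
  The flow sends the source of a good edge to its target and fixes all other vertices. A set of
  vertices compatible with the flow and with the bad edges is not cut by any edge of the subtree of
  \<open>H \<inter> K\<close>, so by \<open>odd_card_separates_iff\<close> it contains the whole orbit of the base vertex.
\<close>

theorem fgip_if_fgip_rel:
  assumes fcip: "fcip_rel A C" and pair: "pair_fgip A C" and sfgip: "sfgip (A\<lparr>carrier := C\<rparr>)"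
    and E_fgip: "fgip_rel G E"
  shows "fgip G"
  unfolding fgip_def
proof (intro allI impI)
  fix H K assume fgH: "fg_subgroup H G" and fgK: "fg_subgroup K G"
  have VA_fgip: "fgip_rel G VA" by (rule fgip_rel_base[OF E_fgip])
  have A_fgip: "fgip A" using pair by (simp add: pair_fgip_def)
  define L where "L = H \<inter> K"
  have L: "subgroup L G"
    unfolding L_def using fgH fgK by (intro subgroups_Inter_pair fg_subgroupD)
  have LG: "l \<in> carrier G" if "l \<in> L" for l using that subgroup.mem_carrier[OF L] by blast
  obtain Z where Z: "finite Z" "Z \<subseteq> edges" and bad0: "\<forall>e\<in>orbit_hull L.
      \<not> good L (orbit_hull L) e \<longrightarrow> (\<exists>l\<in>L. \<exists>z\<in>Z. e = l <# z)"
    using bad_edges[OF fcip pair sfgip E_fgip fgH fgK] unfolding L_def by (elim exE conjE)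
  have bad: "\<exists>l\<in>L. \<exists>z\<in>Z. e = l <# z" if "e \<in> orbit_hull L" "\<not> good L (orbit_hull L) e" for e
    using bad0 that by simp
  have hull_E: "e \<in> edges" if "e \<in> orbit_hull L" for e using that orbit_hull_edges[OF L] by blast
  define V where "V = {x <# VA | x. x \<in> carrier G}"
  have VG: "v \<subseteq> carrier G" if "v \<in> V" for v
    using that l_coset_subset_G[OF VA_carrier] unfolding V_def by auto
  have V_act: "l <# v \<in> V" if "l \<in> carrier G" "v \<in> V" for l v
  proof -
    from that(2) obtain x where "x \<in> carrier G" "v = x <# VA" unfolding V_def by blast
    thus ?thesis using lcoset_mult[OF VA_carrier that(1), of x] m_closed[OF that(1), of x]
      unfolding V_def by blast
  qed
  have src_V: "src e \<in> V" and tgt_V: "tgt e \<in> V" if "e \<in> edges" for e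
    using src_vertex[OF that] tgt_vertex[OF that] unfolding V_def by auto
  define out where "out = (\<lambda>v e. e \<in> orbit_hull L \<and> src e = v \<and> good L (orbit_hull L) e)"
  define F where "F = (\<lambda>v. if \<exists>e. out v e then tgt (SOME e. out v e) else v)"
  have out_unique: "e = e'" if "out v e" "out v e'" for v e e'
  proof -
    from that have "e \<in> orbit_hull L" "src e = src e'" "good L (orbit_hull L) e'"
      by (simp_all add: out_def)
    thus ?thesis using good_unique by blast
  qed
  have F_out: "F v = tgt e" if "out v e" for v e
  proof -
    have "out v (SOME e. out v e)" using someI[of "out v" e] that by simp
    hence "(SOME e. out v e) = e" using that by (rule out_unique)
    moreover have "\<exists>e. out v e" using that by (rule exI)
    ultimately show ?thesis unfolding F_def by simp
  qed
  have F_none: "F v = v" if "\<nexists>e. out v e" for v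
    unfolding F_def using that by (rule if_not_P)
  have out_act: "out (l <# v) (l <# e)" if l: "l \<in> L" and o: "out v e" for l v e
  proof -
    have e: "e \<in> orbit_hull L" "src e = v" and g: "good L (orbit_hull L) e" using o unfolding out_def by auto
    have g1: "m = \<one>" if "m \<in> L" "m <# src e = src e" for m
      by (rule good_free[OF g that])
    have g2: "e' = e" if "e' \<in> orbit_hull L" "src e' = src e" for e'
      by (rule good_unique[OF g that])
    have eE: "e \<in> edges" by (rule hull_E[OF e(1)])
    have le: "l <# e \<in> orbit_hull L" by (rule orbit_hull_act[OF L l e(1)])
    have lG: "l \<in> carrier G" using l LG by blast
    have sle: "src (l <# e) = l <# v" using src_act[OF lG eE] e by simp
    have vG: "v \<subseteq> carrier G" using e(2) src_V[OF eE] VG by blast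
    have "m = \<one>" if m: "m \<in> L" "m <# src (l <# e) = src (l <# e)" for m
    proof -
      have mG: "m \<in> carrier G" using m LG by blast
      have "(inv l \<otimes> m \<otimes> l) <# src e = inv l <# (m <# (l <# v))"
        using e(2) lG mG vG by (simp add: lcoset_mult m_assoc)
      also have "\<dots> = src e" using m(2) sle e(2) lcoset_cancel(1)[OF vG lG] by simp
      finally have "(inv l \<otimes> m \<otimes> l) <# src e = src e" .
      moreover have "inv l \<otimes> m \<otimes> l \<in> L"
        using m(1) l by (intro subgroup.m_closed[OF L] subgroup.m_inv_closed[OF L])
      ultimately have "inv l \<otimes> m \<otimes> l = \<one>" by (rule g1[rotated])
      hence "l \<otimes> (inv l \<otimes> m \<otimes> l) \<otimes> inv l = \<one>" using lG by simp
      thus "m = \<one>" using lG mG by (simp add: m_assoc cancel_left)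
    qed
    moreover have "e' = l <# e" if e': "e' \<in> orbit_hull L" "src e' = src (l <# e)" for e'
    proof -
      have e'E: "e' \<in> edges" using e' hull_E by blast
      have il: "inv l \<in> L" using l subgroup.m_inv_closed[OF L] by blast
      have "src (inv l <# e') = src e"
        using src_act[OF LG[OF il] e'E] e'(2) sle lcoset_cancel(1)[OF vG lG] e(2) by simp
      hence "inv l <# e' = e" by (rule g2[OF orbit_hull_act[OF L il e'(1)]])
      thus "e' = l <# e" using lcoset_cancel(2)[OF lcoset_carrier[OF e'E] lG] by simp
    qed
    ultimately have "good L (orbit_hull L) (l <# e)" unfolding good_def by blast
    thus ?thesis using le sle unfolding out_def by blast
  qed
  have "fg_subgroup L G"
  proof (rule fg_subgroup_if_flow[where V = V and act = "\<lambda>l (v :: 'g set). l <# v" and F = F and base = VA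
        and Bd = "(\<lambda>z. (src z, tgt z)) ` Z"])
    show "subgroup L G" by (rule L)
    show "l <# v \<in> V" if "l \<in> L" "v \<in> V" for l v using V_act[OF LG[OF that(1)] that(2)] .
    show "\<one> <# v = v" if "v \<in> V" for v using VG[OF that] by (rule lcos_mult_one)
    show "(l \<otimes> m) <# v = l <# (m <# v)" if "l \<in> L" "m \<in> L" "v \<in> V" for l m v
      using lcoset_mult[OF VG[OF that(3)] LG[OF that(1)] LG[OF that(2)]] by simp
    show "F v \<in> V" if "v \<in> V" for v
    proof (cases "\<exists>e. out v e")
      case True
      then obtain e where e: "out v e" by blast
      hence "e \<in> edges" using hull_E unfolding out_def by simp
      thus ?thesis unfolding F_out[OF e] by (rule tgt_V)
    next
      case False
      thus ?thesis using F_none that by simp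
    qed
    show "F (l <# v) = l <# F v" if l: "l \<in> L" and v: "v \<in> V" for l v
    proof (cases "\<exists>e. out v e")
      case True
      then obtain e where e: "out v e" by blast
      hence "e \<in> edges" using hull_E unfolding out_def by simp
      thus ?thesis using F_out[OF e] F_out[OF out_act[OF l e]] tgt_act[OF LG[OF l]] by simp
    next
      case False
      have "\<nexists>e. out (l <# v) e"
      proof
        assume "\<exists>e. out (l <# v) e"
        then obtain e where "out (l <# v) e" by blast
        hence "out (inv l <# (l <# v)) (inv l <# e)"
          using out_act subgroup.m_inv_closed[OF L l] by blast
        thus False using False lcoset_cancel(1)[OF VG[OF v] LG[OF l]] by auto
      qed
      thus ?thesis using F_none False by metis
    qed
    show "l = \<one>" if "v \<in> V" "F v \<noteq> v" "l \<in> L" "l <# v = v" for v l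
    proof -
      obtain e where "out v e" using F_none[of v] \<open>F v \<noteq> v\<close> by blast
      hence "src e = v" "good L (orbit_hull L) e" by (simp_all add: out_def)
      thus ?thesis using good_free[of L _ e l] that(3,4) by blast
    qed
    show "fg_subgroup {l \<in> L. l <# v = v} G" if v: "v \<in> V" for v
    proof -
      obtain x where x: "x \<in> carrier G" "v = x <# VA" using v unfolding V_def by blast
      have "(\<lambda>h. inv x \<otimes> h \<otimes> x) ` (H \<inter> K) = (\<lambda>h. inv x \<otimes> h \<otimes> x) ` H \<inter> (\<lambda>h. inv x \<otimes> h \<otimes> x) ` K"
      proof (rule inj_on_image_Int[where C = "carrier G"])
        show "inj_on (\<lambda>h. inv x \<otimes> h \<otimes> x) (carrier G)"
          by (rule inj_on_inverseI[where g = "\<lambda>h. x \<otimes> h \<otimes> inv x"]) (use x in \<open>simp add: m_assoc cancel_left\<close>)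
      qed (use fgH fgK in \<open>auto dest: fg_subgroupD subgroup.mem_carrier\<close>)
      hence "fg_subgroup ((\<lambda>h. inv x \<otimes> h \<otimes> x) ` L \<inter> VA) G"
        using vertex_group_fg[OF A_fgip VA_fgip fg_subgroup_conj_inv[OF fgH x(1)] fg_subgroup_conj_inv[OF fgK x(1)]]
        by (simp add: L_def)
      thus ?thesis unfolding x(2)
        by (intro fg_subgroup_lcoset_stabilizer[OF VA_subgroup subgroup.subset[OF L] x(1)])
    qed
    show "finite ((\<lambda>z. (src z, tgt z)) ` Z)" using Z(1) by simp
    show "(\<lambda>z. (src z, tgt z)) ` Z \<subseteq> V \<times> V" using Z(2) src_V tgt_V by (auto simp del: mem_Collect_eq)
    have "VA = \<one> <# VA" using lcos_mult_one[OF VA_carrier] by simp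
    thus "VA \<in> V" unfolding V_def by blast
    fix W l assume W: "W \<subseteq> V" "VA \<in> W" and WF: "\<And>v. v \<in> V \<Longrightarrow> v \<in> W \<longleftrightarrow> F v \<in> W"
      and WZ: "\<And>m u w. m \<in> L \<Longrightarrow> (u, w) \<in> (\<lambda>z. (src z, tgt z)) ` Z \<Longrightarrow> m <# u \<in> W \<longleftrightarrow> m <# w \<in> W"
      and l: "l \<in> L"
    have "\<not> separates W e" if "e \<in> d l" for e
    proof -
      have e: "e \<in> orbit_hull L" using that l unfolding orbit_hull_def by blast
      have "src e \<in> W \<longleftrightarrow> tgt e \<in> W"
      proof (cases "good L (orbit_hull L) e")
        case True
        hence "out (src e) e" using e unfolding out_def by blast
        hence "F (src e) = tgt e" by (rule F_out)
        thus ?thesis using WF[OF src_V[OF hull_E[OF e]]] by simp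
      next
        case False
        then obtain m z where mz: "m \<in> L" "z \<in> Z" "e = m <# z" using bad[OF e] by blast
        have zE: "z \<in> edges" using mz(2) Z(2) by blast
        have "src e = m <# src z" "tgt e = m <# tgt z"
          unfolding mz(3) using src_act[OF LG[OF mz(1)] zE] tgt_act[OF LG[OF mz(1)] zE] by auto
        moreover have "(src z, tgt z) \<in> (\<lambda>z. (src z, tgt z)) ` Z" using mz(2) by blast
        ultimately show ?thesis using WZ[OF mz(1), of "src z" "tgt z"] by simp
      qed
      thus ?thesis by (simp add: separates_def)
    qed
    hence "{e \<in> d l. separates W e} = {}" by blast
    hence "card {e \<in> d l. separates W e} = 0" by (simp only: card.empty)
    thus "l <# VA \<in> W" using odd_card_separates_iff[OF LG[OF l], of W] W(2) by simp
  qed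
  thus "fg_subgroup (H \<inter> K) G" by (simp add: L_def)
qed

end

section \<open>The base group embeds\<close>

lemma (in group) right_transversal:
  assumes S: "subgroup S G"
  shows "\<exists>r. (\<forall>a\<in>carrier G. r a \<in> carrier G \<and> a \<otimes> inv (r a) \<in> S) \<and>
    (\<forall>s\<in>S. \<forall>a\<in>carrier G. r (s \<otimes> a) = r a)"
proof -
  define r where "r = (\<lambda>a. SOME x. x \<in> S #> a)"
  have r: "r a \<in> S #> a" if "a \<in> carrier G" for a
    unfolding r_def using rcos_self[OF that S] by (rule someI)
  have "r a \<in> carrier G" if "a \<in> carrier G" for a
    using r[OF that] r_coset_subset_G[OF subgroup.subset[OF S] that] by blast
  moreover have "a \<otimes> inv (r a) \<in> S" if a: "a \<in> carrier G" for a
  proof -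
    obtain s where s: "s \<in> S" "r a = s \<otimes> a" using r[OF a] unfolding r_coset_def by blast
    have "s \<in> carrier G" using s(1) subgroup.mem_carrier[OF S] by blast
    hence "a \<otimes> inv (r a) = inv s" unfolding s(2) using a by (simp add: inv_mult_group cancel_left)
    thus ?thesis using s(1) subgroup.m_inv_closed[OF S] by simp
  qed
  moreover have "r (s \<otimes> a) = r a" if s: "s \<in> S" and a: "a \<in> carrier G" for s a
  proof -
    have "S #> (s \<otimes> a) = (S #> s) #> a"
      using coset_mult_assoc[OF subgroup.subset[OF S] _ a] subgroup.mem_carrier[OF S s] by simp
    also have "S #> s = S" using coset_join2[OF _ S s] subgroup.mem_carrier[OF S s] by blast
    finally show ?thesis by (simp add: r_def)
  qed
  ultimately show ?thesis by blast
qed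

text \<open>
  A factor of lists absorbs one more factor on either side.
\<close>

lemma bij_betw_absorb_lists:
  fixes X Y :: "'a set"
  assumes "x0 \<in> X" "y0 \<in> Y"
  shows "\<exists>\<beta>. bij_betw \<beta> (X \<times> (UNIV :: 'a list set)) (Y \<times> (UNIV :: 'a list set))"
proof (rule Schroeder_Bernstein)
  show "inj_on (\<lambda>(x, l). (y0, x # l)) (X \<times> (UNIV :: 'a list set))"
    "inj_on (\<lambda>(y, l). (x0, y # l)) (Y \<times> (UNIV :: 'a list set))" by (auto simp: inj_on_def)
qed (use assms in auto)

locale hnn_iso = group A for A :: "('a, 'b) monoid_scheme" (structure) +
  fixes C :: "'a set" and \<phi> :: "'a \<Rightarrow> 'a"
  assumes C: "subgroup C A" and \<phi>C: "subgroup (\<phi> ` C) A"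
    and \<phi>: "\<phi> \<in> iso (A\<lparr>carrier := C\<rparr>) (A\<lparr>carrier := \<phi> ` C\<rparr>)"
begin

lemma \<phi>_inj: "inj_on \<phi> C"
  using \<phi> by (auto simp: iso_def bij_betw_def)

lemma \<phi>_mult: "c \<in> C \<Longrightarrow> c' \<in> C \<Longrightarrow> \<phi> (c \<otimes> c') = \<phi> c \<otimes> \<phi> c'"
  using \<phi> by (auto simp: iso_def hom_def)

lemma C_in: "c \<in> C \<Longrightarrow> c \<in> carrier A" and \<phi>_in: "c \<in> C \<Longrightarrow> \<phi> c \<in> carrier A"
  using subgroup.mem_carrier[OF C] subgroup.mem_carrier[OF \<phi>C] by auto

sublocale hnn_data A C \<phi>
  by unfold_locales (use C_in \<phi>_in in auto)

text \<open>
  Left multiplication makes \<open>A\<close> a free \<open>C\<close>-set in two ways, through the inclusion and through \<open>\<phi>\<close>. Free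
  \<open>C\<close>-sets are isomorphic when they have equally many orbits, which the factor of lists enforces.
\<close>

lemma intertwiner:
  fixes \<Omega> :: "('a \<times> 'a list) set"
  defines "\<Omega> \<equiv> carrier A \<times> UNIV"
  shows "\<exists>\<tau>. bij_betw \<tau> \<Omega> \<Omega> \<and>
    (\<forall>c\<in>C. \<forall>a\<in>carrier A. \<forall>l. \<tau> (\<phi> c \<otimes> a, l) = (c \<otimes> fst (\<tau> (a, l)), snd (\<tau> (a, l))))"
proof -
  obtain r1 where r1': "(\<forall>a\<in>carrier A. r1 a \<in> carrier A \<and> a \<otimes> inv (r1 a) \<in> C) \<and>
      (\<forall>s\<in>C. \<forall>a\<in>carrier A. r1 (s \<otimes> a) = r1 a)"
    using right_transversal[OF C] by (elim exE)
  have r1: "a \<in> carrier A \<Longrightarrow> r1 a \<in> carrier A" "a \<in> carrier A \<Longrightarrow> a \<otimes> inv (r1 a) \<in> C"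
    "s \<in> C \<Longrightarrow> a \<in> carrier A \<Longrightarrow> r1 (s \<otimes> a) = r1 a" for a s
    using r1' by simp_all
  obtain r2 where r2': "(\<forall>a\<in>carrier A. r2 a \<in> carrier A \<and> a \<otimes> inv (r2 a) \<in> \<phi> ` C) \<and>
      (\<forall>s\<in>\<phi> ` C. \<forall>a\<in>carrier A. r2 (s \<otimes> a) = r2 a)"
    using right_transversal[OF \<phi>C] by (elim exE)
  have r2: "a \<in> carrier A \<Longrightarrow> r2 a \<in> carrier A" "a \<in> carrier A \<Longrightarrow> a \<otimes> inv (r2 a) \<in> \<phi> ` C"
    "s \<in> \<phi> ` C \<Longrightarrow> a \<in> carrier A \<Longrightarrow> r2 (s \<otimes> a) = r2 a" for a s
    using r2' by (simp_all del: ball_simps)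
  have idem1: "r1 (r1 a) = r1 a" if a: "a \<in> carrier A" for a
  proof -
    have "a \<otimes> inv (r1 a) \<otimes> r1 a = a" using a r1(1)[OF a] by (simp add: m_assoc)
    thus ?thesis using r1(3)[OF r1(2)[OF a] r1(1)[OF a]] by simp
  qed
  have idem2: "r2 (r2 a) = r2 a" if a: "a \<in> carrier A" for a
  proof -
    have "a \<otimes> inv (r2 a) \<otimes> r2 a = a" using a r2(1)[OF a] by (simp add: m_assoc)
    thus ?thesis using r2(3)[OF r2(2)[OF a] r2(1)[OF a]] by simp
  qed
  \<comment> \<open>Orbits are represented by \<open>R1\<close> and \<open>R2\<close>; \<open>\<beta>\<close> matches them, and \<open>k a\<close> is the position of \<open>a\<close> in its orbit.\<close>
  define R1 where "R1 = r1 ` carrier A"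
  define R2 where "R2 = r2 ` carrier A"
  have ne: "r2 \<one> \<in> R2" "r1 \<one> \<in> R1" unfolding R1_def R2_def by auto
  obtain \<beta> where \<beta>: "bij_betw \<beta> (R2 \<times> (UNIV :: 'a list set)) (R1 \<times> (UNIV :: 'a list set))"
    using bij_betw_absorb_lists[OF ne] by (elim exE)
  have \<beta>_in: "fst (\<beta> (r2 a, l)) \<in> R1" if "a \<in> carrier A" for a l
  proof -
    have "\<beta> (r2 a, l) \<in> R1 \<times> UNIV" using bij_betwE[OF \<beta>] that unfolding R2_def by blast
    thus ?thesis by auto
  qed
  have R1: "x \<in> carrier A" "r1 x = x" if "x \<in> R1" for x
    using that r1(1) idem1 unfolding R1_def by auto
  define \<psi> where "\<psi> = inv_into C \<phi>"
  have \<psi>: "\<psi> (\<phi> c) = c" if "c \<in> C" for c unfolding \<psi>_def by (rule inv_into_f_f[OF \<phi>_inj that])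
  define k where "k = (\<lambda>a. \<psi> (a \<otimes> inv (r2 a)))"
  have k: "k a \<in> C" "\<phi> (k a) = a \<otimes> inv (r2 a)" if "a \<in> carrier A" for a
  proof -
    from r2(2)[OF that] obtain c where c: "c \<in> C" "a \<otimes> inv (r2 a) = \<phi> c" by blast
    show "k a \<in> C" "\<phi> (k a) = a \<otimes> inv (r2 a)" unfolding k_def c(2) using \<psi>[OF c(1)] c(1) by auto
  qed
  have k_mult: "k (\<phi> c \<otimes> a) = c \<otimes> k a" if c: "c \<in> C" and a: "a \<in> carrier A" for c a
  proof -
    have "\<phi> c \<otimes> a \<otimes> inv (r2 (\<phi> c \<otimes> a)) = \<phi> (c \<otimes> k a)"
      using r2(3)[of "\<phi> c" a] c a k[OF a] \<phi>_in r2(1)[OF a] by (simp add: \<phi>_mult m_assoc)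
    thus ?thesis unfolding k_def using \<psi> c k(1)[OF a] subgroup.m_closed[OF C] unfolding k_def by simp
  qed
  define \<tau> where "\<tau> = (\<lambda>(a, l). (k a \<otimes> fst (\<beta> (r2 a, l)), snd (\<beta> (r2 a, l))))"
  have \<tau>: "\<tau> (a, l) = (k a \<otimes> fst (\<beta> (r2 a, l)), snd (\<beta> (r2 a, l)))" for a l by (simp add: \<tau>_def)
  have bij: "bij_betw \<tau> (carrier A \<times> (UNIV :: 'a list set)) (carrier A \<times> UNIV)"
  proof (rule bij_betw_imageI)
    show "inj_on \<tau> (carrier A \<times> (UNIV :: 'a list set))"
    proof (rule inj_onI, clarify)
      fix a l b m assume a: "a \<in> carrier A" and b: "b \<in> carrier A" and eq: "\<tau> (a, l) = \<tau> (b, m)"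
      have "r1 (k a \<otimes> fst (\<beta> (r2 a, l))) = r1 (k b \<otimes> fst (\<beta> (r2 b, m)))" using eq by (simp add: \<tau>)
      hence 1: "fst (\<beta> (r2 a, l)) = fst (\<beta> (r2 b, m))"
        using r1(3) k(1) a b R1[OF \<beta>_in[OF a]] R1[OF \<beta>_in[OF b]] by simp
      moreover have "snd (\<beta> (r2 a, l)) = snd (\<beta> (r2 b, m))" using eq by (simp add: \<tau>)
      ultimately have "\<beta> (r2 a, l) = \<beta> (r2 b, m)" by (rule prod_eqI)
      hence 2: "(r2 a, l) = (r2 b, m)"
        using bij_betw_imp_inj_on[OF \<beta>] a b unfolding R2_def by (auto dest: inj_onD)
      have "k a = k b"
        using eq 1 R1[OF \<beta>_in[OF a]] R1[OF \<beta>_in[OF b]] k(1) a b C_in by (simp add: \<tau>)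
      hence "a \<otimes> inv (r2 a) = b \<otimes> inv (r2 a)" using k(2) a b 2 by (metis prod.inject)
      hence "a = b" using a b r2(1) by simp
      thus "a = b \<and> l = m" using 2 by simp
    qed
    show "\<tau> ` (carrier A \<times> (UNIV :: 'a list set)) = carrier A \<times> UNIV"
    proof (intro equalityI subsetI)
      fix y assume "y \<in> \<tau> ` (carrier A \<times> (UNIV :: 'a list set))"
      thus "y \<in> carrier A \<times> UNIV" using k(1) C_in R1(1)[OF \<beta>_in] by (auto simp: \<tau>)
    next
      fix y :: "'a \<times> 'a list" assume "y \<in> carrier A \<times> UNIV"
      then obtain b m where y: "y = (b, m)" and b: "b \<in> carrier A" by auto
      have "(r1 b, m) \<in> R1 \<times> UNIV" using b unfolding R1_def by blast
      hence "(r1 b, m) \<in> \<beta> ` (R2 \<times> UNIV)" using bij_betw_imp_surj_on[OF \<beta>] by simp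
      then obtain \<rho> l where \<rho>: "\<rho> \<in> R2" "(r1 b, m) = \<beta> (\<rho>, l)" by auto
      have \<rho>A: "\<rho> \<in> carrier A" and \<rho>r: "r2 \<rho> = \<rho>" using \<rho>(1) r2(1) idem2 unfolding R2_def by auto
      define c where "c = b \<otimes> inv (r1 b)"
      have c: "c \<in> C" unfolding c_def by (rule r1(2)[OF b])
      define a where "a = \<phi> c \<otimes> \<rho>"
      have a: "a \<in> carrier A" "r2 a = \<rho>"
        unfolding a_def using c \<rho>A \<rho>r \<phi>_in r2(3)[of "\<phi> c" \<rho>] by auto
      have "k a = c" unfolding k_def a(2) using \<psi>[OF c] \<rho>A \<phi>_in[OF c] by (simp add: a_def m_assoc)
      hence "\<tau> (a, l) = (c \<otimes> r1 b, m)" using \<rho>(2)[symmetric] by (simp add: \<tau> a(2))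
      also have "c \<otimes> r1 b = b" unfolding c_def using b r1(1)[OF b] by (simp add: m_assoc)
      finally show "y \<in> \<tau> ` (carrier A \<times> UNIV)" unfolding y using a(1) by (metis SigmaI UNIV_I image_eqI)
    qed
  qed
  have eqv: "\<tau> (\<phi> c \<otimes> a, l) = (c \<otimes> fst (\<tau> (a, l)), snd (\<tau> (a, l)))" if "c \<in> C" "a \<in> carrier A" for c a l
    using k_mult[OF that] r2(3)[of "\<phi> c" a] that C_in k(1) R1(1)[OF \<beta>_in] by (simp add: \<tau> m_assoc)
  show ?thesis unfolding \<Omega>_def using bij eqv by (intro exI[of _ \<tau>]) simp
qed

text \<open>
  It suffices that \<open>A\<close> acts faithfully by permutations on a set where some permutation \<open>s\<close> satisfies
  the relations of the stable letter; the intertwiner is such a permutation.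
\<close>

lemma hnn_base_inj: "inj_on (hnn_base A C \<phi>) (carrier A)"
proof -
  define \<Omega> where "\<Omega> = carrier A \<times> (UNIV :: 'a list set)"
  obtain \<tau> where "bij_betw \<tau> \<Omega> \<Omega> \<and> (\<forall>c\<in>C. \<forall>a\<in>carrier A. \<forall>l.
      \<tau> (\<phi> c \<otimes> a, l) = (c \<otimes> fst (\<tau> (a, l)), snd (\<tau> (a, l))))"
    using intertwiner unfolding \<Omega>_def by (elim exE)
  hence bij: "bij_betw \<tau> \<Omega> \<Omega>" and eqv: "\<And>c a l. c \<in> C \<Longrightarrow> a \<in> carrier A \<Longrightarrow>
      \<tau> (\<phi> c \<otimes> a, l) = (c \<otimes> fst (\<tau> (a, l)), snd (\<tau> (a, l)))" by simp_all
  interpret B: group "BijGroup \<Omega>" by (rule group_BijGroup)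
  define lm where "lm = (\<lambda>a. \<lambda>p\<in>\<Omega>. (a \<otimes> fst p, snd p))"
  define s where "s = restrict \<tau> \<Omega>"
  have lm_Bij: "lm a \<in> Bij \<Omega>" if a: "a \<in> carrier A" for a
  proof -
    have "bij_betw (lm a) \<Omega> \<Omega>"
      by (rule bij_betw_byWitness[where f' = "lm (inv a)"])
        (use a in \<open>auto simp: lm_def \<Omega>_def cancel_left\<close>)
    thus ?thesis by (simp add: Bij_def lm_def)
  qed
  have s_Bij: "s \<in> Bij \<Omega>"
    using bij unfolding s_def Bij_def by (simp add: bij_betw_restrict_eq)
  have B_mult: "f \<otimes>\<^bsub>BijGroup \<Omega>\<^esub> g = compose \<Omega> f g" if "f \<in> Bij \<Omega>" "g \<in> Bij \<Omega>" for f g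
    using that by (simp add: BijGroup_def)
  have lm_hom: "lm \<in> hom A (BijGroup \<Omega>)"
  proof (rule homI)
    show "lm a \<in> carrier (BijGroup \<Omega>)" if "a \<in> carrier A" for a
      using lm_Bij[OF that] by (simp add: BijGroup_def)
    show "lm (a \<otimes> b) = lm a \<otimes>\<^bsub>BijGroup \<Omega>\<^esub> lm b" if "a \<in> carrier A" "b \<in> carrier A" for a b
      unfolding B_mult[OF lm_Bij[OF that(1)] lm_Bij[OF that(2)]]
      using that by (auto simp: lm_def \<Omega>_def compose_def fun_eq_iff m_assoc)
  qed
  have rel: "inv\<^bsub>BijGroup \<Omega>\<^esub> s \<otimes>\<^bsub>BijGroup \<Omega>\<^esub> lm c \<otimes>\<^bsub>BijGroup \<Omega>\<^esub> s = lm (\<phi> c)" if c: "c \<in> C" for c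
  proof -
    have sG: "s \<in> carrier (BijGroup \<Omega>)" "lm c \<in> carrier (BijGroup \<Omega>)" "lm (\<phi> c) \<in> carrier (BijGroup \<Omega>)"
      using s_Bij lm_Bij[OF C_in[OF c]] lm_Bij[OF \<phi>_in[OF c]] by (simp_all add: BijGroup_def)
    have \<tau>_in: "\<tau> p \<in> \<Omega>" if "p \<in> \<Omega>" for p using bij_betwE[OF bij] that by blast
    have "lm c \<otimes>\<^bsub>BijGroup \<Omega>\<^esub> s = s \<otimes>\<^bsub>BijGroup \<Omega>\<^esub> lm (\<phi> c)"
      unfolding B_mult[OF lm_Bij[OF C_in[OF c]] s_Bij] B_mult[OF s_Bij lm_Bij[OF \<phi>_in[OF c]]]
      using c eqv \<tau>_in \<phi>_in by (auto simp: compose_def fun_eq_iff lm_def s_def \<Omega>_def)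
    thus ?thesis using sG by (simp add: B.m_assoc B.cancel_left)
  qed
  have "s \<in> carrier (BijGroup \<Omega>)" using s_Bij by (simp add: BijGroup_def)
  then obtain h where h: "\<forall>a\<in>carrier A. h (hnn_base A C \<phi> a) = lm a"
    using hnn_extension_lift[OF B.is_group lm_hom _ rel] by blast
  show ?thesis
  proof (rule inj_onI)
    fix a b assume ab: "a \<in> carrier A" "b \<in> carrier A" and eq: "hnn_base A C \<phi> a = hnn_base A C \<phi> b"
    have "lm a (\<one>, []) = lm b (\<one>, [])" using h ab eq by metis
    thus "a = b" using ab by (simp add: lm_def \<Omega>_def)
  qed
qed

abbreviation "GG \<equiv> hnn_extension A C \<phi>"
abbreviation "tt \<equiv> hnn_class A C \<phi> [Stable]"

text \<open>
  Induction over words. Closure under the inverse of the stable letter is covered by the converse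
  direction of \<open>stable\<close>.
\<close>

lemma hnn_generation:
  assumes g: "g \<in> carrier GG" and one: "R \<one>\<^bsub>GG\<^esub>"
    and base: "\<And>x a. x \<in> carrier GG \<Longrightarrow> a \<in> carrier A \<Longrightarrow> R x \<Longrightarrow> R (x \<otimes>\<^bsub>GG\<^esub> hnn_base A C \<phi> a)"
    and stable: "\<And>x. x \<in> carrier GG \<Longrightarrow> R x \<longleftrightarrow> R (x \<otimes>\<^bsub>GG\<^esub> tt)"
  shows "R g"
proof -
  interpret G: group GG by (rule group_hnn_extension)
  have t: "tt \<in> carrier GG" and t': "hnn_class A C \<phi> [StableInv] \<in> carrier GG"
    by (auto simp: carrier_hnn hnn_words_def)
  have "hnn_class A C \<phi> [StableInv] \<otimes>\<^bsub>GG\<^esub> tt = \<one>\<^bsub>GG\<^esub>"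
    using hnn_cong.inv_stable[of A C \<phi>] by (simp add: mult_hnn one_hnn hnn_words_def hnn_class_eq_iff)
  hence t't: "x \<otimes>\<^bsub>GG\<^esub> hnn_class A C \<phi> [StableInv] \<otimes>\<^bsub>GG\<^esub> tt = x" if "x \<in> carrier GG" for x
    using that t t' by (simp add: G.m_assoc)
  have "u \<in> hnn_words A \<Longrightarrow> R (hnn_class A C \<phi> u)" for u
  proof (induction u rule: rev_induct)
    case Nil
    thus ?case using one by (simp add: one_hnn)
  next
    case (snoc x u)
    hence u: "u \<in> hnn_words A" and x: "[x] \<in> hnn_words A" and IH: "R (hnn_class A C \<phi> u)"
      by (auto simp: hnn_words_def)
    have uG: "hnn_class A C \<phi> u \<in> carrier GG" using u by (auto simp: carrier_hnn)
    have eq: "hnn_class A C \<phi> (u @ [x]) = hnn_class A C \<phi> u \<otimes>\<^bsub>GG\<^esub> hnn_class A C \<phi> [x]"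
      using mult_hnn[OF u x] by simp
    show ?case unfolding eq
    proof (cases x)
      case (Base a)
      hence "a \<in> carrier A" using x by (auto simp: hnn_words_def)
      thus "R (hnn_class A C \<phi> u \<otimes>\<^bsub>GG\<^esub> hnn_class A C \<phi> [x])"
        using base[OF uG _ IH] Base by (simp add: hnn_base_def)
    next
      case Stable
      thus "R (hnn_class A C \<phi> u \<otimes>\<^bsub>GG\<^esub> hnn_class A C \<phi> [x])" using stable[OF uG] IH by simp
    next
      case StableInv
      thus "R (hnn_class A C \<phi> u \<otimes>\<^bsub>GG\<^esub> hnn_class A C \<phi> [x])"
        using stable[of "hnn_class A C \<phi> u \<otimes>\<^bsub>GG\<^esub> hnn_class A C \<phi> [x]"] IH t't[OF uG] uG t' by simp
    qed
  qed
  thus ?thesis using g by (auto simp: carrier_hnn)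
qed

end

section \<open>The cocycle of an HNN extension\<close>

text \<open>
  The semidirect product of \<open>G\<close> with its permutation module over the field with two elements on
  the left cosets of \<open>S\<close>; vectors are finite sets of cosets.
\<close>

definition coset_semidirect :: "('g, 'h) monoid_scheme \<Rightarrow> 'g set \<Rightarrow> ('g set set \<times> 'g) monoid" where
  "coset_semidirect G S =
     \<lparr>carrier = {X. finite X \<and> X \<subseteq> {x <#\<^bsub>G\<^esub> S | x. x \<in> carrier G}} \<times> carrier G,
      mult = (\<lambda>(X, g) (Y, h). (sym_diff X ((\<lambda>e. g <#\<^bsub>G\<^esub> e) ` Y), g \<otimes>\<^bsub>G\<^esub> h)),
      one = ({}, \<one>\<^bsub>G\<^esub>)\<rparr>"

lemma (in group) group_coset_semidirect:
  assumes S: "subgroup S G"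
  shows "group (coset_semidirect G S)"
proof -
  let ?E = "{x <# S | x. x \<in> carrier G}"
  have SG: "S \<subseteq> carrier G" by (rule subgroup.subset[OF S])
  have EG: "e \<subseteq> carrier G" if "e \<in> ?E" for e using that l_coset_subset_G[OF SG] by blast
  have act_E: "g <# e \<in> ?E" if "g \<in> carrier G" "e \<in> ?E" for g e
    using that lcoset_mult[OF SG that(1)] by blast
  have act_mult: "(\<lambda>e. g <# e) ` (\<lambda>e. h <# e) ` X = (\<lambda>e. (g \<otimes> h) <# e) ` X"
    if "g \<in> carrier G" "h \<in> carrier G" "X \<subseteq> ?E" for g h X
    unfolding image_image
  proof (rule image_cong[OF HOL.refl])
    fix e assume "e \<in> X"
    hence "e \<subseteq> carrier G" by (rule EG[OF subsetD[OF that(3)]])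
    thus "g <# (h <# e) = (g \<otimes> h) <# e" using that(1,2) by (rule lcoset_mult)
  qed
  have act_one: "(\<lambda>e. \<one> <# e) ` X = X" if "X \<subseteq> ?E" for X
  proof -
    have "(\<lambda>e. \<one> <# e) ` X = (\<lambda>e. e) ` X"
      by (rule image_cong[OF HOL.refl]) (rule lcos_mult_one[OF EG[OF subsetD[OF that]]])
    thus ?thesis by simp
  qed
  have act_diff: "(\<lambda>e. g <# e) ` sym_diff X Y = sym_diff ((\<lambda>e. g <# e) ` X) ((\<lambda>e. g <# e) ` Y)"
    if "g \<in> carrier G" "X \<subseteq> ?E" "Y \<subseteq> ?E" for g X Y
  proof -
    have inj: "inj_on (\<lambda>e. g <# e) ?E"
      by (rule inj_on_inverseI[where g = "\<lambda>e. inv g <# e"]) (rule lcoset_cancel(1)[OF EG that(1)])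
    show ?thesis
      using inj_on_image_set_diff[OF inj, of X Y] inj_on_image_set_diff[OF inj, of Y X] that(2,3)
      by (simp add: image_Un Diff_subset[THEN subset_trans])
  qed
  have mult: "(X, g) \<otimes>\<^bsub>coset_semidirect G S\<^esub> (Y, h) = (sym_diff X ((\<lambda>e. g <# e) ` Y), g \<otimes> h)" for X g Y h
    by (simp add: coset_semidirect_def)
  have carr: "(X, g) \<in> carrier (coset_semidirect G S) \<longleftrightarrow> finite X \<and> X \<subseteq> ?E \<and> g \<in> carrier G" for X g
    by (auto simp: coset_semidirect_def)
  have one: "\<one>\<^bsub>coset_semidirect G S\<^esub> = ({}, \<one>)" by (simp add: coset_semidirect_def)
  have act_sub: "(\<lambda>e. g <# e) ` Y \<subseteq> ?E" if "g \<in> carrier G" "Y \<subseteq> ?E" for g Y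
    by (rule image_subsetI) (rule act_E[OF that(1) subsetD[OF that(2)]])
  show ?thesis
  proof (rule groupI)
    show "\<one>\<^bsub>coset_semidirect G S\<^esub> \<in> carrier (coset_semidirect G S)" by (simp add: one carr)
    fix p assume p: "p \<in> carrier (coset_semidirect G S)"
    obtain X g where pX: "p = (X, g)" by (cases p)
    have X: "finite X" "X \<subseteq> ?E" and g: "g \<in> carrier G" using p carr unfolding pX by blast+
    show "\<one>\<^bsub>coset_semidirect G S\<^esub> \<otimes>\<^bsub>coset_semidirect G S\<^esub> p = p"
      unfolding one pX mult using act_one[OF X(2)] g by simp
    show "\<exists>q\<in>carrier (coset_semidirect G S). q \<otimes>\<^bsub>coset_semidirect G S\<^esub> p = \<one>\<^bsub>coset_semidirect G S\<^esub>"
    proof (rule bexI)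
      show "((\<lambda>e. inv g <# e) ` X, inv g) \<otimes>\<^bsub>coset_semidirect G S\<^esub> p = \<one>\<^bsub>coset_semidirect G S\<^esub>"
        unfolding one pX mult using g by simp
      show "((\<lambda>e. inv g <# e) ` X, inv g) \<in> carrier (coset_semidirect G S)"
        unfolding carr using X(1) g act_sub[OF inv_closed[OF g] X(2)] by simp
    qed
    fix q assume q: "q \<in> carrier (coset_semidirect G S)"
    obtain Y h where qY: "q = (Y, h)" by (cases q)
    have Y: "finite Y" "Y \<subseteq> ?E" and h: "h \<in> carrier G" using q carr unfolding qY by blast+
    have gY: "(\<lambda>e. g <# e) ` Y \<subseteq> ?E" by (rule act_sub[OF g Y(2)])
    have XgY: "sym_diff X ((\<lambda>e. g <# e) ` Y) \<subseteq> ?E" using X(2) gY by (intro Un_least) (rule order.trans[OF Diff_subset], assumption)+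
    show "p \<otimes>\<^bsub>coset_semidirect G S\<^esub> q \<in> carrier (coset_semidirect G S)"
      unfolding pX qY mult carr using X(1) Y(1) XgY g h by simp
    fix r assume r: "r \<in> carrier (coset_semidirect G S)"
    obtain Z k where rZ: "r = (Z, k)" by (cases r)
    have Z: "Z \<subseteq> ?E" and k: "k \<in> carrier G" using r carr unfolding rZ by blast+
    have hZ: "(\<lambda>e. h <# e) ` Z \<subseteq> ?E" by (rule act_sub[OF h Z])
    show "p \<otimes>\<^bsub>coset_semidirect G S\<^esub> q \<otimes>\<^bsub>coset_semidirect G S\<^esub> r =
        p \<otimes>\<^bsub>coset_semidirect G S\<^esub> (q \<otimes>\<^bsub>coset_semidirect G S\<^esub> r)"
      unfolding pX qY rZ mult act_diff[OF g Y(2) hZ] act_mult[OF g h Z]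
      using g h k by (auto simp: m_assoc)
  qed
qed

context hnn_iso
begin

text \<open>
  A map \<open>d\<close> is a cocycle exactly when \<open>g \<mapsto> (d g, g)\<close> is a homomorphism to the semidirect product. So the
  universal property provides \<open>d\<close>, once \<open>({}, a)\<close> and \<open>({E}, t)\<close> satisfy the defining relations;
  this holds as \<open>cE = E\<close> for \<open>c \<in> C\<close>.
\<close>

lemma hnn_tree_structure: "\<exists>d. hnn_tree GG A (hnn_base A C \<phi>) C tt d"
proof -
  interpret G: group GG by (rule group_hnn_extension)
  interpret b: group_hom A GG "hnn_base A C \<phi>" using hnn_base_hom by unfold_locales
  let ?b = "hnn_base A C \<phi>"
  define E where "E = ?b ` C"
  have E: "subgroup E GG" unfolding E_def by (rule b.subgroup_img_is_subgroup[OF C])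
  have EG: "E \<subseteq> carrier GG" by (rule subgroup.subset[OF E])
  define M where "M = coset_semidirect GG E"
  interpret M: group M unfolding M_def by (rule G.group_coset_semidirect[OF E])
  have t: "tt \<in> carrier GG" by (auto simp: carrier_hnn hnn_words_def)
  have mult: "(X, g) \<otimes>\<^bsub>M\<^esub> (Y, h) = (sym_diff X ((\<lambda>e. g <#\<^bsub>GG\<^esub> e) ` Y), g \<otimes>\<^bsub>GG\<^esub> h)" for X g Y h
    by (simp add: M_def coset_semidirect_def)
  have carr: "(X, g) \<in> carrier M \<longleftrightarrow> finite X \<and> X \<subseteq> {x <#\<^bsub>GG\<^esub> E | x. x \<in> carrier GG} \<and> g \<in> carrier GG" for X g
    by (auto simp: M_def coset_semidirect_def)
  have oneM: "\<one>\<^bsub>M\<^esub> = ({}, \<one>\<^bsub>GG\<^esub>)" by (simp add: M_def coset_semidirect_def)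
  have E_edge: "E \<in> {x <#\<^bsub>GG\<^esub> E | x. x \<in> carrier GG}"
    using G.lcos_mult_one[OF EG] G.one_closed by (metis (mono_tags, lifting) mem_Collect_eq)
  define \<psi> where "\<psi> = (\<lambda>a. ({} :: 'a hnn_letter list set set set, ?b a))"
  define s where "s = ({E}, tt)"
  have sM: "s \<in> carrier M" unfolding s_def carr using E_edge t by simp
  have \<psi>M: "\<psi> a \<in> carrier M" if "a \<in> carrier A" for a unfolding \<psi>_def carr using that by simp
  have \<psi>_hom: "\<psi> \<in> hom A M"
    by (rule homI) (use \<psi>M in \<open>auto simp: \<psi>_def mult\<close>)
  have rel: "inv\<^bsub>M\<^esub> s \<otimes>\<^bsub>M\<^esub> \<psi> c \<otimes>\<^bsub>M\<^esub> s = \<psi> (\<phi> c)" if c: "c \<in> C" for c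
  proof -
    have cA: "c \<in> carrier A" "\<phi> c \<in> carrier A" using c C_in \<phi>_in by auto
    have "tt \<otimes>\<^bsub>GG\<^esub> (inv\<^bsub>GG\<^esub> tt \<otimes>\<^bsub>GG\<^esub> ?b c \<otimes>\<^bsub>GG\<^esub> tt) = tt \<otimes>\<^bsub>GG\<^esub> ?b (\<phi> c)"
      using hnn_relation[OF c] by simp
    hence "?b c \<otimes>\<^bsub>GG\<^esub> tt = tt \<otimes>\<^bsub>GG\<^esub> ?b (\<phi> c)" using t cA by (simp add: G.m_assoc G.cancel_left)
    moreover have "?b c <#\<^bsub>GG\<^esub> E = E"
      using c cA unfolding E_def[symmetric] by (intro G.coset_join3[OF _ E]) (auto simp: E_def)
    ultimately have "\<psi> c \<otimes>\<^bsub>M\<^esub> s = s \<otimes>\<^bsub>M\<^esub> \<psi> (\<phi> c)" by (simp add: \<psi>_def s_def mult)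
    thus ?thesis using sM \<psi>M[OF cA(1)] \<psi>M[OF cA(2)] by (simp add: M.m_assoc M.cancel_left)
  qed
  obtain h where h: "h \<in> hom GG M" "\<forall>a\<in>carrier A. h (?b a) = \<psi> a" "h tt = s"
    using hnn_extension_lift[OF M.is_group \<psi>_hom sM rel] by blast
  interpret h: group_hom GG M h using h(1) by unfold_locales
  have snd_mult: "snd (p \<otimes>\<^bsub>M\<^esub> q) = snd p \<otimes>\<^bsub>GG\<^esub> snd q" for p q
    by (cases p, cases q) (simp add: mult)
  have snd_in: "snd (h x) \<in> carrier GG" if "x \<in> carrier GG" for x
    using h.hom_closed[OF that] carr by (cases "h x") simp
  have snd: "snd (h g) = g" if "g \<in> carrier GG" for g
    using that
  proof (rule hnn_generation[where R = "\<lambda>g. snd (h g) = g"])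
    show "snd (h \<one>\<^bsub>GG\<^esub>) = \<one>\<^bsub>GG\<^esub>" by (simp add: oneM)
    show "snd (h (x \<otimes>\<^bsub>GG\<^esub> ?b a)) = x \<otimes>\<^bsub>GG\<^esub> ?b a" if "x \<in> carrier GG" "a \<in> carrier A" "snd (h x) = x" for x a
      using that h(2) by (simp add: snd_mult \<psi>_def)
    show "snd (h x) = x \<longleftrightarrow> snd (h (x \<otimes>\<^bsub>GG\<^esub> tt)) = x \<otimes>\<^bsub>GG\<^esub> tt" if "x \<in> carrier GG" for x
      using that h(3) t snd_in[OF that] by (simp add: snd_mult s_def)
  qed
  define d where "d = (\<lambda>g. fst (h g))"
  have hd: "h g = (d g, g)" if "g \<in> carrier GG" for g using snd[OF that] by (simp add: d_def prod_eq_iff)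
  have d_carr: "finite (d g) \<and> d g \<subseteq> {x <#\<^bsub>GG\<^esub> E | x. x \<in> carrier GG}" if "g \<in> carrier GG" for g
    using h.hom_closed[OF that] unfolding hd[OF that] carr by blast
  have "hnn_tree GG A ?b C tt d"
  proof (intro hnn_tree.intro hnn_tree_axioms.intro, goal_cases)
    case 1 show ?case by (rule group_hnn_extension)
  next
    case 2 show ?case by (rule is_group)
  next
    case 3 show ?case by (rule hnn_base_hom)
  next
    case 4 show ?case by (rule hnn_base_inj)
  next
    case 5 show ?case by (rule C)
  next
    case 6 show ?case by (rule t)
  next
    case (7 c)
    thus ?case unfolding hnn_relation[OF 7] using \<phi>_in by blast
  next
    case (8 g) thus ?case using d_carr by blast
  next
    case (9 g) thus ?case using d_carr unfolding E_def by blast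
  next
    case (10 a) thus ?case using h(2) by (simp add: d_def \<psi>_def)
  next
    case 11 show ?case using h(3) by (simp add: d_def s_def E_def)
  next
    case (12 g g')
    have "h (g \<otimes>\<^bsub>GG\<^esub> g') = (d g, g) \<otimes>\<^bsub>M\<^esub> (d g', g')"
      unfolding hd[OF 12(1), symmetric] hd[OF 12(2), symmetric] by (rule h.hom_mult[OF 12])
    thus ?case unfolding mult using hd[of "g \<otimes>\<^bsub>GG\<^esub> g'"] 12 by simp
  next
    case (13 g R) thus ?case by (intro hnn_generation[of g R])
  qed
  thus ?thesis by blast
qed

end

theorem theoremH:
  fixes A :: "('a, 'b) monoid_scheme" and C :: "'a set" and \<phi> :: "'a \<Rightarrow> 'a"
  assumes "group A"
    and "subgroup C A" and "subgroup (\<phi> ` C) A"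
    and "\<phi> \<in> iso (A\<lparr>carrier := C\<rparr>) (A\<lparr>carrier := \<phi> ` C\<rparr>)"
    and "fcip_rel A C"
    and "pair_fgip A C"
    and "sfgip (A\<lparr>carrier := C\<rparr>)"
  shows "fgip (hnn_extension A C \<phi>) \<longleftrightarrow>
         fgip_rel (hnn_extension A C \<phi>) (hnn_base A C \<phi> ` C)"
proof -
  interpret A: group A by fact
  interpret hnn_iso A C \<phi> by (intro hnn_iso.intro hnn_iso_axioms.intro assms(1-4))
  obtain d where "hnn_tree (hnn_extension A C \<phi>) A (hnn_base A C \<phi>) C (hnn_class A C \<phi> [Stable]) d"
    using hnn_tree_structure by blast
  then interpret T: hnn_tree "hnn_extension A C \<phi>" A "hnn_base A C \<phi>" C "hnn_class A C \<phi> [Stable]" d .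
  show ?thesis
  proof
    assume "fgip (hnn_extension A C \<phi>)"
    moreover have "fg_subgroup (hnn_base A C \<phi> ` C) (hnn_extension A C \<phi>)"
      using fg_subgroup_hom_image[OF T.is_group assms(1) hnn_base_hom] assms(5)
      by (simp add: fcip_rel_def)
    ultimately show "fgip_rel (hnn_extension A C \<phi>) (hnn_base A C \<phi> ` C)"
      unfolding fgip_def fgip_rel_def by blast
  next
    assume "fgip_rel (hnn_extension A C \<phi>) (hnn_base A C \<phi> ` C)"
    thus "fgip (hnn_extension A C \<phi>)" by (rule T.fgip_if_fgip_rel[OF assms(5-7)])
  qed
qed

end
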